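(* Let $d\in\mathbb{N}$, let $g:\mathbb{R}\to\mathbb{R}$ and $f:\mathbb{T}^d\to\mathbb{R}$ be real analytic, and consider the ordinary differential equation in $\mathbb{R}$ $$\varepsilon\,\ddot x+\dot x+\varepsilon\,g(x)=\varepsilon\,f(\omega t),$$ where $\varepsilon\in\mathbb{R}$ is a small parameter and $\omega\in\mathbb{R}^d$. Let $f_{0}$ denote the average of $f$ over $\mathbb{T}^d$ (its Fourier coefficient of index $0\in\mathbb{Z}^d$), and assume that the function $x\mapsto g(x)-f_{0}$ has a simple zero $c_0\in\mathbb{R}$. Then for any frequency vector $\omega\in\mathbb{R}^d$ (with rationally independent components, that is, $\omega\cdot\nu\neq0$ for all $\nu\in\mathbb{Z}^d\setminus\{0\}$) there exists $\varepsilon_0>0$ such that for all $|\varepsilon|<\varepsilon_0$ there is at least one quasi-periodic solution $x_0(t)=c_0+X(\omega t,\varepsilon)$ to the equation, such that $X(\psi,\varepsilon)$ is analytic in $\psi$ and goes to $0$ as $\varepsilon\to0$. If $g'(c_0)>0$, the solution is locally attractive in the plane $(x,\dot x)$ and hence unique in a neighbourhood of $(c_0,0)$.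
   Context: $\mathbb{T}=\mathbb{R}/2\pi\mathbb{Z}$. Fourier expansion: $f(\psi)=\sum_{\nu\in\mathbb{Z}^d}e^{\mathrm{i}\nu\cdot\psi}f_\nu$. A simple zero $c_0$ of $g(x)-f_0$ means $g(c_0)=f_0$ and $g'(c_0)\neq0$. Locally attractive in the plane $(x,\dot x)$ means that the trajectories $(x(t),\dot x(t))$ of the equation starting close enough to $(x_0(t),\dot x_0(t))$ converge to it as $t\to+\infty$. Uniqueness in a neighbourhood of $(c_0,0)$ means that it is the only quasi-periodic solution for which $(x(t),\dot x(t))$ stays in that neighbourhood.
   Formalization: If g'(c_0)>0, local attractivity is claimed only for 0<ε<ε_0 and uniqueness only for 0<|ε|<ε_0: for ε<0 the solution is repelling, and for ε=0 every constant is a solution, so the claim for all |ε|<ε_0 is false. *)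

theory Defs
  imports "HOL-Analysis.Analysis"
begin

text \<open>
  Real analyticity on a Euclidean space: around every point the function is the sum of an
  (unconditionally convergent) power series in the coordinates. Multi-indices are the functions
  \<open>\<alpha> \<in> Basis \<rightarrow>\<^sub>E UNIV\<close>, since \<open>Basis\<close> indexes the coordinates; for
  \<open>real\<close> this is the usual power series in one variable.
\<close>

definition real_analytic :: "('a::euclidean_space \<Rightarrow> real) \<Rightarrow> bool" where
  "real_analytic h \<longleftrightarrow>
     (\<forall>p. \<exists>r>0. \<exists>a :: ('a \<Rightarrow> nat) \<Rightarrow> real. \<forall>x\<in>ball p r.
        ((\<lambda>\<alpha>. a \<alpha> * (\<Prod>b\<in>Basis. ((x - p) \<bullet> b) ^ \<alpha> b)) has_sum h x)
          (Basis \<rightarrow>\<^sub>E (UNIV :: nat set)))"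

text \<open>
  A function on the torus \<open>(\<real> / 2\<pi>\<int>)\<^sup>d\<close> is represented by its lift, a function on
  \<open>\<real>\<^sup>d\<close> that is \<open>2\<pi>\<close>-periodic in each coordinate.
\<close>

definition torus_periodic :: "(real ^ 'd \<Rightarrow> real) \<Rightarrow> bool" where
  "torus_periodic h \<longleftrightarrow> (\<forall>\<psi> i. h (\<psi> + axis i (2 * pi)) = h \<psi>)"

definition torus_average :: "(real ^ 'd \<Rightarrow> real) \<Rightarrow> real" where
  "torus_average h = integral (cbox 0 (\<chi> i. 2 * pi)) h / (2 * pi) ^ CARD('d)"

definition rationally_independent :: "real ^ 'd \<Rightarrow> bool" where
  "rationally_independent \<omega> \<longleftrightarrow>
     (\<forall>\<nu> :: int ^ 'd. \<nu> \<noteq> 0 \<longrightarrow> (\<Sum>i\<in>UNIV. \<omega> $ i * of_int (\<nu> $ i)) \<noteq> 0)"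

text \<open>
  Quasi-periodicity with an arbitrary finite number \<open>n\<close> of frequencies
  \<open>w 0, \<dots>, w (n - 1)\<close>. As \<open>n\<close> is bound inside the formula, a continuous function on the
  \<open>n\<close>-torus is encoded as a function of sequences that only depends on the first
  \<open>n\<close> entries; continuity for the product topology then is continuity on \<open>\<real>\<^sup>n\<close>.
\<close>

definition quasi_periodic :: "(real \<Rightarrow> real) \<Rightarrow> bool" where
  "quasi_periodic x \<longleftrightarrow>
     (\<exists>(n::nat) (w :: nat \<Rightarrow> real) (F :: (nat \<Rightarrow> real) \<Rightarrow> real).
        continuous_on UNIV F \<and>
        (\<forall>\<phi> \<phi>'. (\<forall>i<n. \<phi> i = \<phi>' i) \<longrightarrow> F \<phi> = F \<phi>') \<and>
        (\<forall>\<phi>. \<forall>i<n. F (\<phi>(i := \<phi> i + 2 * pi)) = F \<phi>) \<and>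
        (\<forall>t. x t = F (\<lambda>i. t * w i)))"

text \<open>
  \<open>(x, v)\<close> is a trajectory of \<open>\<epsilon> x'' + x' + \<epsilon> g(x) = \<epsilon> f(\<omega> t)\<close>
  in the plane of positions and velocities, over the time interval \<open>I\<close>.
\<close>

definition trajectory_on ::
  "real \<Rightarrow> (real \<Rightarrow> real) \<Rightarrow> (real ^ 'd \<Rightarrow> real) \<Rightarrow> real ^ 'd \<Rightarrow> real set \<Rightarrow>
     (real \<Rightarrow> real) \<Rightarrow> (real \<Rightarrow> real) \<Rightarrow> bool" where
  "trajectory_on \<epsilon> g f \<omega> I x v \<longleftrightarrow>
     (\<forall>t\<in>I. (x has_real_derivative v t) (at t within I) \<and>
       (\<exists>a. (v has_real_derivative a) (at t within I) \<and>
            \<epsilon> * a + v t + \<epsilon> * g (x t) = \<epsilon> * f (t *\<^sub>R \<omega>)))"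

definition solution ::
  "real \<Rightarrow> (real \<Rightarrow> real) \<Rightarrow> (real ^ 'd \<Rightarrow> real) \<Rightarrow> real ^ 'd \<Rightarrow> (real \<Rightarrow> real) \<Rightarrow> bool" where
  "solution \<epsilon> g f \<omega> x \<longleftrightarrow> trajectory_on \<epsilon> g f \<omega> UNIV x (deriv x)"

text \<open>
  For every initial time \<open>\<tau>\<close>, every initial datum \<open>(a, b)\<close> close enough to
  \<open>(x0 \<tau>, x0' \<tau>)\<close> has a trajectory defined for all later times (no blow-up), and every such
  trajectory converges to that of \<open>x0\<close>.
\<close>

definition locally_attractive ::
  "real \<Rightarrow> (real \<Rightarrow> real) \<Rightarrow> (real ^ 'd \<Rightarrow> real) \<Rightarrow> real ^ 'd \<Rightarrow> (real \<Rightarrow> real) \<Rightarrow> bool" where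
  "locally_attractive \<epsilon> g f \<omega> x0 \<longleftrightarrow>
     (\<forall>\<tau>. \<exists>\<delta>>0. \<forall>a b. dist (a, b) (x0 \<tau>, deriv x0 \<tau>) < \<delta> \<longrightarrow>
        (\<exists>x v. trajectory_on \<epsilon> g f \<omega> {\<tau>..} x v \<and> x \<tau> = a \<and> v \<tau> = b) \<and>
        (\<forall>x v. trajectory_on \<epsilon> g f \<omega> {\<tau>..} x v \<and> x \<tau> = a \<and> v \<tau> = b \<longrightarrow>
           ((\<lambda>t. dist (x t, v t) (x0 t, deriv x0 t)) \<longlongrightarrow> 0) at_top))"

definition unique_quasi_periodic_in ::
  "(real \<times> real) set \<Rightarrow> real \<Rightarrow> (real \<Rightarrow> real) \<Rightarrow> (real ^ 'd \<Rightarrow> real) \<Rightarrow> real ^ 'd \<Rightarrow>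
     (real \<Rightarrow> real) \<Rightarrow> bool" where
  "unique_quasi_periodic_in U \<epsilon> g f \<omega> x0 \<longleftrightarrow>
     (\<forall>x. solution \<epsilon> g f \<omega> x \<and> quasi_periodic x \<and> (\<forall>t. (x t, deriv x t) \<in> U) \<longleftrightarrow> x = x0)"

end

theory Submission
  imports Defs
begin

text \<open>
  Write \<open>D = \<omega> \<cdot> \<partial>\<^sub>\<psi>\<close> and \<open>a = g' (c\<^sub>0)\<close>. A quasi-periodic solution \<open>c\<^sub>0 + X (\<omega> t)\<close> is a fixed point
  of \<open>X \<mapsto> \<epsilon> (\<epsilon> D\<^sup>2 + D + \<epsilon> a)\<^sup>-\<^sup>1 (f - f\<^sub>0 - N (X))\<close>, where \<open>N\<close> is the part of \<open>g (c\<^sub>0 + X)\<close>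
  of order at least two. On a mode with \<open>D = \<i> s\<close> the operator is multiplication by
  \<open>\<epsilon> / (\<epsilon> (a - s\<^sup>2) + \<i> s)\<close>. This is bounded uniformly in \<open>s\<close> and \<open>\<epsilon>\<close>, whatever the small divisors, so
  the map is a contraction in the weighted Wiener algebra of the exponentially decaying Fourier
  series, and no Diophantine condition is needed. For each \<open>s \<noteq> 0\<close> the multiplier tends to \<open>0\<close> with \<open>\<epsilon>\<close>;
  as \<open>f - f\<^sub>0\<close> has no resonant mode, dominated convergence gives \<open>X \<rightarrow> 0\<close>.

  If \<open>a > 0\<close>, a quadratic Lyapunov function of the difference of two trajectories near \<open>c\<^sub>0\<close> decays
  exponentially for \<open>\<epsilon> > 0\<close>. Forwards in time this gives attraction, backwards in time it forces two bounded
  solutions to coincide. Reversing time exchanges \<open>\<epsilon>\<close> and \<open>- \<epsilon>\<close>, hence uniqueness also for \<open>\<epsilon> < 0\<close>.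
\<close>

section \<open>The convolution algebra of summable families\<close>

typedef 'a l1 = "{c :: 'a \<Rightarrow> complex. (\<lambda>m. norm (c m)) summable_on UNIV}"
  morphisms coef Abs_l1
  by (rule exI[of _ "\<lambda>_. 0"]) simp

setup_lifting type_definition_l1

lemma abs_summable_coef [simp]: "(\<lambda>m. norm (coef x m)) summable_on A"
  using coef[of x] summable_on_subset_banach[of _ UNIV A] by auto

lemma coef_inject_iff: "x = y \<longleftrightarrow> (\<forall>m. coef x m = coef y m)"
  by (metis coef_inject ext)

lemma abs_summable_coef_mult:
  assumes "\<And>m. norm (\<phi> m) \<le> B"
  shows "(\<lambda>m. norm (coef x m * \<phi> m)) summable_on A"
proof (rule summable_on_comparison_test)
  show "(\<lambda>m. norm (coef x m) * B) summable_on A"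
    by (intro summable_on_cmult_left) simp
  show "norm (coef x m * \<phi> m) \<le> norm (coef x m) * B" for m
    unfolding norm_mult by (intro mult_left_mono assms) simp
qed auto

lemma abs_summable_add_diff:
  fixes c d :: "'a \<Rightarrow> complex"
  assumes "(\<lambda>m. norm (c m)) summable_on A" "(\<lambda>m. norm (d m)) summable_on A"
  shows "(\<lambda>m. norm (c m + d m)) summable_on A" "(\<lambda>m. norm (c m - d m)) summable_on A"
  by (rule summable_on_comparison_test[OF summable_on_add[OF assms]];
      simp add: norm_triangle_ineq norm_triangle_ineq4)+

instantiation l1 :: (type) real_vector
begin

lift_definition zero_l1 :: "'a l1" is "\<lambda>_. 0" by simp

lift_definition plus_l1 :: "'a l1 \<Rightarrow> 'a l1 \<Rightarrow> 'a l1" is "\<lambda>c d m. c m + d m"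
  by (rule abs_summable_add_diff(1))

lift_definition uminus_l1 :: "'a l1 \<Rightarrow> 'a l1" is "\<lambda>c m. - c m" by simp

lift_definition minus_l1 :: "'a l1 \<Rightarrow> 'a l1 \<Rightarrow> 'a l1" is "\<lambda>c d m. c m - d m"
  by (rule abs_summable_add_diff(2))

lift_definition scaleR_l1 :: "real \<Rightarrow> 'a l1 \<Rightarrow> 'a l1" is "\<lambda>r c m. r *\<^sub>R c m"
  by (simp add: summable_on_cmult_right)

instance
proof
  fix x y z :: "'a l1" and r s :: real
  show "x + y + z = x + (y + z)" "x + y = y + x" "0 + x = x" "- x + x = 0" "x - y = x + - y"
       "r *\<^sub>R (x + y) = r *\<^sub>R x + r *\<^sub>R y" "(r + s) *\<^sub>R x = r *\<^sub>R x + s *\<^sub>R x"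
       "r *\<^sub>R s *\<^sub>R x = (r * s) *\<^sub>R x" "1 *\<^sub>R x = x"
    by (transfer; simp add: fun_eq_iff algebra_simps)+
qed

end

instantiation l1 :: (type) real_normed_vector
begin

lift_definition norm_l1 :: "'a l1 \<Rightarrow> real" is "\<lambda>c. \<Sum>\<^sub>\<infinity>m. norm (c m)" .

definition dist_l1 :: "'a l1 \<Rightarrow> 'a l1 \<Rightarrow> real" where "dist_l1 x y = norm (x - y)"

definition uniformity_l1 :: "('a l1 \<times> 'a l1) filter" where
  "uniformity_l1 = (INF e\<in>{0<..}. principal {(x, y). dist x y < e})"

definition open_l1 :: "'a l1 set \<Rightarrow> bool" where
  "open_l1 U \<longleftrightarrow> (\<forall>x\<in>U. \<forall>\<^sub>F (x', y) in uniformity. x' = x \<longrightarrow> y \<in> U)"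

definition sgn_l1 :: "'a l1 \<Rightarrow> 'a l1" where "sgn_l1 x = x /\<^sub>R norm x"

instance
proof
  fix x y :: "'a l1" and r :: real and U :: "'a l1 set"
  show "dist x y = norm (x - y)" by (rule dist_l1_def)
  show "sgn x = x /\<^sub>R norm x" by (rule sgn_l1_def)
  show "uniformity = (INF e\<in>{0<..}. principal {(x, y). dist (x::'a l1) y < e})"
    by (rule uniformity_l1_def)
  show "open U \<longleftrightarrow> (\<forall>x\<in>U. \<forall>\<^sub>F (x', y) in uniformity. x' = x \<longrightarrow> y \<in> U)"
    by (rule open_l1_def)
  show "norm x = 0 \<longleftrightarrow> x = 0"
  proof
    assume "norm x = 0"
    then have le: "(\<Sum>\<^sub>\<infinity>m. norm (coef x m)) \<le> 0" by (simp add: norm_l1.rep_eq)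
    have "norm (coef x m) = 0" for m
      by (rule nonneg_infsum_le_0D[OF le abs_summable_coef]) auto
    then show "x = 0" unfolding coef_inject_iff zero_l1.rep_eq by simp
  qed (simp add: norm_l1.rep_eq zero_l1.rep_eq)
  have "(\<Sum>\<^sub>\<infinity>m. norm (coef x m + coef y m)) \<le> (\<Sum>\<^sub>\<infinity>m. norm (coef x m) + norm (coef y m))"
    by (intro infsum_mono abs_summable_add_diff(1) summable_on_add abs_summable_coef norm_triangle_ineq)
  also have "\<dots> = (\<Sum>\<^sub>\<infinity>m. norm (coef x m)) + (\<Sum>\<^sub>\<infinity>m. norm (coef y m))"
    by (intro infsum_add abs_summable_coef)
  finally show "norm (x + y) \<le> norm x + norm y"
    unfolding norm_l1.rep_eq plus_l1.rep_eq .
  show "norm (r *\<^sub>R x) = \<bar>r\<bar> * norm x"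
    unfolding norm_l1.rep_eq scaleR_l1.rep_eq by (simp add: infsum_cmult_right')
qed

end

lemma norm_l1_alt: "norm x = (\<Sum>\<^sub>\<infinity>m. norm (coef x m))"
  by (rule norm_l1.rep_eq)

lemma sum_coef_le_norm: "finite F \<Longrightarrow> (\<Sum>m\<in>F. norm (coef x m)) \<le> norm x"
  unfolding norm_l1_alt by (rule finite_sum_le_infsum) auto

lemma norm_coef_le: "norm (coef x m) \<le> norm x"
  using sum_coef_le_norm[of "{m}" x] by simp

lemma norm_l1_leI:
  assumes "\<And>F. finite F \<Longrightarrow> (\<Sum>m\<in>F. norm (coef x m)) \<le> B"
  shows "norm x \<le> B"
  unfolding norm_l1_alt by (rule infsum_le_finite_sums) (use assms in auto)

instance l1 :: (type) banach
proof
  fix X :: "nat \<Rightarrow> 'a l1"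
  assume C: "Cauchy X"
  have "Cauchy (\<lambda>n. coef (X n) m)" for m
  proof (rule CauchyI)
    fix e :: real assume "e > 0"
    then obtain N where N: "\<And>i j. i \<ge> N \<Longrightarrow> j \<ge> N \<Longrightarrow> norm (X i - X j) < e"
      using CauchyD[OF C] by blast
    have "norm (coef (X i) m - coef (X j) m) < e" if "i \<ge> N" "j \<ge> N" for i j
      using N[OF that] norm_coef_le[of "X i - X j" m] by (simp add: minus_l1.rep_eq)
    then show "\<exists>M. \<forall>i\<ge>M. \<forall>j\<ge>M. norm (coef (X i) m - coef (X j) m) < e" by blast
  qed
  then have "\<exists>l. (\<lambda>n. coef (X n) m) \<longlonglongrightarrow> l" for m
    by (simp add: Cauchy_convergent_iff convergent_def)
  then obtain c where c: "\<And>m. (\<lambda>n. coef (X n) m) \<longlonglongrightarrow> c m" by metis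
  have bound: "\<exists>N. \<forall>n\<ge>N. \<forall>F. finite F \<longrightarrow> (\<Sum>m\<in>F. norm (coef (X n) m - c m)) \<le> e"
    if "e > 0" for e :: real
  proof -
    obtain N where N: "\<And>i j. i \<ge> N \<Longrightarrow> j \<ge> N \<Longrightarrow> norm (X i - X j) < e"
      using CauchyD[OF C \<open>e > 0\<close>] by blast
    have "(\<Sum>m\<in>F. norm (coef (X n) m - c m)) \<le> e" if "n \<ge> N" "finite F" for n F
    proof (rule LIMSEQ_le_const2)
      show "(\<lambda>j. \<Sum>m\<in>F. norm (coef (X n) m - coef (X j) m)) \<longlonglongrightarrow> (\<Sum>m\<in>F. norm (coef (X n) m - c m))"
        by (intro tendsto_intros c)
      have "(\<Sum>m\<in>F. norm (coef (X n) m - coef (X j) m)) \<le> e" if "j \<ge> N" for j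
        using sum_coef_le_norm[OF \<open>finite F\<close>, of "X n - X j"] N[OF \<open>n \<ge> N\<close> that]
        by (simp add: minus_l1.rep_eq)
      then show "\<exists>N. \<forall>j\<ge>N. (\<Sum>m\<in>F. norm (coef (X n) m - coef (X j) m)) \<le> e" by blast
    qed
    then show ?thesis by blast
  qed
  obtain N1 where N1: "\<And>F. finite F \<Longrightarrow> (\<Sum>m\<in>F. norm (coef (X N1) m - c m)) \<le> 1"
    using bound[of 1] by auto
  have "(\<lambda>m. norm (coef (X N1) m - c m)) summable_on UNIV"
    by (rule nonneg_bounded_partial_sums_imp_summable_on[of _ _ 1])
      (use N1 in \<open>auto intro!: eventually_finite_subsets_at_top_weakI\<close>)
  then have "(\<lambda>m. norm (coef (X N1) m) + norm (coef (X N1) m - c m)) summable_on UNIV"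
    by (intro summable_on_add) auto
  then have "(\<lambda>m. norm (c m)) summable_on UNIV"
  proof (rule summable_on_comparison_test)
    show "norm (c m) \<le> norm (coef (X N1) m) + norm (coef (X N1) m - c m)" for m
      using norm_triangle_ineq4[of "coef (X N1) m" "coef (X N1) m - c m"] by simp
  qed auto
  then have coef: "coef (Abs_l1 c) = c" by (simp add: Abs_l1_inverse)
  have "X \<longlonglongrightarrow> Abs_l1 c"
  proof (rule LIMSEQ_I)
    fix r :: real assume "r > 0"
    then obtain N where N: "\<And>n F. n \<ge> N \<Longrightarrow> finite F \<Longrightarrow> (\<Sum>m\<in>F. norm (coef (X n) m - c m)) \<le> r / 2"
      using bound[of "r / 2"] by auto
    have "norm (X n - Abs_l1 c) \<le> r / 2" if "n \<ge> N" for n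
      by (rule norm_l1_leI) (use N[OF that] in \<open>simp add: minus_l1.rep_eq coef\<close>)
    then show "\<exists>N. \<forall>n\<ge>N. norm (X n - Abs_l1 c) < r"
      using \<open>r > 0\<close> by (intro exI[of _ N]) force
  qed
  then show "convergent X" by (rule convergentI)
qed

definition pairing :: "'a l1 \<Rightarrow> ('a \<Rightarrow> complex) \<Rightarrow> complex" where
  "pairing x \<phi> = (\<Sum>\<^sub>\<infinity>m. coef x m * \<phi> m)"

definition bdd_fun :: "('a \<Rightarrow> complex) \<Rightarrow> bool" where
  "bdd_fun \<phi> \<longleftrightarrow> (\<exists>B. \<forall>m. norm (\<phi> m) \<le> B)"

lemma summable_pairing: "bdd_fun \<phi> \<Longrightarrow> (\<lambda>m. coef x m * \<phi> m) summable_on A"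
  unfolding bdd_fun_def by (metis abs_summable_coef_mult abs_summable_summable)

lemma norm_pairing_le:
  assumes "\<And>m. norm (\<phi> m) \<le> B"
  shows "norm (pairing x \<phi>) \<le> B * norm x"
proof -
  have "norm (pairing x \<phi>) \<le> (\<Sum>\<^sub>\<infinity>m. norm (coef x m * \<phi> m))"
    unfolding pairing_def by (rule norm_infsum_bound, rule abs_summable_coef_mult, rule assms)
  also have "\<dots> \<le> (\<Sum>\<^sub>\<infinity>m. norm (coef x m) * B)"
    by (rule infsum_mono[OF abs_summable_coef_mult[OF assms] summable_on_cmult_left])
      (simp_all add: norm_mult mult_left_mono assms)
  also have "\<dots> = B * norm x"
    by (simp add: norm_l1_alt infsum_cmult_left')
  finally show ?thesis .
qed

lemma pairing_add: "bdd_fun \<phi> \<Longrightarrow> pairing (x + y) \<phi> = pairing x \<phi> + pairing y \<phi>"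
  unfolding pairing_def plus_l1.rep_eq ring_distribs by (intro infsum_add summable_pairing)

lemma pairing_add_fun: "bdd_fun \<phi> \<Longrightarrow> bdd_fun \<psi> \<Longrightarrow> pairing x (\<lambda>m. \<phi> m + \<psi> m) = pairing x \<phi> + pairing x \<psi>"
  unfolding pairing_def ring_distribs by (intro infsum_add summable_pairing)

lemma pairing_cmult_fun: "pairing x (\<lambda>m. k * \<phi> m) = k * pairing x \<phi>"
  unfolding pairing_def by (subst infsum_cmult_right'[symmetric]) (simp add: mult_ac)

lemma pairing_mult_fun: "pairing x (\<lambda>m. \<phi> m * k) = pairing x \<phi> * k"
  unfolding pairing_def by (subst infsum_cmult_left'[symmetric]) (simp add: mult_ac)

lemma pairing_scaleR: "pairing (r *\<^sub>R x) \<phi> = r *\<^sub>R pairing x \<phi>"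
  unfolding pairing_def scaleR_l1.rep_eq scaleR_conv_of_real mult.assoc
  by (rule infsum_cmult_right')

lemma bounded_linear_pairing: "bdd_fun \<phi> \<Longrightarrow> bounded_linear (\<lambda>x. pairing x \<phi>)"
proof -
  assume b: "bdd_fun \<phi>"
  then obtain B where B: "\<And>m. norm (\<phi> m) \<le> B" by (auto simp: bdd_fun_def)
  show ?thesis
    by (intro bounded_linear_intro[of _ B])
      (use norm_pairing_le[OF B] in \<open>auto simp: pairing_add[OF b] pairing_scaleR mult.commute\<close>)
qed

lemma bdd_fun_indicator: "bdd_fun (\<lambda>m. if P m then 1 else 0)"
  unfolding bdd_fun_def by (rule exI[of _ 1]) auto

lemma pairing_indicator: "pairing x (\<lambda>k. if k = m then 1 else 0) = coef x m"
proof -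
  have "pairing x (\<lambda>k. if k = m then 1 else 0) = (\<Sum>\<^sub>\<infinity>k\<in>{m}. coef x k)"
    unfolding pairing_def by (rule infsum_cong_neutral) auto
  then show ?thesis by simp
qed

lemma l1_eqI:
  assumes "\<And>\<phi>. bdd_fun \<phi> \<Longrightarrow> pairing x \<phi> = pairing y \<phi>"
  shows "x = y"
  using assms[OF bdd_fun_indicator] unfolding coef_inject_iff
  by (metis pairing_indicator)

lemma bdd_fun_pairing:
  assumes "bdd_fun (\<lambda>(a, b). \<phi> a b)"
  shows "bdd_fun (\<lambda>a. pairing y (\<phi> a))"
proof -
  obtain B where B: "\<And>a b. norm (\<phi> a b) \<le> B" using assms by (auto simp: bdd_fun_def)
  show ?thesis unfolding bdd_fun_def
    by (rule exI[of _ "B * norm y"]) (auto intro!: norm_pairing_le B)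
qed

lemma summable_coef_coef: "(\<lambda>(a, b). norm (coef x a * coef y b)) summable_on UNIV"
proof -
  have "(\<lambda>p. norm (coef x (fst p) * coef y (snd p))) summable_on UNIV \<times> UNIV"
    unfolding Infinite_Sum.abs_summable_on_Sigma_iff
    by (auto simp: norm_mult infsum_cmult_right' abs_mult summable_on_cmult_right intro!: summable_on_cmult_left infsum_nonneg)
  then show ?thesis by (simp add: case_prod_unfold)
qed

lemma summable_coef_coef_mult:
  assumes "\<And>a b. norm (\<phi> a b) \<le> B"
  shows "(\<lambda>(a, b). coef x a * coef y b * \<phi> a b) summable_on UNIV"
proof (rule abs_summable_summable, rule summable_on_comparison_test)
  show "(\<lambda>(a, b). norm (coef x a * coef y b) * B) summable_on UNIV"
    using summable_on_cmult_left[OF summable_coef_coef] by (simp add: case_prod_unfold)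
qed (auto simp: norm_mult intro!: mult_left_mono assms)

lemma pairing_pairing:
  assumes "bdd_fun (\<lambda>(a, b). \<phi> a b)"
  shows "pairing x (\<lambda>a. pairing y (\<phi> a)) = (\<Sum>\<^sub>\<infinity>(a, b). coef x a * coef y b * \<phi> a b)"
proof -
  obtain B where B: "\<And>a b. norm (\<phi> a b) \<le> B" using assms by (auto simp: bdd_fun_def)
  have "pairing x (\<lambda>a. pairing y (\<phi> a)) = (\<Sum>\<^sub>\<infinity>a. \<Sum>\<^sub>\<infinity>b. coef x a * coef y b * \<phi> a b)"
    unfolding pairing_def by (simp add: infsum_cmult_right' mult.assoc)
  also have "\<dots> = (\<Sum>\<^sub>\<infinity>(a, b)\<in>UNIV \<times> UNIV. coef x a * coef y b * \<phi> a b)"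
    by (rule infsum_Sigma'_banach) (use summable_coef_coef_mult[OF B] in simp)
  finally show ?thesis by simp
qed

lemma pairing_swap:
  assumes "bdd_fun (\<lambda>(a, b). \<phi> a b)"
  shows "pairing x (\<lambda>a. pairing y (\<phi> a)) = pairing y (\<lambda>b. pairing x (\<lambda>a. \<phi> a b))"
proof -
  have "bdd_fun (\<lambda>(b, a). \<phi> a b)" using assms by (auto simp: bdd_fun_def)
  then have "pairing y (\<lambda>b. pairing x (\<lambda>a. \<phi> a b)) = (\<Sum>\<^sub>\<infinity>(b, a). coef y b * coef x a * \<phi> a b)"
    by (rule pairing_pairing)
  also have "\<dots> = (\<Sum>\<^sub>\<infinity>(a, b). coef x a * coef y b * \<phi> a b)"
    by (rule infsum_reindex_bij_witness[of _ prod.swap prod.swap]) auto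
  finally show ?thesis by (simp add: pairing_pairing[OF assms])
qed

definition conv :: "'a::comm_monoid_add l1 \<Rightarrow> 'a l1 \<Rightarrow> 'a \<Rightarrow> complex" where
  "conv x y m = pairing x (\<lambda>a. pairing y (\<lambda>b. if a + b = m then 1 else 0))"

lemma conv_eq: "conv x y m = (\<Sum>\<^sub>\<infinity>(a, b)\<in>{(a, b). a + b = m}. coef x a * coef y b)"
proof -
  have "bdd_fun (\<lambda>(a, b). if a + b = m then 1 else 0)"
    using bdd_fun_indicator[of "\<lambda>(a, b). a + b = m"] by (simp add: case_prod_unfold)
  then have "conv x y m = (\<Sum>\<^sub>\<infinity>(a, b). coef x a * coef y b * (if a + b = m then 1 else 0))"
    unfolding conv_def by (rule pairing_pairing)
  also have "\<dots> = (\<Sum>\<^sub>\<infinity>(a, b)\<in>{(a, b). a + b = m}. coef x a * coef y b)"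
    by (rule infsum_cong_neutral) auto
  finally show ?thesis .
qed

lemma
  fixes x y :: "'a::comm_monoid_add l1"
  shows abs_summable_conv: "(\<lambda>m. norm (conv x y m)) summable_on UNIV"
    and norm_conv_le: "(\<Sum>\<^sub>\<infinity>m. norm (conv x y m)) \<le> norm x * norm y"
    and pairing_conv: "bdd_fun \<phi> \<Longrightarrow>
      (\<Sum>\<^sub>\<infinity>m. conv x y m * \<phi> m) = pairing x (\<lambda>a. pairing y (\<lambda>b. \<phi> (a + b)))"
proof -
  define S where "S = Sigma (UNIV :: 'a set) (\<lambda>m. {(a, b). a + b = m})"
  have bij: "bij_betw (\<lambda>(a, b). (a + b, (a, b))) UNIV S"
    unfolding S_def by (rule bij_betwI[where g = snd]) auto
  have sumS: "(\<lambda>(m, (a, b)). norm (coef x a * coef y b)) summable_on S"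
    using summable_coef_coef[of x y]
    by (subst summable_on_reindex_bij_betw[OF bij, symmetric]) (simp add: case_prod_unfold)
  have sumSm: "(\<lambda>(a, b). norm (coef x a * coef y b)) summable_on {(a, b). a + b = m}" for m
    by (rule summable_on_subset_banach[OF summable_coef_coef]) auto
  have le: "norm (conv x y m) \<le> (\<Sum>\<^sub>\<infinity>(a, b)\<in>{(a, b). a + b = m}. norm (coef x a * coef y b))" for m
    unfolding conv_eq
    using norm_infsum_bound[of "\<lambda>(a, b). coef x a * coef y b" "{(a, b). a + b = m}"] sumSm[of m]
    by (simp add: case_prod_unfold)
  have s2: "(\<lambda>m. \<Sum>\<^sub>\<infinity>(a, b)\<in>{(a, b). a + b = m}. norm (coef x a * coef y b)) summable_on UNIV"
    using summable_on_Sigma_banach[of "\<lambda>m (a, b). norm (coef x a * coef y b)" UNIV "\<lambda>m. {(a, b). a + b = m}"]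
      sumS unfolding S_def by (simp add: case_prod_unfold)
  show s1: "(\<lambda>m. norm (conv x y m)) summable_on UNIV"
    by (rule summable_on_comparison_test[OF s2 le]) auto
  have "(\<Sum>\<^sub>\<infinity>m. norm (conv x y m)) \<le> (\<Sum>\<^sub>\<infinity>m. \<Sum>\<^sub>\<infinity>(a, b)\<in>{(a, b). a + b = m}. norm (coef x a * coef y b))"
    by (intro infsum_mono s1 s2 le)
  also have "\<dots> = (\<Sum>\<^sub>\<infinity>(m, (a, b))\<in>S. norm (coef x a * coef y b))"
    using infsum_Sigma'_banach[of "\<lambda>m (a, b). norm (coef x a * coef y b)" UNIV "\<lambda>m. {(a, b). a + b = m}"] sumS
    unfolding S_def by (simp add: case_prod_unfold)
  also have "\<dots> = (\<Sum>\<^sub>\<infinity>(a, b). norm (coef x a * coef y b))"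
    by (subst infsum_reindex_bij_betw[OF bij, symmetric]) (simp add: case_prod_unfold)
  also have "\<dots> = (\<Sum>\<^sub>\<infinity>a. \<Sum>\<^sub>\<infinity>b. norm (coef x a * coef y b))"
    using infsum_Sigma'_banach[of "\<lambda>a b. norm (coef x a * coef y b)" UNIV "\<lambda>_. UNIV"] summable_coef_coef[of x y]
    by simp
  also have "\<dots> = norm x * norm y"
    by (simp add: norm_mult infsum_cmult_right' infsum_cmult_left' norm_l1_alt)
  finally show "(\<Sum>\<^sub>\<infinity>m. norm (conv x y m)) \<le> norm x * norm y" .
  assume b: "bdd_fun \<phi>"
  then obtain B where B: "\<And>m. norm (\<phi> m) \<le> B" by (auto simp: bdd_fun_def)
  have sumS': "(\<lambda>(m, (a, b)). coef x a * coef y b * \<phi> m) summable_on S"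
  proof (rule abs_summable_summable, rule summable_on_comparison_test)
    show "(\<lambda>(m, (a, b)). norm (coef x a * coef y b) * B) summable_on S"
      using summable_on_cmult_left[OF sumS] by (simp add: case_prod_unfold)
  qed (auto simp: norm_mult intro!: mult_left_mono B)
  have "(\<Sum>\<^sub>\<infinity>m. conv x y m * \<phi> m) = (\<Sum>\<^sub>\<infinity>m. \<Sum>\<^sub>\<infinity>(a, b)\<in>{(a, b). a + b = m}. coef x a * coef y b * \<phi> m)"
    unfolding conv_eq by (simp add: infsum_cmult_left'[symmetric] case_prod_unfold)
  also have "\<dots> = (\<Sum>\<^sub>\<infinity>(m, (a, b))\<in>S. coef x a * coef y b * \<phi> m)"
    using infsum_Sigma'_banach[of "\<lambda>m (a, b). coef x a * coef y b * \<phi> m" UNIV "\<lambda>m. {(a, b). a + b = m}"] sumS'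
    unfolding S_def by (simp add: case_prod_unfold)
  also have "\<dots> = (\<Sum>\<^sub>\<infinity>(a, b). coef x a * coef y b * \<phi> (a + b))"
    by (subst infsum_reindex_bij_betw[OF bij, symmetric]) (simp add: case_prod_unfold)
  also have "\<dots> = pairing x (\<lambda>a. pairing y (\<lambda>b. \<phi> (a + b)))"
    by (rule pairing_pairing[symmetric]) (auto simp: bdd_fun_def intro: B)
  finally show "(\<Sum>\<^sub>\<infinity>m. conv x y m * \<phi> m) = pairing x (\<lambda>a. pairing y (\<lambda>b. \<phi> (a + b)))" .
qed

lemma bdd_fun_shift:
  assumes "bdd_fun \<phi>"
  shows "bdd_fun (\<lambda>b. \<phi> (a + b))" "bdd_fun (\<lambda>(a, b). \<phi> (a + b))"
    "bdd_fun (\<lambda>a. pairing y (\<lambda>b. \<phi> (a + b)))"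
proof -
  show 1: "bdd_fun (\<lambda>b. \<phi> (a + b))" "bdd_fun (\<lambda>(a, b). \<phi> (a + b))"
    using assms unfolding bdd_fun_def by auto
  show "bdd_fun (\<lambda>a. pairing y (\<lambda>b. \<phi> (a + b)))"
    by (rule bdd_fun_pairing[OF 1(2)])
qed

instantiation l1 :: (comm_monoid_add) comm_ring_1
begin

definition one_l1 :: "'a l1" where "one_l1 = Abs_l1 (\<lambda>m. if m = 0 then 1 else 0)"

definition times_l1 :: "'a l1 \<Rightarrow> 'a l1 \<Rightarrow> 'a l1" where "times_l1 x y = Abs_l1 (conv x y)"

lemma coef_times: "coef (x * y) = conv x y"
  unfolding times_l1_def by (rule Abs_l1_inverse) (simp add: abs_summable_conv)

lemma coef_one: "coef (1 :: 'a l1) = (\<lambda>m. if m = 0 then 1 else 0)"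
proof -
  have "(\<lambda>m :: 'a. norm (if m = 0 then 1 else 0 :: complex)) summable_on UNIV"
    by (rule finite_nonzero_values_imp_summable_on) (auto intro: finite_subset[of _ "{0}"])
  then show ?thesis unfolding one_l1_def by (simp add: Abs_l1_inverse)
qed

lemma pairing_times:
  "bdd_fun \<phi> \<Longrightarrow> pairing (x * y) \<phi> = pairing x (\<lambda>a. pairing y (\<lambda>b. \<phi> (a + b)))"
  unfolding pairing_def[of "x * y"] coef_times by (rule pairing_conv)

lemma pairing_one: "pairing (1 :: 'a l1) \<phi> = \<phi> 0"
proof -
  have "pairing (1 :: 'a l1) \<phi> = (\<Sum>\<^sub>\<infinity>k\<in>{0}. \<phi> k)"
    unfolding pairing_def coef_one by (rule infsum_cong_neutral) auto
  then show ?thesis by simp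
qed

instance
proof
  fix x y z :: "'a l1"
  show "x * y * z = x * (y * z)"
  proof (rule l1_eqI)
    fix \<phi> :: "'a \<Rightarrow> complex" assume b: "bdd_fun \<phi>"
    show "pairing (x * y * z) \<phi> = pairing (x * (y * z)) \<phi>"
      unfolding pairing_times[OF b] pairing_times[OF bdd_fun_shift(3)[OF b]]
        pairing_times[OF bdd_fun_shift(1)[OF b]] add.assoc ..
  qed
  show "x * y = y * x"
  proof (rule l1_eqI)
    fix \<phi> :: "'a \<Rightarrow> complex" assume b: "bdd_fun \<phi>"
    show "pairing (x * y) \<phi> = pairing (y * x) \<phi>"
      unfolding pairing_times[OF b] using pairing_swap[OF bdd_fun_shift(2)[OF b], of x y]
      by (simp only: add.commute)
  qed
  show "1 * x = x"
    by (rule l1_eqI) (simp add: pairing_times pairing_one)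
  show "(x + y) * z = x * z + y * z"
  proof (rule l1_eqI)
    fix \<phi> :: "'a \<Rightarrow> complex" assume b: "bdd_fun \<phi>"
    show "pairing ((x + y) * z) \<phi> = pairing (x * z + y * z) \<phi>"
      unfolding pairing_add[OF b] pairing_times[OF b] pairing_add[OF bdd_fun_shift(3)[OF b]] ..
  qed
  show "(0 :: 'a l1) \<noteq> 1"
    by (metis coef_one zero_l1.rep_eq zero_neq_one)
qed

end

lemma norm_one_l1: "norm (1 :: 'a::comm_monoid_add l1) = 1"
proof -
  have "norm (1 :: 'a::comm_monoid_add l1) = (\<Sum>\<^sub>\<infinity>m\<in>{0::'a}. 1)"
    unfolding norm_l1_alt coef_one by (rule infsum_cong_neutral) auto
  then show ?thesis by simp
qed

instance l1 :: (comm_monoid_add) real_normed_algebra_1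
proof
  fix x y :: "'a l1" and r :: real
  show *: "r *\<^sub>R x * y = r *\<^sub>R (x * y)" for x y :: "'a l1"
  proof (rule l1_eqI)
    fix \<phi> :: "'a \<Rightarrow> complex" assume b: "bdd_fun \<phi>"
    show "pairing (r *\<^sub>R x * y) \<phi> = pairing (r *\<^sub>R (x * y)) \<phi>"
      unfolding pairing_scaleR pairing_times[OF b] ..
  qed
  show "x * r *\<^sub>R y = r *\<^sub>R (x * y)"
    using *[of y x] by (simp only: mult.commute)
  show "norm (x * y) \<le> norm x * norm y"
    unfolding norm_l1_alt[of "x * y"] coef_times by (rule norm_conv_le)
  show "norm (1 :: 'a l1) = 1" by (rule norm_one_l1)
qed

lemma pairing_mult_character:
  assumes "bdd_fun h" "\<And>a b. h (a + b) = h a * h b"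
  shows "pairing (x * y) h = pairing x h * pairing y h"
  unfolding pairing_times[OF assms(1)] assms(2) pairing_cmult_fun by (rule pairing_mult_fun)

lemma pairing_power_character:
  assumes "bdd_fun h" "\<And>a b. h (a + b) = h a * h b" "h 0 = 1"
  shows "pairing (x ^ n) h = pairing x h ^ n"
proof (induction n)
  case (Suc n)
  have "pairing (x * x ^ n) h = pairing x h * pairing (x ^ n) h"
    using assms(1,2) by (rule pairing_mult_character)
  then show ?case using Suc by simp
qed (simp add: pairing_one assms(3))

definition multiplier :: "('a \<Rightarrow> complex) \<Rightarrow> 'a l1 \<Rightarrow> 'a l1" where
  "multiplier \<mu> x = Abs_l1 (\<lambda>m. \<mu> m * coef x m)"

lemma coef_multiplier: "bdd_fun \<mu> \<Longrightarrow> coef (multiplier \<mu> x) m = \<mu> m * coef x m"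
proof -
  assume "bdd_fun \<mu>"
  then obtain B where B: "\<And>m. norm (\<mu> m) \<le> B" by (auto simp: bdd_fun_def)
  have "(\<lambda>m. norm (\<mu> m * coef x m)) summable_on UNIV"
    using abs_summable_coef_mult[of \<mu> B x UNIV, OF B] by (simp add: norm_mult mult.commute)
  then show ?thesis unfolding multiplier_def by (simp add: Abs_l1_inverse)
qed

lemma norm_multiplier_le:
  assumes "\<And>m. norm (\<mu> m) \<le> B"
  shows "norm (multiplier \<mu> x) \<le> B * norm x"
proof (rule norm_l1_leI)
  fix F :: "'a set" assume F: "finite F"
  have b: "bdd_fun \<mu>" using assms by (auto simp: bdd_fun_def)
  have "0 \<le> B" using order.trans[OF norm_ge_zero assms] .
  have "(\<Sum>m\<in>F. norm (coef (multiplier \<mu> x) m)) \<le> (\<Sum>m\<in>F. B * norm (coef x m))"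
    by (rule sum_mono) (simp add: coef_multiplier[OF b] norm_mult mult_right_mono[OF assms norm_ge_zero])
  also have "\<dots> \<le> B * norm x"
    unfolding sum_distrib_left[symmetric] by (intro mult_left_mono sum_coef_le_norm F \<open>0 \<le> B\<close>)
  finally show "(\<Sum>m\<in>F. norm (coef (multiplier \<mu> x) m)) \<le> B * norm x" .
qed

lemma multiplier_diff: "bdd_fun \<mu> \<Longrightarrow> multiplier \<mu> (x - y) = multiplier \<mu> x - multiplier \<mu> y"
  unfolding coef_inject_iff by (simp add: coef_multiplier minus_l1.rep_eq right_diff_distrib)

lemma pairing_multiplier: "bdd_fun \<mu> \<Longrightarrow> pairing (multiplier \<mu> x) \<phi> = pairing x (\<lambda>m. \<mu> m * \<phi> m)"
  unfolding pairing_def by (rule infsum_cong) (simp add: coef_multiplier)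

section \<open>The fixed point equation\<close>

definition star :: "('a \<Rightarrow> 'a) \<Rightarrow> 'a l1 \<Rightarrow> 'a l1" where
  "star \<sigma> x = Abs_l1 (\<lambda>m. cnj (coef x (\<sigma> m)))"

lemma coef_star:
  assumes "\<And>m. \<sigma> (\<sigma> m) = m"
  shows "coef (star \<sigma> x) m = cnj (coef x (\<sigma> m))"
proof -
  have "bij \<sigma>" using assms by (metis bijI')
  then have "(\<lambda>m. norm (coef x (\<sigma> m))) summable_on UNIV"
    using summable_on_reindex_bij_betw[of \<sigma> UNIV UNIV "\<lambda>m. norm (coef x m)"] by simp
  then show ?thesis unfolding star_def by (simp add: Abs_l1_inverse)
qed

lemma star_diff:
  assumes "\<And>m. \<sigma> (\<sigma> m) = m"
  shows "star \<sigma> (x - y) = star \<sigma> x - star \<sigma> y"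
  unfolding coef_inject_iff by (simp add: coef_star[OF assms] minus_l1.rep_eq)

lemma star_add:
  assumes "\<And>m. \<sigma> (\<sigma> m) = m"
  shows "star \<sigma> (x + y) = star \<sigma> x + star \<sigma> y"
  unfolding coef_inject_iff by (simp add: coef_star[OF assms] plus_l1.rep_eq)

lemma star_scaleR:
  assumes "\<And>m. \<sigma> (\<sigma> m) = m"
  shows "star \<sigma> (r *\<^sub>R x) = r *\<^sub>R star \<sigma> x"
  unfolding coef_inject_iff by (simp add: coef_star[OF assms] scaleR_l1.rep_eq)

lemma norm_star:
  assumes "\<And>m. \<sigma> (\<sigma> m) = m"
  shows "norm (star \<sigma> x) = norm x"
proof -
  have "bij \<sigma>" using assms by (metis bijI')
  then show ?thesis
    unfolding norm_l1_alt using infsum_reindex_bij_betw[of \<sigma> UNIV UNIV "\<lambda>m. norm (coef x m)"]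
    by (simp add: coef_star[OF assms])
qed

lemma bounded_linear_star:
  assumes "\<And>m. \<sigma> (\<sigma> m) = m"
  shows "bounded_linear (star \<sigma>)"
  by (rule bounded_linear_intro[of _ 1])
    (simp_all add: star_add[OF assms] star_scaleR[OF assms] norm_star[OF assms])

lemma pairing_star:
  assumes "\<And>m. \<sigma> (\<sigma> m) = m"
  shows "pairing (star \<sigma> x) \<phi> = cnj (pairing x (\<lambda>m. cnj (\<phi> (\<sigma> m))))"
proof -
  have "bij \<sigma>" using assms by (metis bijI')
  then have "(\<Sum>\<^sub>\<infinity>m. cnj (coef x (\<sigma> m)) * \<phi> (\<sigma> (\<sigma> m))) = (\<Sum>\<^sub>\<infinity>m. cnj (coef x m) * \<phi> (\<sigma> m))"
    by (intro infsum_reindex_bij_betw[of \<sigma> UNIV UNIV "\<lambda>m. cnj (coef x m) * \<phi> (\<sigma> m)"])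
  then show ?thesis
    unfolding pairing_def by (simp add: coef_star[OF assms] assms flip: infsum_cnj)
qed

lemma star_times:
  fixes x y :: "'a::comm_monoid_add l1"
  assumes "\<And>m. \<sigma> (\<sigma> m) = m" "\<And>m n. \<sigma> (m + n) = \<sigma> m + \<sigma> n"
  shows "star \<sigma> (x * y) = star \<sigma> x * star \<sigma> y"
proof (rule l1_eqI)
  fix \<phi> :: "'a \<Rightarrow> complex" assume b: "bdd_fun \<phi>"
  then have b': "bdd_fun (\<lambda>m. cnj (\<phi> (\<sigma> m)))" by (auto simp: bdd_fun_def)
  show "pairing (star \<sigma> (x * y)) \<phi> = pairing (star \<sigma> x * star \<sigma> y) \<phi>"
    unfolding pairing_times[OF b] pairing_star[OF assms(1)] pairing_times[OF b']
    by (simp add: assms)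
qed

lemma star_one:
  assumes "\<And>m. \<sigma> (\<sigma> m) = m" "\<And>m n. \<sigma> (m + n) = \<sigma> m + \<sigma> n"
  shows "star \<sigma> 1 = (1 :: 'a::comm_monoid_add l1)"
proof -
  have "\<sigma> 0 = 0" by (metis assms add.right_neutral add.commute)
  then have "\<sigma> m = 0 \<longleftrightarrow> m = 0" for m by (metis assms(1))
  then show ?thesis unfolding coef_inject_iff by (simp add: coef_star[OF assms(1)] coef_one)
qed

lemma star_power:
  fixes x :: "'a::comm_monoid_add l1"
  assumes "\<And>m. \<sigma> (\<sigma> m) = m" "\<And>m n. \<sigma> (m + n) = \<sigma> m + \<sigma> n"
  shows "star \<sigma> (x ^ n) = star \<sigma> x ^ n"
proof (induction n)
  case 0
  then show ?case using star_one[of \<sigma>, OF assms] by simp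
next
  case (Suc n)
  then show ?case using star_times[of \<sigma> x "x ^ n", OF assms] by simp
qed

lemma star_multiplier:
  assumes "\<And>m. \<sigma> (\<sigma> m) = m" "bdd_fun \<mu>" "\<And>m. \<mu> (\<sigma> m) = cnj (\<mu> m)"
  shows "star \<sigma> (multiplier \<mu> x) = multiplier \<mu> (star \<sigma> x)"
  unfolding coef_inject_iff by (simp add: coef_star[OF assms(1)] coef_multiplier[OF assms(2)] assms(3))

lemma norm_power_diff_le:
  fixes x y :: "'a::{comm_ring_1,real_normed_algebra_1}"
  assumes "norm x \<le> r" "norm y \<le> r"
  shows "norm (x ^ Suc n - y ^ Suc n) \<le> real (Suc n) * r ^ n * norm (x - y)"
proof (induction n)
  case (Suc n)
  have r: "0 \<le> r" using assms(1) norm_ge_zero order.trans by blast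
  have "x ^ Suc (Suc n) - y ^ Suc (Suc n) = (x - y) * x ^ Suc n + y * (x ^ Suc n - y ^ Suc n)"
    by (simp add: algebra_simps)
  then have "norm (x ^ Suc (Suc n) - y ^ Suc (Suc n))
    \<le> norm (x - y) * norm (x ^ Suc n) + norm y * norm (x ^ Suc n - y ^ Suc n)"
    by (simp only:) (intro norm_triangle_le add_mono norm_mult_ineq)
  also have "\<dots> \<le> norm (x - y) * r ^ Suc n + r * (real (Suc n) * r ^ n * norm (x - y))"
    by (intro add_mono mult_mono assms Suc.IH order.trans[OF norm_power_ineq] power_mono) (use r in auto)
  also have "\<dots> = real (Suc (Suc n)) * r ^ Suc n * norm (x - y)"
    by (simp add: algebra_simps)
  finally show ?case .
qed simp

definition nonlin :: "(nat \<Rightarrow> real) \<Rightarrow> 'a::{real_normed_algebra_1} \<Rightarrow> 'a" where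
  "nonlin b x = (\<Sum>k. b (k + 2) *\<^sub>R x ^ (k + 2))"

lemma summable_powser:
  fixes x :: "'a::{real_normed_algebra_1,banach}"
  assumes "summable (\<lambda>k. \<bar>b k\<bar> * R ^ k)" "norm x \<le> R"
  shows "summable (\<lambda>k. b k *\<^sub>R x ^ k)"
proof (rule summable_comparison_test'[OF assms(1), of 0])
  fix k
  have "norm (x ^ k) \<le> R ^ k"
    using norm_power_ineq[of x k] power_mono[OF assms(2), of k] by simp
  then show "norm (b k *\<^sub>R x ^ k) \<le> \<bar>b k\<bar> * R ^ k"
    by (simp add: mult_left_mono)
qed

lemma summable_nonlin:
  fixes x :: "'a::{real_normed_algebra_1,banach}"
  assumes "summable (\<lambda>k. \<bar>b k\<bar> * R ^ k)" "norm x \<le> R"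
  shows "summable (\<lambda>k. b (k + 2) *\<^sub>R x ^ (k + 2))"
  using summable_ignore_initial_segment[OF summable_powser[OF assms], of 2] .

lemma nonlin_zero: "nonlin b 0 = 0"
  unfolding nonlin_def by simp

lemma nonlin_powser:
  fixes x :: "'a::{real_normed_algebra_1,banach}"
  assumes "summable (\<lambda>k. \<bar>b k\<bar> * R ^ k)" "norm x \<le> R"
  shows "(\<Sum>k. b k *\<^sub>R x ^ k) = b 0 *\<^sub>R 1 + b 1 *\<^sub>R x + nonlin b x"
  unfolding nonlin_def using suminf_split_initial_segment[OF summable_powser[OF assms], of 2]
  by (simp add: numeral_2_eq_2)

lemma nonlin_bounded_linear:
  fixes x :: "'a::{real_normed_algebra_1,banach}" and F :: "'a \<Rightarrow> 'b::{real_normed_algebra_1,banach}"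
  assumes "summable (\<lambda>k. \<bar>b k\<bar> * R ^ k)" "norm x \<le> R"
    and "bounded_linear F" "\<And>n. F (x ^ n) = F x ^ n"
  shows "F (nonlin b x) = nonlin b (F x)"
proof -
  interpret bounded_linear F by fact
  show ?thesis unfolding nonlin_def
    using suminf[OF summable_nonlin[OF assms(1,2)]] by (simp add: scaleR assms(4) del: power_Suc)
qed

lemma norm_nonlin_diff_le:
  fixes x y :: "'a::{comm_ring_1,real_normed_algebra_1,banach}"
  assumes b: "summable (\<lambda>k. \<bar>b k\<bar> * R ^ k)" and R: "0 < R" and r: "r \<le> R / 2"
    and x: "norm x \<le> r" and y: "norm y \<le> r"
  shows "norm (nonlin b x - nonlin b y) \<le> (2 / R\<^sup>2 * (\<Sum>k. \<bar>b k\<bar> * R ^ k)) * r * norm (x - y)"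
proof -
  have r0: "0 \<le> r" using x norm_ge_zero order.trans by blast
  have xR: "norm x \<le> R" "norm y \<le> R" using x y r R by auto
  let ?c = "2 * r * norm (x - y) / R\<^sup>2"
  have le: "norm (b (k + 2) *\<^sub>R x ^ (k + 2) - b (k + 2) *\<^sub>R y ^ (k + 2)) \<le> ?c * (\<bar>b (k + 2)\<bar> * R ^ (k + 2))" for k
  proof -
    have k: "real (k + 2) \<le> 2 * 2 ^ k" by (induction k) auto
    have "norm (x ^ Suc (Suc k) - y ^ Suc (Suc k)) \<le> real (Suc (Suc k)) * r ^ Suc k * norm (x - y)"
      by (rule norm_power_diff_le[OF x y])
    also have "\<dots> = real (k + 2) * (r * norm (x - y)) * r ^ k" by simp
    also have "\<dots> \<le> 2 * 2 ^ k * (r * norm (x - y)) * (R / 2) ^ k"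
      by (intro mult_mono k power_mono r) (use r0 in auto)
    also have "\<dots> = ?c * R ^ (k + 2)"
      using R by (simp add: field_simps power2_eq_square)
    finally have "norm (x ^ Suc (Suc k) - y ^ Suc (Suc k)) \<le> ?c * R ^ (k + 2)" .
    from mult_left_mono[OF this, of "\<bar>b (k + 2)\<bar>"] show ?thesis
      by (simp add: scaleR_diff_right[symmetric] mult_ac)
  qed
  have sb: "summable (\<lambda>k. \<bar>b (k + 2)\<bar> * R ^ (k + 2))"
    using summable_ignore_initial_segment[OF b, of 2] .
  have sc: "summable (\<lambda>k. ?c * (\<bar>b (k + 2)\<bar> * R ^ (k + 2)))"
    by (rule summable_mult[OF sb])
  have "nonlin b x - nonlin b y = (\<Sum>k. b (k + 2) *\<^sub>R x ^ (k + 2) - b (k + 2) *\<^sub>R y ^ (k + 2))"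
    unfolding nonlin_def by (rule suminf_diff) (rule summable_nonlin[OF b]; fact xR)+
  also have "norm \<dots> \<le> (\<Sum>k. ?c * (\<bar>b (k + 2)\<bar> * R ^ (k + 2)))"
    by (rule norm_suminf_le[OF le sc])
  also have "\<dots> = ?c * (\<Sum>k. \<bar>b (k + 2)\<bar> * R ^ (k + 2))"
    by (rule suminf_mult[OF sb])
  also have "\<dots> \<le> ?c * (\<Sum>k. \<bar>b k\<bar> * R ^ k)"
  proof (rule mult_left_mono)
    have "0 \<le> (\<Sum>k<2. \<bar>b k\<bar> * R ^ k)" using R by (intro sum_nonneg) auto
    then show "(\<Sum>k. \<bar>b (k + 2)\<bar> * R ^ (k + 2)) \<le> (\<Sum>k. \<bar>b k\<bar> * R ^ k)"
      using suminf_split_initial_segment[OF b, of 2] by linarith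
  qed (use r0 in auto)
  finally show ?thesis by (simp add: field_simps)
qed

text \<open>The multiplier of \<open>\<epsilon> (\<epsilon> D\<^sup>2 + D + \<epsilon> a)\<^sup>-\<^sup>1\<close> on a mode with \<open>D = \<i> s\<close>.\<close>

definition resolvent :: "real \<Rightarrow> real \<Rightarrow> real \<Rightarrow> complex" where
  "resolvent a \<epsilon> s = of_real \<epsilon> / Complex (\<epsilon> * (a - s\<^sup>2)) s"

lemma resolvent_uminus: "resolvent a \<epsilon> (- s) = cnj (resolvent a \<epsilon> s)"
  by (simp add: resolvent_def complex_cnj)

lemma norm_resolvent_le1: "norm (of_real s * resolvent a \<epsilon> s) \<le> \<bar>\<epsilon>\<bar>"
proof (cases "s = 0")
  case False
  have "\<bar>s\<bar> \<le> norm (Complex (\<epsilon> * (a - s\<^sup>2)) s)"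
    using abs_Im_le_cmod[of "Complex (\<epsilon> * (a - s\<^sup>2)) s"] by simp
  moreover from this False have "0 < norm (Complex (\<epsilon> * (a - s\<^sup>2)) s)" by linarith
  ultimately show ?thesis
    by (simp add: resolvent_def norm_mult norm_divide field_simps mult_left_mono)
qed simp

lemma norm_resolvent_le:
  assumes "a \<noteq> 0" "\<bar>\<epsilon>\<bar> \<le> 1"
  shows "norm (resolvent a \<epsilon> s) \<le> 2 / \<bar>a\<bar> + 1 / sqrt (\<bar>a\<bar> / 2)"
proof (cases "s\<^sup>2 \<le> \<bar>a\<bar> / 2")
  case True
  then have 1: "\<bar>a\<bar> / 2 \<le> \<bar>a - s\<^sup>2\<bar>" using zero_le_power2[of s] by linarith
  have "\<bar>\<epsilon>\<bar> * (\<bar>a\<bar> / 2) \<le> norm (Complex (\<epsilon> * (a - s\<^sup>2)) s)"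
    using abs_Re_le_cmod[of "Complex (\<epsilon> * (a - s\<^sup>2)) s"] mult_left_mono[OF 1, of "\<bar>\<epsilon>\<bar>"]
    by (simp add: abs_mult)
  then have "norm (resolvent a \<epsilon> s) \<le> 2 / \<bar>a\<bar>"
    using assms
    by (cases "Complex (\<epsilon> * (a - s\<^sup>2)) s = 0")
      (simp_all add: resolvent_def norm_divide field_simps)
  then show ?thesis by (rule order.trans) simp
next
  case False
  then have s: "sqrt (\<bar>a\<bar> / 2) \<le> \<bar>s\<bar>" by (metis linorder_linear real_sqrt_abs real_sqrt_le_iff)
  have p: "0 < sqrt (\<bar>a\<bar> / 2)" using assms by simp
  have "\<bar>s\<bar> * norm (resolvent a \<epsilon> s) \<le> 1"
    using norm_resolvent_le1[of s a \<epsilon>] assms by (simp add: norm_mult)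
  with mult_right_mono[OF s norm_ge_zero[of "resolvent a \<epsilon> s"]]
  have "sqrt (\<bar>a\<bar> / 2) * norm (resolvent a \<epsilon> s) \<le> 1" by linarith
  then have "norm (resolvent a \<epsilon> s) \<le> 1 / sqrt (\<bar>a\<bar> / 2)"
    using p by (simp add: field_simps)
  then show ?thesis by (rule order.trans) simp
qed

lemma resolvent_solves:
  assumes "a \<noteq> 0"
  shows "(of_real (\<epsilon> * (a - s\<^sup>2)) + \<i> * of_real s) * resolvent a \<epsilon> s = of_real \<epsilon>"
proof (cases "Complex (\<epsilon> * (a - s\<^sup>2)) s = 0")
  case True
  then have s: "s = 0" by (simp add: complex_eq_iff)
  with True have "\<epsilon> * a = 0" by (simp add: complex_eq_iff)
  with assms s have "\<epsilon> = 0" "s = 0" by auto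
  then show ?thesis by simp
next
  case False
  then show ?thesis by (simp add: resolvent_def Complex_eq)
qed

lemma bdd_fun_resolvent:
  "a \<noteq> 0 \<Longrightarrow> \<bar>\<epsilon>\<bar> \<le> 1 \<Longrightarrow> bdd_fun (\<lambda>m. resolvent a \<epsilon> (s m))"
  unfolding bdd_fun_def using norm_resolvent_le by blast

lemma multiplier_resolvent_tendsto_0:
  assumes a: "a \<noteq> 0" and q: "\<And>m. s m = 0 \<Longrightarrow> coef q m = 0"
  shows "((\<lambda>\<epsilon>. multiplier (\<lambda>m. resolvent a \<epsilon> (s m)) q) \<longlongrightarrow> 0) (at 0)"
proof (rule tendstoI)
  fix e :: real assume e: "e > 0"
  define C where "C = 2 / \<bar>a\<bar> + 1 / sqrt (\<bar>a\<bar> / 2)"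
  have C: "C > 0" using a by (simp add: C_def add_pos_pos)
  obtain F where F: "finite F" "dist (\<Sum>m\<in>F. norm (coef q m)) (norm q) \<le> e / (4 * C)"
    using infsum_finite_approximation[of "\<lambda>m. norm (coef q m)" UNIV "e / (4 * C)"] e C
    by (auto simp: norm_l1_alt)
  define K where "K = (\<Sum>m\<in>F. norm (coef q m) / \<bar>s m\<bar>)"
  have bound: "norm (multiplier (\<lambda>m. resolvent a \<epsilon> (s m)) q) \<le> \<bar>\<epsilon>\<bar> * K + e / 4" if \<epsilon>: "\<bar>\<epsilon>\<bar> \<le> 1" for \<epsilon>
  proof (rule norm_l1_leI)
    fix G :: "'a set" assume G: "finite G"
    have b: "bdd_fun (\<lambda>m. resolvent a \<epsilon> (s m))" by (rule bdd_fun_resolvent[OF a \<epsilon>])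
    let ?t = "\<lambda>m. norm (resolvent a \<epsilon> (s m)) * norm (coef q m)"
    have "(\<Sum>m\<in>G. norm (coef (multiplier (\<lambda>m. resolvent a \<epsilon> (s m)) q) m)) = sum ?t G"
      by (simp add: coef_multiplier[OF b] norm_mult)
    also have "\<dots> \<le> sum ?t (F \<union> (G - F))"
      by (rule sum_mono2) (use F G in auto)
    also have "\<dots> = sum ?t F + sum ?t (G - F)"
      by (rule sum.union_disjoint) (use F G in auto)
    also have "sum ?t F \<le> (\<Sum>m\<in>F. \<bar>\<epsilon>\<bar> * (norm (coef q m) / \<bar>s m\<bar>))"
    proof (rule sum_mono)
      fix m
      show "?t m \<le> \<bar>\<epsilon>\<bar> * (norm (coef q m) / \<bar>s m\<bar>)"
      proof (cases "s m = 0")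
        case False
        then have "norm (resolvent a \<epsilon> (s m)) \<le> \<bar>\<epsilon>\<bar> / \<bar>s m\<bar>"
          using norm_resolvent_le1[of "s m" a \<epsilon>] by (simp add: norm_mult field_simps)
        from mult_right_mono[OF this, of "norm (coef q m)"] show ?thesis by simp
      qed (simp add: q)
    qed
    also have "\<dots> = \<bar>\<epsilon>\<bar> * K" by (simp add: K_def sum_distrib_left)
    also have "sum ?t (G - F) \<le> (\<Sum>m\<in>G - F. C * norm (coef q m))"
      unfolding C_def by (intro sum_mono mult_right_mono norm_resolvent_le a \<epsilon>) simp
    also have "\<dots> = C * (\<Sum>m\<in>G - F. norm (coef q m))" by (simp add: sum_distrib_left)
    also have "(\<Sum>m\<in>G - F. norm (coef q m)) \<le> e / (4 * C)"
    proof -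
      have "(\<Sum>m\<in>G - F. norm (coef q m)) + (\<Sum>m\<in>F. norm (coef q m)) = (\<Sum>m\<in>(G - F) \<union> F. norm (coef q m))"
        by (rule sum.union_disjoint[symmetric]) (use F G in auto)
      also have "\<dots> \<le> norm q" by (rule sum_coef_le_norm) (use F G in auto)
      finally show ?thesis using F(2) by (simp add: dist_real_def)
    qed
    also have "C * (e / (4 * C)) = e / 4" using C by simp
    finally show "(\<Sum>m\<in>G. norm (coef (multiplier (\<lambda>m. resolvent a \<epsilon> (s m)) q) m)) \<le> \<bar>\<epsilon>\<bar> * K + e / 4"
      using C by simp
  qed
  have "((\<lambda>\<epsilon>. \<bar>\<epsilon>\<bar> * K) \<longlongrightarrow> \<bar>0\<bar> * K) (at 0)" by (intro tendsto_intros)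
  then have "\<forall>\<^sub>F \<epsilon> in at 0. \<bar>\<epsilon>\<bar> * K < e / 4"
    using e by (intro order_tendstoD(2)[of _ "\<bar>0\<bar> * K"]) auto
  moreover have "\<forall>\<^sub>F \<epsilon>::real in at 0. \<bar>\<epsilon>\<bar> \<le> 1"
    unfolding eventually_at by (rule exI[of _ 1]) auto
  ultimately show "\<forall>\<^sub>F \<epsilon> in at 0. dist (multiplier (\<lambda>m. resolvent a \<epsilon> (s m)) q) 0 < e"
    by eventually_elim (use bound e in force)
qed

lemma quasi_periodic_fixed_point:
  fixes q :: "'a::comm_monoid_add l1"
  assumes a: "a \<noteq> 0" and b: "summable (\<lambda>k. \<bar>b k\<bar> * R ^ k)" and R: "0 < R"
    and q: "\<And>m. s m = 0 \<Longrightarrow> coef q m = 0"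
    and \<sigma>: "\<And>m. \<sigma> (\<sigma> m) = m" "\<And>m n. \<sigma> (m + n) = \<sigma> m + \<sigma> n" "\<And>m. s (\<sigma> m) = - s m"
    and star: "star \<sigma> q = q" and \<delta>: "0 < \<delta>"
  obtains \<epsilon>0 \<Xi> where "0 < \<epsilon>0" "\<epsilon>0 \<le> 1"
    "\<forall>\<epsilon>. \<bar>\<epsilon>\<bar> < \<epsilon>0 \<longrightarrow> \<Xi> \<epsilon> = multiplier (\<lambda>m. resolvent a \<epsilon> (s m)) (q - nonlin b (\<Xi> \<epsilon>)) \<and>
       norm (\<Xi> \<epsilon>) \<le> \<delta> \<and> norm (\<Xi> \<epsilon>) \<le> R / 2 \<and> norm (nonlin b (\<Xi> \<epsilon>)) \<le> \<delta> \<and> star \<sigma> (\<Xi> \<epsilon>) = \<Xi> \<epsilon>"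
    "(\<Xi> \<longlongrightarrow> 0) (at 0)"
proof -
  define C where "C = 2 / \<bar>a\<bar> + 1 / sqrt (\<bar>a\<bar> / 2)"
  define K where "K = 2 / R\<^sup>2 * (\<Sum>k. \<bar>b k\<bar> * R ^ k)"
  define \<eta> where "\<eta> = min \<delta> (min (R / 2) (min (1 / (2 * C * (K + 1))) (1 / (K + 1))))"
  have C: "C > 0" using a by (simp add: C_def add_pos_pos)
  have K: "K \<ge> 0" unfolding K_def using R b by (intro mult_nonneg_nonneg suminf_nonneg) auto
  have \<eta>: "0 < \<eta>" "\<eta> \<le> \<delta>" "\<eta> \<le> R / 2" "C * (K * \<eta>) \<le> 1 / 2" "K * \<eta> \<le> 1"
  proof -
    show "0 < \<eta>" using C K \<delta> R by (simp add: \<eta>_def add_nonneg_pos)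
    show "\<eta> \<le> \<delta>" "\<eta> \<le> R / 2" by (simp_all add: \<eta>_def)
    have 1: "\<eta> \<le> 1 / (2 * C * (K + 1))" "\<eta> \<le> 1 / (K + 1)" by (simp_all add: \<eta>_def)
    have "C * (K * \<eta>) \<le> C * ((K + 1) * \<eta>)" using C K \<open>0 < \<eta>\<close> by (intro mult_left_mono mult_right_mono) auto
    also have "\<dots> \<le> 1 / 2"
    proof -
      have "C * (K + 1) * \<eta> \<le> C * (K + 1) * (1 / (2 * C * (K + 1)))"
        using C K by (intro mult_left_mono 1(1)) auto
      also have "\<dots> = 1 / 2" using C K by (simp add: add_nonneg_eq_0_iff)
      finally show ?thesis by (simp add: mult.assoc)
    qed
    finally show "C * (K * \<eta>) \<le> 1 / 2" .
    have "K * \<eta> \<le> (K + 1) * \<eta>" using \<open>0 < \<eta>\<close> by (intro mult_right_mono) auto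
    also have "\<dots> \<le> 1" using mult_left_mono[OF 1(2), of "K + 1"] K by simp
    finally show "K * \<eta> \<le> 1" .
  qed
  define T where "T \<epsilon> = multiplier (\<lambda>m. resolvent a \<epsilon> (s m))" for \<epsilon> :: real
  have T_diff: "T \<epsilon> (x - y) = T \<epsilon> x - T \<epsilon> y" if "\<bar>\<epsilon>\<bar> \<le> 1" for \<epsilon> x y
    unfolding T_def by (rule multiplier_diff[OF bdd_fun_resolvent[OF a that]])
  have T_norm: "norm (T \<epsilon> x) \<le> C * norm x" if "\<bar>\<epsilon>\<bar> \<le> 1" for \<epsilon> x
    unfolding T_def C_def by (rule norm_multiplier_le[OF norm_resolvent_le[OF a that]])
  have T_star: "star \<sigma> (T \<epsilon> x) = T \<epsilon> (star \<sigma> x)" if "\<bar>\<epsilon>\<bar> \<le> 1" for \<epsilon> x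
    unfolding T_def
    by (rule star_multiplier[OF \<sigma>(1) bdd_fun_resolvent[OF a that]]) (simp add: \<sigma>(3) resolvent_uminus)
  have N_diff: "norm (nonlin b x - nonlin b y) \<le> K * \<eta> * norm (x - y)"
    if "norm x \<le> \<eta>" "norm y \<le> \<eta>" for x y :: "'a l1"
    unfolding K_def by (rule norm_nonlin_diff_le[OF b R \<eta>(3) that])
  have N_star: "star \<sigma> (nonlin b x) = nonlin b (star \<sigma> x)" if "norm x \<le> \<eta>" for x
  proof (rule nonlin_bounded_linear[OF b])
    show "norm x \<le> R" using that \<eta> R by linarith
    show "bounded_linear (star \<sigma>)" by (rule bounded_linear_star[of \<sigma>, OF \<sigma>(1)])
    show "star \<sigma> (x ^ n) = star \<sigma> x ^ n" for n by (rule star_power[of \<sigma>, OF \<sigma>(1,2)])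
  qed
  have lim: "((\<lambda>\<epsilon>. T \<epsilon> q) \<longlongrightarrow> 0) (at 0)"
    unfolding T_def by (rule multiplier_resolvent_tendsto_0[OF a q])
  then have "\<forall>\<^sub>F \<epsilon> in at 0. norm (T \<epsilon> q) < \<eta> / 2"
    using \<eta>(1) by (auto dest: tendstoD[of _ _ _ "\<eta> / 2"])
  then obtain d where d: "d > 0" "\<And>\<epsilon>. \<epsilon> \<noteq> 0 \<Longrightarrow> \<bar>\<epsilon>\<bar> < d \<Longrightarrow> norm (T \<epsilon> q) < \<eta> / 2"
    by (auto simp: eventually_at)
  have T0: "T 0 x = 0" for x
  proof -
    have "norm (T 0 x) \<le> 0 * norm x" unfolding T_def
      by (rule norm_multiplier_le) (simp add: resolvent_def)
    then show ?thesis by simp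
  qed
  define \<epsilon>0 where "\<epsilon>0 = min d 1"
  have small: "norm (T \<epsilon> q) \<le> \<eta> / 2" if "\<bar>\<epsilon>\<bar> < \<epsilon>0" for \<epsilon>
    using d(2)[of \<epsilon>] that \<eta>(1) T0 by (cases "\<epsilon> = 0") (auto simp: \<epsilon>0_def)
  have ex1: "\<exists>!x\<in>cball 0 \<eta>. T \<epsilon> (q - nonlin b x) = x" if \<epsilon>: "\<bar>\<epsilon>\<bar> < \<epsilon>0" for \<epsilon>
  proof (rule Banach_fix[where c = "1 / 2"])
    have \<epsilon>1: "\<bar>\<epsilon>\<bar> \<le> 1" using that by (simp add: \<epsilon>0_def)
    have lip: "norm (T \<epsilon> (q - nonlin b x) - T \<epsilon> (q - nonlin b y)) \<le> 1 / 2 * norm (x - y)"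
      if "norm x \<le> \<eta>" "norm y \<le> \<eta>" for x y
    proof -
      have "norm (T \<epsilon> (q - nonlin b x) - T \<epsilon> (q - nonlin b y)) \<le> C * norm (nonlin b x - nonlin b y)"
        using T_norm[OF \<epsilon>1, of "nonlin b y - nonlin b x"]
        by (simp add: T_diff[OF \<epsilon>1, symmetric] norm_minus_commute)
      also have "\<dots> \<le> C * (K * \<eta> * norm (x - y))"
        using C by (intro mult_left_mono N_diff that) auto
      also have "\<dots> = C * (K * \<eta>) * norm (x - y)" by simp
      also have "\<dots> \<le> 1 / 2 * norm (x - y)" by (intro mult_right_mono \<eta>(4)) simp
      finally show ?thesis .
    qed
    show "complete (cball 0 \<eta> :: 'a l1 set)" by (simp add: complete_eq_closed)
    show "cball 0 \<eta> \<noteq> ({} :: 'a l1 set)" using \<eta>(1) by simp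
    show "(\<lambda>x. T \<epsilon> (q - nonlin b x)) ` cball 0 \<eta> \<subseteq> cball 0 \<eta>"
    proof (clarsimp)
      fix x :: "'a l1" assume x: "norm x \<le> \<eta>"
      have "norm (T \<epsilon> (q - nonlin b x)) \<le> norm (T \<epsilon> q) + norm (T \<epsilon> (q - nonlin b x) - T \<epsilon> (q - nonlin b 0))"
        using norm_triangle_sub[of "T \<epsilon> (q - nonlin b x)" "T \<epsilon> q"] by (simp add: nonlin_zero)
      also have "\<dots> \<le> \<eta> / 2 + 1 / 2 * norm x"
        using small[OF \<epsilon>] lip[OF x, of 0] \<eta>(1) by simp
      finally show "norm (T \<epsilon> (q - nonlin b x)) \<le> \<eta>" using x by simp
    qed
    show "dist (T \<epsilon> (q - nonlin b x)) (T \<epsilon> (q - nonlin b y)) \<le> 1 / 2 * dist x y"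
      if "x \<in> cball 0 \<eta>" "y \<in> cball 0 \<eta>" for x y
      using lip[of x y] that by (simp add: dist_norm)
  qed auto
  define \<Xi> where "\<Xi> \<epsilon> = (THE x. x \<in> cball 0 \<eta> \<and> T \<epsilon> (q - nonlin b x) = x)" for \<epsilon>
  have \<Xi>: "norm (\<Xi> \<epsilon>) \<le> \<eta>" "T \<epsilon> (q - nonlin b (\<Xi> \<epsilon>)) = \<Xi> \<epsilon>" if "\<bar>\<epsilon>\<bar> < \<epsilon>0" for \<epsilon>
    using theI'[OF ex1[OF that]] unfolding \<Xi>_def by auto
  have N_\<Xi>: "norm (nonlin b (\<Xi> \<epsilon>)) \<le> K * \<eta> * norm (\<Xi> \<epsilon>)" if "\<bar>\<epsilon>\<bar> < \<epsilon>0" for \<epsilon>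
    using N_diff[OF \<Xi>(1)[OF that], of 0] \<eta>(1) by (simp add: nonlin_zero)
  show ?thesis
  proof (rule that[of \<epsilon>0 \<Xi>])
    show "0 < \<epsilon>0" "\<epsilon>0 \<le> 1" using d(1) by (simp_all add: \<epsilon>0_def)
    show "\<forall>\<epsilon>. \<bar>\<epsilon>\<bar> < \<epsilon>0 \<longrightarrow> \<Xi> \<epsilon> = multiplier (\<lambda>m. resolvent a \<epsilon> (s m)) (q - nonlin b (\<Xi> \<epsilon>)) \<and>
       norm (\<Xi> \<epsilon>) \<le> \<delta> \<and> norm (\<Xi> \<epsilon>) \<le> R / 2 \<and> norm (nonlin b (\<Xi> \<epsilon>)) \<le> \<delta> \<and> star \<sigma> (\<Xi> \<epsilon>) = \<Xi> \<epsilon>"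
    proof (intro allI impI conjI)
      fix \<epsilon> :: real assume \<epsilon>: "\<bar>\<epsilon>\<bar> < \<epsilon>0"
      then have \<epsilon>1: "\<bar>\<epsilon>\<bar> \<le> 1" by (simp add: \<epsilon>0_def)
      show "\<Xi> \<epsilon> = multiplier (\<lambda>m. resolvent a \<epsilon> (s m)) (q - nonlin b (\<Xi> \<epsilon>))"
        using \<Xi>(2)[OF \<epsilon>] by (simp add: T_def)
      show "norm (\<Xi> \<epsilon>) \<le> \<delta>" "norm (\<Xi> \<epsilon>) \<le> R / 2" using \<Xi>(1)[OF \<epsilon>] \<eta> by auto
      have "K * \<eta> * norm (\<Xi> \<epsilon>) \<le> 1 * norm (\<Xi> \<epsilon>)" by (intro mult_right_mono \<eta>) simp
      then show "norm (nonlin b (\<Xi> \<epsilon>)) \<le> \<delta>" using N_\<Xi>[OF \<epsilon>] \<Xi>(1)[OF \<epsilon>] \<eta> by auto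
      have "T \<epsilon> (q - nonlin b (star \<sigma> (\<Xi> \<epsilon>))) = star \<sigma> (\<Xi> \<epsilon>)"
        using arg_cong[OF \<Xi>(2)[OF \<epsilon>], of "star \<sigma>"]
        by (simp add: T_star[OF \<epsilon>1] star_diff[of \<sigma>, OF \<sigma>(1)] star N_star[OF \<Xi>(1)[OF \<epsilon>]])
      moreover have "norm (star \<sigma> (\<Xi> \<epsilon>)) \<le> \<eta>"
        using \<Xi>(1)[OF \<epsilon>] by (simp add: norm_star[of \<sigma>, OF \<sigma>(1)])
      ultimately show "star \<sigma> (\<Xi> \<epsilon>) = \<Xi> \<epsilon>"
        using ex1[OF \<epsilon>] \<Xi>[OF \<epsilon>] unfolding mem_cball_0 by metis
    qed
  next
    have "\<forall>\<^sub>F \<epsilon> in at 0. norm (\<Xi> \<epsilon>) \<le> norm (T \<epsilon> q) * 2"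
      unfolding eventually_at
    proof (intro exI conjI ballI impI)
      show "0 < \<epsilon>0" using d(1) by (simp add: \<epsilon>0_def)
      fix \<epsilon> :: real assume "\<epsilon> \<noteq> 0 \<and> dist \<epsilon> 0 < \<epsilon>0"
      then have \<epsilon>: "\<bar>\<epsilon>\<bar> < \<epsilon>0" by simp
      then have \<epsilon>1: "\<bar>\<epsilon>\<bar> \<le> 1" by (simp add: \<epsilon>0_def)
      have "norm (\<Xi> \<epsilon>) \<le> norm (T \<epsilon> q) + norm (T \<epsilon> (nonlin b (\<Xi> \<epsilon>)))"
        using norm_triangle_ineq4[of "T \<epsilon> q" "T \<epsilon> (nonlin b (\<Xi> \<epsilon>))"] \<Xi>(2)[OF \<epsilon>]
        by (simp add: T_diff[OF \<epsilon>1])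
      also have "norm (T \<epsilon> (nonlin b (\<Xi> \<epsilon>))) \<le> C * (K * \<eta> * norm (\<Xi> \<epsilon>))"
        using C by (intro order.trans[OF T_norm[OF \<epsilon>1]] mult_left_mono N_\<Xi> \<epsilon>) auto
      also have "\<dots> = C * (K * \<eta>) * norm (\<Xi> \<epsilon>)" by simp
      also have "\<dots> \<le> 1 / 2 * norm (\<Xi> \<epsilon>)" by (intro mult_right_mono \<eta>(4)) simp
      finally show "norm (\<Xi> \<epsilon>) \<le> norm (T \<epsilon> q) * 2" by simp
    qed
    then show "(\<Xi> \<longlongrightarrow> 0) (at 0)"
      by (rule Lim_null_comparison)
        (use tendsto_mult_left_zero[OF tendsto_norm_zero[OF lim], of 2] in \<open>simp add: mult.commute\<close>)
  qed
qed

section \<open>Exponential series and real analyticity\<close>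

lemma summable_on_prod_PiE:
  fixes f :: "'b \<Rightarrow> 'k \<Rightarrow> real"
  assumes B: "finite B" and f: "\<And>b. b \<in> B \<Longrightarrow> f b summable_on UNIV" "\<And>b k. 0 \<le> f b k"
  shows "(\<lambda>\<alpha>. \<Prod>b\<in>B. f b (\<alpha> b)) summable_on (B \<rightarrow>\<^sub>E UNIV)"
proof (rule nonneg_bounded_partial_sums_imp_summable_on)
  show "\<forall>\<^sub>F F in finite_subsets_at_top (B \<rightarrow>\<^sub>E UNIV). (\<Sum>\<alpha>\<in>F. \<Prod>b\<in>B. f b (\<alpha> b)) \<le> (\<Prod>b\<in>B. infsum (f b) UNIV)"
  proof (rule eventually_finite_subsets_at_top_weakI)
    fix F assume F: "finite F" "F \<subseteq> B \<rightarrow>\<^sub>E (UNIV :: 'k set)"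
    have "(\<Sum>\<alpha>\<in>F. \<Prod>b\<in>B. f b (\<alpha> b)) \<le> (\<Sum>\<alpha>\<in>PiE B (\<lambda>b. (\<lambda>\<alpha>. \<alpha> b) ` F). \<Prod>b\<in>B. f b (\<alpha> b))"
      using F B f(2) by (intro sum_mono2 finite_PiE prod_nonneg) (auto simp: PiE_iff subset_iff)
    also have "\<dots> = (\<Prod>b\<in>B. \<Sum>k\<in>(\<lambda>\<alpha>. \<alpha> b) ` F. f b k)"
      by (rule prod_sum_PiE[symmetric]) (use B F in auto)
    also have "\<dots> \<le> (\<Prod>b\<in>B. infsum (f b) UNIV)"
      using F f by (intro prod_mono conjI sum_nonneg finite_sum_le_infsum) auto
    finally show "(\<Sum>\<alpha>\<in>F. \<Prod>b\<in>B. f b (\<alpha> b)) \<le> (\<Prod>b\<in>B. infsum (f b) UNIV)" .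
  qed
qed (use f(2) in \<open>auto intro!: prod_nonneg\<close>)

lemma prod_exp_series:
  fixes u :: "'b \<Rightarrow> 'c::{real_normed_field,banach}"
  assumes B: "finite B"
  shows "(\<lambda>\<alpha>. norm (\<Prod>b\<in>B. u b ^ \<alpha> b / fact (\<alpha> b))) summable_on (B \<rightarrow>\<^sub>E UNIV)"
    and "(\<Sum>\<^sub>\<infinity>\<alpha>\<in>B \<rightarrow>\<^sub>E UNIV. \<Prod>b\<in>B. u b ^ \<alpha> b / fact (\<alpha> b)) = exp (\<Sum>b\<in>B. u b)"
proof -
  have scale: "x ^ k /\<^sub>R fact k = x ^ k / fact k" for x :: 'c and k
    by (simp add: scaleR_conv_of_real divide_inverse of_real_inverse)
  have s: "summable (\<lambda>k. norm (u b ^ k / fact k))" for b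
    using summable_norm_exp[of "u b"] unfolding scale .
  then have s': "(\<lambda>k. norm (u b ^ k / fact k)) summable_on UNIV" for b
    by (rule summable_nonneg_imp_summable_on) simp
  have e: "((\<lambda>k. u b ^ k / fact k) has_sum exp (u b)) UNIV" for b
    using exp_converges[of "u b"] unfolding scale by (rule norm_summable_imp_has_sum[OF s])
  show "(\<lambda>\<alpha>. norm (\<Prod>b\<in>B. u b ^ \<alpha> b / fact (\<alpha> b))) summable_on (B \<rightarrow>\<^sub>E UNIV)"
    unfolding prod_norm[symmetric] by (rule summable_on_prod_PiE[OF B s']) simp
  have "(\<Sum>\<^sub>\<infinity>\<alpha>\<in>B \<rightarrow>\<^sub>E UNIV. \<Prod>b\<in>B. u b ^ \<alpha> b / fact (\<alpha> b)) = (\<Prod>b\<in>B. \<Sum>\<^sub>\<infinity>k. u b ^ k / fact k)"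
    by (rule infsum_prod_PiE_abs[OF B]) (rule s')
  then show "(\<Sum>\<^sub>\<infinity>\<alpha>\<in>B \<rightarrow>\<^sub>E UNIV. \<Prod>b\<in>B. u b ^ \<alpha> b / fact (\<alpha> b)) = exp (\<Sum>b\<in>B. u b)"
    using B by (simp add: infsumI[OF e] exp_sum)
qed

lemma real_analytic_fourier:
  fixes c :: "'i \<Rightarrow> complex" and k :: "'i \<Rightarrow> 'a::euclidean_space"
  assumes R: "0 < R" and c: "(\<lambda>i. norm (c i) * exp (R * (\<Sum>b\<in>Basis. \<bar>k i \<bullet> b\<bar>))) summable_on UNIV"
  shows "real_analytic (\<lambda>\<psi>. Re (\<Sum>\<^sub>\<infinity>i. c i * cis (k i \<bullet> \<psi>)))"
  unfolding real_analytic_def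
proof (intro allI exI conjI ballI)
  fix p :: 'a
  let ?I = "(Basis :: 'a set) \<rightarrow>\<^sub>E (UNIV :: nat set)"
  define e where "e i \<alpha> = (\<Prod>b\<in>(Basis :: 'a set). (\<i> * of_real (k i \<bullet> b)) ^ \<alpha> b / fact (\<alpha> b))" for i \<alpha>
  define A where "A \<alpha> = (\<Sum>\<^sub>\<infinity>i. c i * cis (k i \<bullet> p) * e i \<alpha>)" for \<alpha>
  show "0 < R" by (rule R)
  fix \<psi> assume "\<psi> \<in> ball p R"
  define z where "z = \<psi> - p"
  have zb: "\<bar>z \<bullet> b\<bar> \<le> R" if "b \<in> Basis" for b
    using Basis_le_norm[OF that, of z] \<open>\<psi> \<in> ball p R\<close> by (simp add: z_def dist_norm norm_minus_commute)
  define Z where "Z \<alpha> = (\<Prod>b\<in>(Basis :: 'a set). (z \<bullet> b) ^ \<alpha> b)" for \<alpha>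
  define u where "u i b = \<i> * of_real (k i \<bullet> b) * of_real (z \<bullet> b)" for i b
  have eZ: "e i \<alpha> * of_real (Z \<alpha>) = (\<Prod>b\<in>(Basis :: 'a set). u i b ^ \<alpha> b / fact (\<alpha> b))" for i \<alpha>
    unfolding e_def Z_def u_def by (simp add: prod.distrib[symmetric] power_mult_distrib)
  define D where "D i \<alpha> = c i * cis (k i \<bullet> p) * (e i \<alpha> * of_real (Z \<alpha>))" for i \<alpha>
  note s = prod_exp_series[of "Basis :: 'a set" "u i" for i, OF finite_Basis, folded eZ]
  have u_norm: "(\<Sum>b\<in>Basis. norm (u i b)) \<le> R * (\<Sum>b\<in>Basis. \<bar>k i \<bullet> b\<bar>)" for i
    unfolding u_def sum_distrib_left
    by (intro sum_mono) (use zb in \<open>simp add: norm_mult mult.commute mult_right_mono\<close>)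
  have u_sum: "exp (\<Sum>b\<in>Basis. u i b) = cis (k i \<bullet> z)" for i
    unfolding u_def cis_conv_exp by (subst euclidean_inner) (simp add: sum_distrib_left mult.assoc)
  have D_norm: "(\<lambda>\<alpha>. norm (D i \<alpha>)) summable_on ?I"
      "(\<Sum>\<^sub>\<infinity>\<alpha>\<in>?I. norm (D i \<alpha>)) \<le> norm (c i) * exp (R * (\<Sum>b\<in>Basis. \<bar>k i \<bullet> b\<bar>))" for i
  proof -
    have D: "norm (D i \<alpha>) = norm (c i) * norm (e i \<alpha> * of_real (Z \<alpha>))" for \<alpha>
      by (simp add: D_def norm_mult)
    show "(\<lambda>\<alpha>. norm (D i \<alpha>)) summable_on ?I"
      unfolding D by (intro summable_on_cmult_right s)
    have "(\<Sum>\<^sub>\<infinity>\<alpha>\<in>?I. norm (D i \<alpha>)) = norm (c i) * (\<Sum>\<^sub>\<infinity>\<alpha>\<in>?I. norm (e i \<alpha> * of_real (Z \<alpha>)))"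
      unfolding D by (rule infsum_cmult_right')
    also have "(\<Sum>\<^sub>\<infinity>\<alpha>\<in>?I. norm (e i \<alpha> * of_real (Z \<alpha>))) = exp (\<Sum>b\<in>Basis. norm (u i b))"
      using prod_exp_series(2)[of "Basis :: 'a set" "\<lambda>b. norm (u i b)"]
      by (simp add: eZ prod_norm[symmetric] norm_divide norm_power)
    also have "norm (c i) * \<dots> \<le> norm (c i) * exp (R * (\<Sum>b\<in>Basis. \<bar>k i \<bullet> b\<bar>))"
      by (intro mult_left_mono) (simp_all add: u_norm)
    finally show "(\<Sum>\<^sub>\<infinity>\<alpha>\<in>?I. norm (D i \<alpha>)) \<le> norm (c i) * exp (R * (\<Sum>b\<in>Basis. \<bar>k i \<bullet> b\<bar>))" .
  qed
  have D_sum: "(\<lambda>x. norm (case x of (i, \<alpha>) \<Rightarrow> D i \<alpha>)) summable_on UNIV \<times> ?I"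
    unfolding Infinite_Sum.abs_summable_on_Sigma_iff
  proof (intro conjI ballI)
    show "(\<lambda>\<alpha>. norm (case (i, \<alpha>) of (i, \<alpha>) \<Rightarrow> D i \<alpha>)) summable_on ?I" for i
      using D_norm(1)[of i] by simp
    show "(\<lambda>i. norm (\<Sum>\<^sub>\<infinity>\<alpha>\<in>?I. norm (case (i, \<alpha>) of (i, \<alpha>) \<Rightarrow> D i \<alpha>))) summable_on UNIV"
    proof (rule summable_on_comparison_test[OF c])
      show "norm (\<Sum>\<^sub>\<infinity>\<alpha>\<in>?I. norm (case (i, \<alpha>) of (i, \<alpha>) \<Rightarrow> D i \<alpha>)) \<le> norm (c i) * exp (R * (\<Sum>b\<in>Basis. \<bar>k i \<bullet> b\<bar>))" for i
        using D_norm(2)[of i] by (simp add: infsum_nonneg)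
    qed auto
  qed
  then have D_sum1: "(\<lambda>(i, \<alpha>). D i \<alpha>) summable_on UNIV \<times> ?I"
    by (rule abs_summable_summable)
  then have D_sum2: "(\<lambda>(\<alpha>, i). D i \<alpha>) summable_on ?I \<times> UNIV"
    by (subst (asm) summable_on_swap) (simp add: case_prod_unfold)
  have inner: "(\<Sum>\<^sub>\<infinity>\<alpha>\<in>?I. D i \<alpha>) = c i * cis (k i \<bullet> \<psi>)" for i
  proof -
    have "(\<Sum>\<^sub>\<infinity>\<alpha>\<in>?I. D i \<alpha>) = c i * cis (k i \<bullet> p) * (\<Sum>\<^sub>\<infinity>\<alpha>\<in>?I. e i \<alpha> * of_real (Z \<alpha>))"
      unfolding D_def by (rule infsum_cmult_right')
    also have "\<dots> = c i * cis (k i \<bullet> p) * cis (k i \<bullet> z)" unfolding s(2) u_sum ..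
    also have "\<dots> = c i * cis (k i \<bullet> \<psi>)"
      by (simp add: z_def cis_mult mult.assoc inner_diff_right)
    finally show ?thesis .
  qed
  have outer: "(\<Sum>\<^sub>\<infinity>i. D i \<alpha>) = A \<alpha> * of_real (Z \<alpha>)" for \<alpha>
    unfolding A_def D_def by (subst infsum_cmult_left'[symmetric]) (simp add: mult.assoc)
  have "((\<lambda>\<alpha>. \<Sum>\<^sub>\<infinity>i. D i \<alpha>) has_sum (\<Sum>\<^sub>\<infinity>\<alpha>\<in>?I. \<Sum>\<^sub>\<infinity>i. D i \<alpha>)) ?I"
    by (rule has_sum_infsum) (use summable_on_Sigma_banach[OF D_sum2] in simp)
  also have "(\<Sum>\<^sub>\<infinity>\<alpha>\<in>?I. \<Sum>\<^sub>\<infinity>i. D i \<alpha>) = (\<Sum>\<^sub>\<infinity>i. \<Sum>\<^sub>\<infinity>\<alpha>\<in>?I. D i \<alpha>)"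
    by (rule infsum_swap_banach[OF D_sum2])
  finally have "((\<lambda>\<alpha>. A \<alpha> * of_real (Z \<alpha>)) has_sum (\<Sum>\<^sub>\<infinity>i. c i * cis (k i \<bullet> \<psi>))) ?I"
    unfolding inner outer .
  note sum = has_sum_Re[OF this]
  have "Re (w * of_real r) = Re w * r" for w r by simp
  from sum[unfolded this]
  show "((\<lambda>\<alpha>. Re (A \<alpha>) * (\<Prod>b\<in>Basis. ((\<psi> - p) \<bullet> b) ^ \<alpha> b)) has_sum Re (\<Sum>\<^sub>\<infinity>i. c i * cis (k i \<bullet> \<psi>))) ?I"
    unfolding Z_def z_def .
qed

section \<open>Local bounds for real analytic functions\<close>

lemma has_sum_finite_sum:
  fixes f :: "'i \<Rightarrow> 'a \<Rightarrow> 'b::topological_comm_monoid_add"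
  assumes "\<And>i. i \<in> I \<Longrightarrow> (f i has_sum S i) A"
  shows "((\<lambda>x. \<Sum>i\<in>I. f i x) has_sum (\<Sum>i\<in>I. S i)) A"
  using assms by (induction I rule: infinite_finite_induct) (auto intro!: has_sum_add)

lemma alternating_binomial_power_sum:
  fixes x h :: "'a::comm_ring_1"
  assumes "n < k"
  shows "(\<Sum>m\<le>k. (-1) ^ m * of_nat (k choose m) * (x + of_nat m * h) ^ n) = 0"
  using assms
proof (induction k arbitrary: n x)
  case (Suc k)
  define D where "D x = (\<Sum>m\<le>k. (-1) ^ m * of_nat (k choose m) * (x + of_nat m * h) ^ n)" for x
  have rec: "(\<Sum>m\<le>Suc k. (-1) ^ m * of_nat (Suc k choose m) * (x + of_nat m * h) ^ n) = D x - D (x + h)"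
  proof -
    let ?g = "\<lambda>m. (-1) ^ m * (x + of_nat m * h) ^ n"
    have "(\<Sum>m\<le>Suc k. (-1) ^ m * of_nat (Suc k choose m) * (x + of_nat m * h) ^ n)
        = x ^ n + (\<Sum>m\<le>k. of_nat (Suc k choose Suc m) * ?g (Suc m))"
      by (subst sum.atMost_Suc_shift) (simp add: mult_ac)
    also have "(\<Sum>m\<le>k. of_nat (Suc k choose Suc m) * ?g (Suc m))
        = (\<Sum>m\<le>k. of_nat (k choose m) * ?g (Suc m)) + (\<Sum>m\<le>k. of_nat (k choose Suc m) * ?g (Suc m))"
      unfolding binomial_Suc_Suc of_nat_add distrib_right sum.distrib ..
    also have "(\<Sum>m\<le>k. of_nat (k choose m) * ?g (Suc m)) = - D (x + h)"
      unfolding D_def sum_negf[symmetric] by (intro sum.cong) (auto simp: algebra_simps)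
    also have "x ^ n + (- D (x + h) + (\<Sum>m\<le>k. of_nat (k choose Suc m) * ?g (Suc m)))
        = (\<Sum>m\<le>Suc k. of_nat (k choose m) * ?g m) - D (x + h)"
      by (subst sum.atMost_Suc_shift) simp
    also have "(\<Sum>m\<le>Suc k. of_nat (k choose m) * ?g m) = D x"
      unfolding D_def by (simp add: mult_ac binomial_eq_0)
    finally show ?thesis .
  qed
  show ?case
  proof (cases "n < k")
    case True
    have "D x = 0" "D (x + h) = 0" unfolding D_def by (rule Suc.IH[OF True])+
    then show ?thesis using rec by simp
  next
    case False
    then have n: "n = k" using Suc.prems by simp
    have diff: "(x + h) ^ n = x ^ n + (\<Sum>j<n. of_nat (n choose j) * x ^ j * h ^ (n - j))" for x
      by (simp add: binomial_ring lessThan_Suc_atMost[symmetric])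
    have "D (x + h) = (\<Sum>m\<le>k. (-1) ^ m * of_nat (k choose m) * ((x + of_nat m * h) + h) ^ n)"
      unfolding D_def by (simp add: add_ac)
    also have "\<dots> = D x + (\<Sum>m\<le>k. \<Sum>j<n. (of_nat (n choose j) * h ^ (n - j)) *
        ((-1) ^ m * of_nat (k choose m) * (x + of_nat m * h) ^ j))"
      unfolding diff D_def by (simp add: distrib_left sum.distrib sum_distrib_left mult_ac)
    also have "(\<Sum>m\<le>k. \<Sum>j<n. (of_nat (n choose j) * h ^ (n - j)) *
        ((-1) ^ m * of_nat (k choose m) * (x + of_nat m * h) ^ j)) =
        (\<Sum>j<n. (of_nat (n choose j) * h ^ (n - j)) * (\<Sum>m\<le>k. (-1) ^ m * of_nat (k choose m) * (x + of_nat m * h) ^ j))"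
      by (subst sum.swap) (simp add: sum_distrib_left)
    also have "\<dots> = 0"
      by (intro sum.neutral ballI) (use Suc.IH n in auto)
    finally show ?thesis using rec by simp
  qed
qed simp

text \<open>Absolute convergence at one corner of a cube controls the power series on the whole cube.\<close>

lemma real_analyticE:
  fixes f :: "'a::euclidean_space \<Rightarrow> real"
  assumes "real_analytic f"
  obtains \<sigma> a where "0 < \<sigma>"
    "(\<lambda>\<alpha>. \<bar>a \<alpha>\<bar> * (\<Prod>b\<in>Basis. \<sigma> ^ \<alpha> b)) summable_on (Basis \<rightarrow>\<^sub>E (UNIV :: nat set))"
    "\<forall>y. (\<forall>b\<in>Basis. \<bar>y \<bullet> b\<bar> \<le> \<sigma>) \<longrightarrow>
       ((\<lambda>\<alpha>. a \<alpha> * (\<Prod>b\<in>Basis. (y \<bullet> b) ^ \<alpha> b)) has_sum f (p + y)) (Basis \<rightarrow>\<^sub>E (UNIV :: nat set))"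
proof -
  obtain r a where r: "r > 0" and a: "\<forall>x\<in>ball p r.
      ((\<lambda>\<alpha>. a \<alpha> * (\<Prod>b\<in>Basis. ((x - p) \<bullet> b) ^ \<alpha> b)) has_sum f x) (Basis \<rightarrow>\<^sub>E (UNIV :: nat set))"
    using assms[unfolded real_analytic_def, THEN spec, of p] by (elim exE conjE) (rule that)
  note a = bspec[OF a]
  define \<sigma> where "\<sigma> = r / (2 * (real DIM('a) + 1))"
  define z where "z = (\<Sum>b\<in>Basis. \<sigma> *\<^sub>R (b :: 'a))"
  have \<sigma>: "\<sigma> > 0" using r by (simp add: \<sigma>_def)
  have zb: "z \<bullet> b = \<sigma>" if "b \<in> Basis" for b
    unfolding z_def by (simp add: inner_sum_left inner_Basis that if_distrib cong: if_cong)
  have "norm z \<le> (\<Sum>b\<in>(Basis :: 'a set). \<bar>\<sigma>\<bar>)"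
    unfolding z_def by (rule order.trans[OF norm_sum]) (rule sum_mono, simp)
  also have "\<dots> = real DIM('a) * \<sigma>" using \<sigma> by simp
  also have "\<dots> < r" using r unfolding \<sigma>_def by (simp add: field_simps add_nonneg_pos)
  finally have z: "norm z < r" .
  show ?thesis
  proof (rule that[of \<sigma> a])
    show "0 < \<sigma>" by fact
    have "p + z \<in> ball p r" using z by (simp add: dist_norm)
    from has_sum_imp_summable[OF a[OF this]]
    have "(\<lambda>\<alpha>. a \<alpha> * (\<Prod>b\<in>(Basis :: 'a set). \<sigma> ^ \<alpha> b)) summable_on (Basis \<rightarrow>\<^sub>E (UNIV :: nat set))"
      by (simp add: zb)
    from summable_on_iff_abs_summable_on_real[THEN iffD1, OF this] show "(\<lambda>\<alpha>. \<bar>a \<alpha>\<bar> * (\<Prod>b\<in>Basis. \<sigma> ^ \<alpha> b)) summable_on ((Basis :: 'a set) \<rightarrow>\<^sub>E (UNIV :: nat set))"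
      using \<sigma> by (simp add: abs_mult abs_prod)
    show "\<forall>y. (\<forall>b\<in>Basis. \<bar>y \<bullet> b\<bar> \<le> \<sigma>) \<longrightarrow>
       ((\<lambda>\<alpha>. a \<alpha> * (\<Prod>b\<in>Basis. (y \<bullet> b) ^ \<alpha> b)) has_sum f (p + y)) (Basis \<rightarrow>\<^sub>E UNIV)"
    proof (intro allI impI)
      fix y :: 'a assume y: "\<forall>b\<in>Basis. \<bar>y \<bullet> b\<bar> \<le> \<sigma>"
      have "norm y \<le> norm z" by (rule norm_le_componentwise) (use y zb \<sigma> in auto)
      then have "p + y \<in> ball p r" using z by (simp add: dist_norm)
      from a[OF this] show "((\<lambda>\<alpha>. a \<alpha> * (\<Prod>b\<in>Basis. (y \<bullet> b) ^ \<alpha> b)) has_sum f (p + y)) (Basis \<rightarrow>\<^sub>E UNIV)"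
        by simp
    qed
  qed
qed

lemma real_analytic_isCont:
  fixes f :: "'a::euclidean_space \<Rightarrow> real"
  assumes "real_analytic f"
  shows "isCont f p"
proof -
  let ?I = "(Basis :: 'a set) \<rightarrow>\<^sub>E (UNIV :: nat set)"
  obtain \<sigma> a where \<sigma>: "0 < \<sigma>"
    and sum: "(\<lambda>\<alpha>. \<bar>a \<alpha>\<bar> * (\<Prod>b\<in>Basis. \<sigma> ^ \<alpha> b)) summable_on ?I"
    and f: "\<forall>y. (\<forall>b\<in>Basis. \<bar>y \<bullet> b\<bar> \<le> \<sigma>) \<longrightarrow>
       ((\<lambda>\<alpha>. a \<alpha> * (\<Prod>b\<in>Basis. (y \<bullet> b) ^ \<alpha> b)) has_sum f (p + y)) ?I"
    by (rule real_analyticE[OF assms, where p = p]) (rule that)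
  have yb: "\<bar>(x - p) \<bullet> b\<bar> \<le> \<sigma>" if "x \<in> ball p \<sigma>" "b \<in> Basis" for x b
    using Basis_le_norm[OF that(2), of "x - p"] that(1) by (simp add: dist_norm norm_minus_commute)
  have "uniform_limit (ball p \<sigma>) (\<lambda>F x. \<Sum>\<alpha>\<in>F. a \<alpha> * (\<Prod>b\<in>Basis. ((x - p) \<bullet> b) ^ \<alpha> b)) f (finite_subsets_at_top ?I)"
  proof (rule Weierstrass_m_test_general'[OF _ _ sum])
    fix \<alpha> x assume "x \<in> ball p \<sigma>"
    then have "(\<Prod>b\<in>Basis. \<bar>(x - p) \<bullet> b\<bar> ^ \<alpha> b) \<le> (\<Prod>b\<in>Basis. \<sigma> ^ \<alpha> b)"
      by (intro prod_mono conjI power_mono yb) auto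
    then show "norm (a \<alpha> * (\<Prod>b\<in>Basis. ((x - p) \<bullet> b) ^ \<alpha> b)) \<le> \<bar>a \<alpha>\<bar> * (\<Prod>b\<in>Basis. \<sigma> ^ \<alpha> b)"
      by (simp add: abs_mult abs_prod power_abs mult_left_mono)
  next
    fix x assume "x \<in> ball p \<sigma>"
    then show "((\<lambda>\<alpha>. a \<alpha> * (\<Prod>b\<in>Basis. ((x - p) \<bullet> b) ^ \<alpha> b)) has_sum f x) ?I"
      using f[rule_format, of "x - p"] yb by simp
  qed
  then have "continuous_on (ball p \<sigma>) f"
    by (rule uniform_limit_theorem[rotated]) (auto intro!: always_eventually continuous_intros)
  then show ?thesis using \<sigma> by (simp add: continuous_on_eq_continuous_at)
qed

lemma real_analytic_continuous_on: "real_analytic f \<Longrightarrow> continuous_on S f"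
  using real_analytic_isCont continuous_at_imp_continuous_on by blast

lemma real_analytic_difference_bound_local:
  fixes f :: "'a::euclidean_space \<Rightarrow> real"
  assumes "real_analytic f"
  obtains A \<delta> where "0 \<le> A" "0 < \<delta>"
    "\<And>q c k s. dist p q < \<delta> \<Longrightarrow> c \<in> Basis \<Longrightarrow> 0 \<le> s \<Longrightarrow> real k * s \<le> \<delta> \<Longrightarrow>
       \<bar>\<Sum>m\<le>k. (-1) ^ m * real (k choose m) * f (q + (real m * s) *\<^sub>R c)\<bar> \<le> A"
proof -
  obtain \<sigma> a where \<sigma>: "0 < \<sigma>"
    and sum: "(\<lambda>\<alpha>. \<bar>a \<alpha>\<bar> * (\<Prod>b\<in>Basis. \<sigma> ^ \<alpha> b)) summable_on ((Basis :: 'a set) \<rightarrow>\<^sub>E (UNIV :: nat set))"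
    and f: "\<forall>y. (\<forall>b\<in>Basis. \<bar>y \<bullet> b\<bar> \<le> \<sigma>) \<longrightarrow>
       ((\<lambda>\<alpha>. a \<alpha> * (\<Prod>b\<in>Basis. (y \<bullet> b) ^ \<alpha> b)) has_sum f (p + y)) (Basis \<rightarrow>\<^sub>E (UNIV :: nat set))"
    by (rule real_analyticE[OF assms, where p = p]) (rule that)
  note f = f[rule_format]
  define A where "A = (\<Sum>\<^sub>\<infinity>\<alpha>\<in>(Basis :: 'a set) \<rightarrow>\<^sub>E UNIV. \<bar>a \<alpha>\<bar> * (\<Prod>b\<in>Basis. \<sigma> ^ \<alpha> b))"
  show ?thesis
  proof (rule that[of A "\<sigma> / 4"])
    show "0 \<le> A" unfolding A_def using \<sigma> by (intro infsum_nonneg mult_nonneg_nonneg prod_nonneg) auto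
    show "0 < \<sigma> / 4" using \<sigma> by simp
    fix q c :: 'a and k :: nat and s :: real
    assume q: "dist p q < \<sigma> / 4" and c: "c \<in> Basis" and s: "0 \<le> s" "real k * s \<le> \<sigma> / 4"
    define w where "w m = (-1) ^ m * real (k choose m)" for m
    define y where "y m = q - p + (real m * s) *\<^sub>R c" for m
    have yc: "y m \<bullet> b = (q - p) \<bullet> b + (if b = c then real m * s else 0)" if "b \<in> Basis" for m b
      unfolding y_def using that c by (simp add: inner_add_left inner_Basis)
    have yb: "\<bar>y m \<bullet> b\<bar> \<le> \<sigma> / 2" if "b \<in> Basis" "m \<le> k" for m b
    proof -
      have "\<bar>(q - p) \<bullet> b\<bar> \<le> \<sigma> / 4"
        using Basis_le_norm[OF that(1), of "q - p"] q by (simp add: dist_norm norm_minus_commute)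
      moreover have "real m * s \<le> real k * s" "0 \<le> real m * s" using that s by (auto intro!: mult_right_mono)
      ultimately have "\<bar>(q - p) \<bullet> b\<bar> \<le> \<sigma> / 4" "0 \<le> (if b = c then real m * s else 0)"
        "(if b = c then real m * s else 0) \<le> \<sigma> / 4" using s(2) \<sigma> by auto
      then show ?thesis unfolding yc[OF that(1)] by linarith
    qed
    have "((\<lambda>\<alpha>. \<Sum>m\<le>k. w m * (a \<alpha> * (\<Prod>b\<in>Basis. (y m \<bullet> b) ^ \<alpha> b))) has_sum (\<Sum>m\<le>k. w m * f (p + y m)))
        (Basis \<rightarrow>\<^sub>E (UNIV :: nat set))"
    proof (intro has_sum_finite_sum has_sum_cmult_right f)
      show "\<bar>y m \<bullet> b\<bar> \<le> \<sigma>" if "m \<in> {..k}" "b \<in> Basis" for m b using yb[of b m] that \<sigma> by simp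
    qed
    moreover have "((\<lambda>\<alpha>. \<bar>a \<alpha>\<bar> * (\<Prod>b\<in>Basis. \<sigma> ^ \<alpha> b)) has_sum A) ((Basis :: 'a set) \<rightarrow>\<^sub>E (UNIV :: nat set))"
      unfolding A_def by (intro has_sum_infsum sum)
    ultimately have "norm (\<Sum>m\<le>k. w m * f (p + y m)) \<le> A"
    proof (rule norm_infsum_le)
      fix \<alpha> assume "\<alpha> \<in> (Basis :: 'a set) \<rightarrow>\<^sub>E (UNIV :: nat set)"
      show "norm (\<Sum>m\<le>k. w m * (a \<alpha> * (\<Prod>b\<in>Basis. (y m \<bullet> b) ^ \<alpha> b))) \<le> \<bar>a \<alpha>\<bar> * (\<Prod>b\<in>Basis. \<sigma> ^ \<alpha> b)"
      proof (cases "\<alpha> c < k")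
        case True
        have "(\<Prod>b\<in>Basis. (y m \<bullet> b) ^ \<alpha> b)
            = ((q - p) \<bullet> c + real m * s) ^ \<alpha> c * (\<Prod>b\<in>Basis - {c}. ((q - p) \<bullet> b) ^ \<alpha> b)" for m
          using c by (subst prod.remove[OF _ c]) (auto simp: yc)
        then have "(\<Sum>m\<le>k. w m * (a \<alpha> * (\<Prod>b\<in>Basis. (y m \<bullet> b) ^ \<alpha> b)))
          = a \<alpha> * (\<Prod>b\<in>Basis - {c}. ((q - p) \<bullet> b) ^ \<alpha> b) * (\<Sum>m\<le>k. w m * ((q - p) \<bullet> c + real m * s) ^ \<alpha> c)"
          by (simp add: sum_distrib_left mult_ac)
        also have "\<dots> = 0"
          using alternating_binomial_power_sum[OF True, of "(q - p) \<bullet> c" s] by (simp add: w_def)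
        finally show ?thesis using \<sigma> by (simp add: prod_nonneg)
      next
        case False
        have pr: "\<bar>\<Prod>b\<in>Basis. (y m \<bullet> b) ^ \<alpha> b\<bar> \<le> (1 / 2) ^ k * (\<Prod>b\<in>(Basis :: 'a set). \<sigma> ^ \<alpha> b)" if "m \<le> k" for m
        proof -
          have "\<bar>\<Prod>b\<in>Basis. (y m \<bullet> b) ^ \<alpha> b\<bar> \<le> (\<Prod>b\<in>(Basis :: 'a set). (if b = c then (1 / 2) ^ k else 1) * \<sigma> ^ \<alpha> b)"
            unfolding abs_prod
          proof (rule prod_mono, safe)
            fix b :: 'a assume b: "b \<in> Basis"
            have "\<bar>y m \<bullet> b\<bar> ^ \<alpha> b \<le> (\<sigma> / 2) ^ \<alpha> b" by (intro power_mono yb b that) simp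
            also have "\<dots> = (1 / 2) ^ \<alpha> b * \<sigma> ^ \<alpha> b" by (simp add: power_divide)
            also have "\<dots> \<le> (if b = c then (1 / 2) ^ k else 1) * \<sigma> ^ \<alpha> b"
              using False \<sigma> power_decreasing[of k "\<alpha> c" "1/2 :: real"]
              by (intro mult_right_mono) (auto simp: power_le_one)
            finally show "\<bar>(y m \<bullet> b) ^ \<alpha> b\<bar> \<le> (if b = c then (1 / 2) ^ k else 1) * \<sigma> ^ \<alpha> b"
              by (simp add: power_abs)
          qed simp
          also have "\<dots> = (1 / 2) ^ k * (\<Prod>b\<in>Basis. \<sigma> ^ \<alpha> b)"
            unfolding prod.distrib using c by (simp add: prod.If_cases)
          finally show ?thesis .
        qed
        have "norm (\<Sum>m\<le>k. w m * (a \<alpha> * (\<Prod>b\<in>Basis. (y m \<bullet> b) ^ \<alpha> b)))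
            \<le> (\<Sum>m\<le>k. real (k choose m) * (\<bar>a \<alpha>\<bar> * ((1 / 2) ^ k * (\<Prod>b\<in>(Basis :: 'a set). \<sigma> ^ \<alpha> b))))"
        proof (rule order.trans[OF norm_sum], rule sum_mono)
          fix m assume "m \<in> {..k}"
          then have "real (k choose m) * (\<bar>a \<alpha>\<bar> * \<bar>\<Prod>b\<in>Basis. (y m \<bullet> b) ^ \<alpha> b\<bar>)
              \<le> real (k choose m) * (\<bar>a \<alpha>\<bar> * ((1 / 2) ^ k * (\<Prod>b\<in>(Basis :: 'a set). \<sigma> ^ \<alpha> b)))"
            by (intro mult_left_mono pr) auto
          then show "norm (w m * (a \<alpha> * (\<Prod>b\<in>Basis. (y m \<bullet> b) ^ \<alpha> b)))
            \<le> real (k choose m) * (\<bar>a \<alpha>\<bar> * ((1 / 2) ^ k * (\<Prod>b\<in>(Basis :: 'a set). \<sigma> ^ \<alpha> b)))"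
            by (simp add: w_def abs_mult power_abs)
        qed
        also have "\<dots> = real (\<Sum>m\<le>k. k choose m) * (1 / 2) ^ k * (\<bar>a \<alpha>\<bar> * (\<Prod>b\<in>(Basis :: 'a set). \<sigma> ^ \<alpha> b))"
          unfolding of_nat_sum sum_distrib_right by (rule sum.cong) (simp_all add: mult_ac)
        also have "real (\<Sum>m\<le>k. k choose m) * (1 / 2) ^ k = 1"
          by (simp add: choose_row_sum power_divide)
        finally show ?thesis by simp
      qed
    qed
    then show "\<bar>\<Sum>m\<le>k. (-1) ^ m * real (k choose m) * f (q + (real m * s) *\<^sub>R c)\<bar> \<le> A"
      by (simp add: w_def y_def)
  qed
qed

lemma real_analytic_difference_bound:
  fixes f :: "'a::euclidean_space \<Rightarrow> real"
  assumes "real_analytic f" "compact K"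
  obtains A \<delta> where "0 \<le> A" "0 < \<delta>"
    "\<forall>q\<in>K. \<forall>c\<in>Basis. \<forall>k s. 0 \<le> s \<longrightarrow> real k * s \<le> \<delta> \<longrightarrow>
       \<bar>\<Sum>m\<le>k. (-1) ^ m * real (k choose m) * f (q + (real m * s) *\<^sub>R c)\<bar> \<le> A"
proof -
  define P where "P p A \<delta> \<longleftrightarrow> 0 \<le> A \<and> 0 < \<delta> \<and> (\<forall>q c k s. dist p q < \<delta> \<longrightarrow> c \<in> Basis \<longrightarrow> 0 \<le> s \<longrightarrow> real k * s \<le> \<delta> \<longrightarrow>
       \<bar>\<Sum>m\<le>k. (-1) ^ m * real (k choose m) * f (q + (real m * s) *\<^sub>R c)\<bar> \<le> A)" for p A \<delta>
  have "\<exists>A \<delta>. P p A \<delta>" for p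
    by (rule real_analytic_difference_bound_local[OF assms(1), of p]) (unfold P_def, blast)
  then obtain A \<delta> where A: "\<And>p. P p (A p) (\<delta> p)" by metis
  have "K \<subseteq> (\<Union>p\<in>K. ball p (\<delta> p))" using A unfolding P_def by auto
  then obtain F where F: "F \<subseteq> K" "finite F" "K \<subseteq> (\<Union>p\<in>F. ball p (\<delta> p))"
    using compactE_image[OF assms(2), of K "\<lambda>p. ball p (\<delta> p)"] by auto
  define d where "d = Min (insert 1 (\<delta> ` F))"
  show ?thesis
  proof (rule that[of "sum A F" d])
    show "0 \<le> sum A F" using A unfolding P_def by (intro sum_nonneg) auto
    show "0 < d" unfolding d_def using A F(2) unfolding P_def by auto
    show "\<forall>q\<in>K. \<forall>c\<in>Basis. \<forall>k s. 0 \<le> s \<longrightarrow> real k * s \<le> d \<longrightarrow>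
       \<bar>\<Sum>m\<le>k. (-1) ^ m * real (k choose m) * f (q + (real m * s) *\<^sub>R c)\<bar> \<le> sum A F"
    proof (intro ballI allI impI)
      fix q c :: 'a and k :: nat and s :: real
      assume h: "q \<in> K" "c \<in> Basis" "0 \<le> s" "real k * s \<le> d"
      then obtain p where p: "p \<in> F" "dist p q < \<delta> p" using F(3) by auto
      have "d \<le> \<delta> p" unfolding d_def using p F(2) by (intro Min_le) auto
      with h have "real k * s \<le> \<delta> p" by linarith
      with A[of p] p h have "\<bar>\<Sum>m\<le>k. (-1) ^ m * real (k choose m) * f (q + (real m * s) *\<^sub>R c)\<bar> \<le> A p"
        unfolding P_def by auto
      also have "A p \<le> sum A F" using A F p unfolding P_def by (intro member_le_sum) auto
      finally show "\<bar>\<Sum>m\<le>k. (-1) ^ m * real (k choose m) * f (q + (real m * s) *\<^sub>R c)\<bar> \<le> sum A F" .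
    qed
  qed
qed

section \<open>Fourier coefficients on the torus\<close>

definition mode :: "int ^ 'd \<Rightarrow> real ^ 'd \<Rightarrow> complex" where
  "mode \<nu> \<psi> = cis (\<Sum>i\<in>UNIV. of_int (\<nu> $ i) * \<psi> $ i)"

abbreviation torus_box :: "(real ^ 'd) set" where
  "torus_box \<equiv> cbox 0 (\<chi> i. 2 * pi)"

lemma norm_mode [simp]: "norm (mode \<nu> \<psi>) = 1"
  by (simp add: mode_def)

lemma mode_zero [simp]: "mode 0 \<psi> = 1"
  by (simp add: mode_def)

lemma mode_add: "mode (\<nu> + \<mu>) \<psi> = mode \<nu> \<psi> * mode \<mu> \<psi>"
  by (simp add: mode_def cis_mult sum.distrib distrib_right)

lemma mode_uminus: "mode (- \<nu>) \<psi> = cnj (mode \<nu> \<psi>)"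
  by (simp add: mode_def cis_cnj sum_negf)

lemma mode_plus: "mode \<nu> (\<psi> + \<phi>) = mode \<nu> \<psi> * mode \<nu> \<phi>"
  by (simp add: mode_def cis_mult sum.distrib distrib_left)

lemma mode_axis: "mode \<nu> (axis i s) = cis (of_int (\<nu> $ i) * s)"
  by (simp add: mode_def axis_def if_distrib cong: if_cong)

lemma mode_periodic: "mode \<nu> (\<psi> + axis i (2 * pi)) = mode \<nu> \<psi>"
proof -
  have "cis (of_int (\<nu> $ i) * (2 * pi)) = 1"
    using cis_multiple_2pi[of "of_int (\<nu> $ i)"] by (simp add: mult.commute)
  then show ?thesis by (simp add: mode_plus mode_axis)
qed

lemma continuous_on_mode [continuous_intros]:
  "continuous_on S h \<Longrightarrow> continuous_on S (\<lambda>x. mode \<nu> (h x))"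
  unfolding mode_def cis_conv_exp by (intro continuous_intros)

lemma periodic_lattice:
  fixes h :: "real ^ 'd \<Rightarrow> 'b"
  assumes "\<And>\<psi> i. h (\<psi> + axis i (2 * pi)) = h \<psi>"
  shows "h (\<psi> + (\<chi> i. 2 * pi * of_int (k i))) = h \<psi>"
proof -
  have nat: "h (\<psi> + axis i (2 * pi * real n)) = h \<psi>" for \<psi> i n
  proof (induction n)
    case 0
    have "\<psi> + axis i (2 * pi * real 0) = \<psi>" by (simp add: axis_def vec_eq_iff)
    then show ?case by (simp only:)
  next
    case (Suc n)
    have "\<psi> + axis i (2 * pi * real (Suc n)) = (\<psi> + axis i (2 * pi * real n)) + axis i (2 * pi)"
      by (simp add: axis_def vec_eq_iff algebra_simps)
    then show ?case using assms[of "\<psi> + axis i (2 * pi * real n)" i] Suc by (simp only:)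
  qed
  have int: "h (\<psi> + axis i (2 * pi * of_int n)) = h \<psi>" for \<psi> i n
  proof (cases "n \<ge> 0")
    case True
    then show ?thesis using nat[of \<psi> i "nat n"] by simp
  next
    case False
    have "(\<psi> + axis i (2 * pi * of_int n)) + axis i (2 * pi * real (nat (- n))) = \<psi>"
      using False by (simp add: axis_def vec_eq_iff)
    then show ?thesis using nat[of "\<psi> + axis i (2 * pi * of_int n)" i "nat (- n)"] by (simp only:)
  qed
  have "h (\<psi> + (\<Sum>i\<in>A. axis i (2 * pi * of_int (k i)))) = h \<psi>" for A
  proof (induction A rule: infinite_finite_induct)
    case (insert j A)
    have "\<psi> + (\<Sum>i\<in>insert j A. axis i (2 * pi * of_int (k i)))
        = (\<psi> + (\<Sum>i\<in>A. axis i (2 * pi * of_int (k i)))) + axis j (2 * pi * of_int (k j))"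
      using insert.hyps by (simp add: add_ac)
    then show ?case
      using insert.IH int[of "\<psi> + (\<Sum>i\<in>A. axis i (2 * pi * of_int (k i)))" j "k j"] by (simp only:)
  qed auto
  moreover have "(\<Sum>i\<in>UNIV. axis i (2 * pi * of_int (k i))) = ((\<chi> i. 2 * pi * of_int (k i)) :: real ^ 'd)"
    by (simp add: vec_eq_iff axis_def if_distrib cong: if_cong)
  ultimately show ?thesis by metis
qed

lemma integral_torus_shift:
  fixes h :: "real ^ 'd \<Rightarrow> complex"
  assumes c: "continuous_on UNIV h" and p: "\<And>\<psi> i. h (\<psi> + axis i (2 * pi)) = h \<psi>"
    and s: "0 \<le> s" "s \<le> 2 * pi"
  shows "integral torus_box (\<lambda>\<psi>. h (\<psi> + axis j s)) = integral torus_box h"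
proof -
  define T :: "real ^ 'd" where "T = (\<chi> i. 2 * pi)"
  define e :: "real ^ 'd" where "e = axis j 1"
  have e: "e \<in> Basis" "\<And>x. x \<bullet> e = x $ j" by (simp_all add: e_def cart_eq_inner_axis)
  have int: "h integrable_on cbox a b" for a b
    by (rule integrable_continuous[OF continuous_on_subset[OF c]]) simp
  have "integral torus_box (\<lambda>\<psi>. h (\<psi> + axis j s)) = integral (cbox (axis j s - axis j s) (T + axis j s - axis j s)) (\<lambda>\<psi>. h (\<psi> + axis j s))"
    by (simp add: T_def)
  also have "\<dots> = integral (cbox (axis j s) (T + axis j s)) h"
    by (rule integral_shift_cbox)
  also have "\<dots> = integral (cbox (axis j s) (T + axis j s) \<inter> {x. x \<bullet> e \<le> 2 * pi}) h
      + integral (cbox (axis j s) (T + axis j s) \<inter> {x. x \<bullet> e \<ge> 2 * pi}) h"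
    by (rule integral_split[OF int e(1)])
  also have "cbox (axis j s) (T + axis j s) \<inter> {x. x \<bullet> e \<le> 2 * pi} = cbox 0 T \<inter> {x. x \<bullet> e \<ge> s}"
    unfolding e set_eq_iff Int_iff mem_Collect_eq mem_box_cart T_def
  proof (intro allI iffI; elim conjE; intro conjI allI)
    fix x :: "real ^ 'd" and i
    assume *: "\<forall>i. axis j s $ i \<le> x $ i \<and> x $ i \<le> ((\<chi> i. 2 * pi) + axis j s) $ i" "x $ j \<le> 2 * pi"
    show "0 $ i \<le> x $ i" "x $ i \<le> (\<chi> i. 2 * pi) $ i" "s \<le> x $ j"
      using *(1)[rule_format, of i] *(1)[rule_format, of j] *(2) s by (cases "i = j"; simp add: axis_def)+
  next
    fix x :: "real ^ 'd" and i
    assume *: "\<forall>i. 0 $ i \<le> x $ i \<and> x $ i \<le> (\<chi> i. 2 * pi) $ i" "s \<le> x $ j"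
    show "axis j s $ i \<le> x $ i" "x $ i \<le> ((\<chi> i. 2 * pi) + axis j s) $ i" "x $ j \<le> 2 * pi"
      using *(1)[rule_format, of i] *(1)[rule_format, of j] *(2) s by (cases "i = j"; simp add: axis_def)+
  qed
  also have "cbox (axis j s) (T + axis j s) \<inter> {x. x \<bullet> e \<ge> 2 * pi} = cbox (axis j (2 * pi)) ((\<chi> i. if i = j then s else 2 * pi) + axis j (2 * pi))"
    unfolding e set_eq_iff Int_iff mem_Collect_eq mem_box_cart T_def
  proof (intro allI iffI; (elim conjE)?; (intro conjI)?; (intro allI conjI)?)
    fix x :: "real ^ 'd" and i
    assume *: "\<forall>i. axis j s $ i \<le> x $ i \<and> x $ i \<le> ((\<chi> i. 2 * pi) + axis j s) $ i" "2 * pi \<le> x $ j"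
    show "axis j (2 * pi) $ i \<le> x $ i" "x $ i \<le> ((\<chi> i. if i = j then s else 2 * pi) + axis j (2 * pi)) $ i"
      using *(1)[rule_format, of i] *(2) s by (cases "i = j"; simp add: axis_def)+
  next
    fix x :: "real ^ 'd" and i
    assume *: "\<forall>i. axis j (2 * pi) $ i \<le> x $ i \<and> x $ i \<le> ((\<chi> i. if i = j then s else 2 * pi) + axis j (2 * pi)) $ i"
    show "axis j s $ i \<le> x $ i" "x $ i \<le> ((\<chi> i. 2 * pi) + axis j s) $ i" "2 * pi \<le> x $ j"
      using *(1)[rule_format, of i] *(1)[rule_format, of j] s by (cases "i = j"; simp add: axis_def)+
  qed
  also have "integral \<dots> h = integral (cbox 0 (\<chi> i. if i = j then s else 2 * pi)) (\<lambda>\<psi>. h (\<psi> + axis j (2 * pi)))"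
    using integral_shift_cbox[of "axis j (2 * pi)" "axis j (2 * pi)" "(\<chi> i. if i = j then s else 2 * pi) + axis j (2 * pi)" h] by simp
  also have "\<dots> = integral (cbox 0 (\<chi> i. if i = j then s else 2 * pi)) h" by (simp add: p)
  also have "cbox 0 (\<chi> i. if i = j then s else 2 * pi) = cbox 0 T \<inter> {x. x \<bullet> e \<le> s}"
    unfolding e set_eq_iff Int_iff mem_Collect_eq mem_box_cart T_def
  proof (intro allI iffI; (elim conjE)?; (intro conjI)?; (intro allI conjI)?)
    fix x :: "real ^ 'd" and i
    assume *: "\<forall>i. 0 $ i \<le> x $ i \<and> x $ i \<le> (\<chi> i. if i = j then s else 2 * pi) $ i"
    show "0 $ i \<le> x $ i" "x $ i \<le> (\<chi> i. 2 * pi) $ i" "x $ j \<le> s"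
      using *(1)[rule_format, of i] *(1)[rule_format, of j] s by (cases "i = j"; simp)+
  next
    fix x :: "real ^ 'd" and i
    assume *: "\<forall>i. 0 $ i \<le> x $ i \<and> x $ i \<le> (\<chi> i. 2 * pi) $ i" "x $ j \<le> s"
    show "0 $ i \<le> x $ i" "x $ i \<le> (\<chi> i. if i = j then s else 2 * pi) $ i"
      using *(1)[rule_format, of i] *(2) s by (cases "i = j"; simp)+
  qed
  also have "integral (cbox 0 T \<inter> {x. x \<bullet> e \<ge> s}) h + integral (cbox 0 T \<inter> {x. x \<bullet> e \<le> s}) h = integral (cbox 0 T) h"
    using integral_split[OF int e(1), of 0 T s] by simp
  finally show ?thesis by (simp add: T_def)
qed

definition fourier_coeff :: "(real ^ 'd \<Rightarrow> complex) \<Rightarrow> int ^ 'd \<Rightarrow> complex" where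
  "fourier_coeff h \<nu> = integral torus_box (\<lambda>\<psi>. h \<psi> * mode (- \<nu>) \<psi>) / complex_of_real ((2 * pi) ^ CARD('d))"

lemma norm_fourier_coeff:
  fixes h :: "real ^ 'd \<Rightarrow> complex"
  shows "norm (fourier_coeff h \<nu>) = norm (integral torus_box (\<lambda>\<psi>. h \<psi> * mode (- \<nu>) \<psi>)) / (2 * pi) ^ CARD('d)"
  unfolding fourier_coeff_def norm_divide norm_of_real by simp

lemma content_torus_box: "measure lborel (torus_box :: (real ^ 'd) set) = (2 * pi) ^ CARD('d)"
proof -
  have "(torus_box :: (real ^ 'd) set) \<noteq> {}" by (simp add: box_ne_empty Basis_vec_def inner_axis)
  then show ?thesis by (simp add: content_cbox_cart)
qed

lemma integral_mode_shift:
  fixes h :: "real ^ 'd \<Rightarrow> complex"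
  assumes c: "continuous_on UNIV h" and p: "\<And>\<psi> i. h (\<psi> + axis i (2 * pi)) = h \<psi>"
    and s: "0 \<le> s" "s \<le> 2 * pi"
  shows "integral torus_box (\<lambda>\<psi>. h (\<psi> + axis j (real m * s)) * mode (- \<nu>) \<psi>)
     = cis (of_int (\<nu> $ j) * s) ^ m * integral torus_box (\<lambda>\<psi>. h \<psi> * mode (- \<nu>) \<psi>)"
proof (induction m)
  case 0
  have "\<psi> + axis j (real 0 * s) = \<psi>" for \<psi> :: "real ^ 'd" by (simp add: axis_def vec_eq_iff)
  then show ?case by (simp only: power_0 mult_1_left)
next
  case (Suc m)
  define G where "G \<psi> = h (\<psi> + axis j (real m * s)) * mode (- \<nu>) \<psi>" for \<psi>
  have G_cont: "continuous_on UNIV G"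
    unfolding G_def by (intro continuous_intros continuous_on_compose2[OF c]) auto
  have G_per: "G (\<psi> + axis i (2 * pi)) = G \<psi>" for \<psi> i
    using p[of "\<psi> + axis j (real m * s)" i] by (simp add: G_def mode_periodic add_ac)
  have "axis j (real (Suc m) * s) = axis j s + axis j (real m * s)"
    by (simp add: axis_def vec_eq_iff algebra_simps)
  then have eq: "h (\<psi> + axis j (real (Suc m) * s)) * mode (- \<nu>) \<psi> = cis (of_int (\<nu> $ j) * s) * G (\<psi> + axis j s)" for \<psi>
    by (simp add: G_def mode_plus mode_axis add_ac cis_mult)
  have "integral torus_box (\<lambda>\<psi>. h (\<psi> + axis j (real (Suc m) * s)) * mode (- \<nu>) \<psi>)
      = cis (of_int (\<nu> $ j) * s) * integral torus_box (\<lambda>\<psi>. G (\<psi> + axis j s))"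
    unfolding eq by (rule integral_mult_right)
  also have "integral torus_box (\<lambda>\<psi>. G (\<psi> + axis j s)) = integral torus_box G"
    by (rule integral_torus_shift[OF G_cont G_per s])
  finally show ?case using Suc.IH unfolding G_def by simp
qed

lemma integral_mode:
  "integral torus_box (mode \<nu> :: real ^ 'd \<Rightarrow> complex) = (if \<nu> = 0 then (2 * pi) ^ CARD('d) else 0)"
proof (cases "\<nu> = 0")
  case True
  have "integral torus_box (\<lambda>\<psi>::real ^ 'd. 1 :: complex) = measure lborel (torus_box :: (real ^ 'd) set) *\<^sub>R 1"
    by (rule integral_const)
  moreover have "(mode 0 :: real ^ 'd \<Rightarrow> complex) = (\<lambda>_. 1)" by (simp add: fun_eq_iff)
  ultimately show ?thesis unfolding True content_torus_box by (simp add: scaleR_conv_of_real)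
next
  case False
  then obtain j where j: "\<nu> $ j \<noteq> 0" by (auto simp: vec_eq_iff)
  define s where "s = pi / \<bar>of_int (\<nu> $ j)\<bar>"
  have "1 \<le> \<bar>\<nu> $ j\<bar>" using j by simp
  then have "1 \<le> \<bar>of_int (\<nu> $ j) :: real\<bar>" by (metis of_int_1_le_iff of_int_abs)
  then have s: "0 \<le> s" "s \<le> 2 * pi" by (auto simp: s_def field_simps intro: order.trans[of _ "pi * 1"])
  have "of_int (\<nu> $ j) * s = pi \<or> of_int (\<nu> $ j) * s = - pi"
    using j by (auto simp: s_def abs_if)
  then have "cis (of_int (\<nu> $ j) * s) = -1" by (auto simp: complex_eq_iff)
  moreover have "integral torus_box (\<lambda>\<psi>. mode \<nu> (\<psi> + axis j s)) = integral torus_box (mode \<nu>)"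
    by (rule integral_torus_shift[OF _ mode_periodic s]) (intro continuous_intros)
  ultimately show ?thesis using False by (simp add: mode_plus mode_axis)
qed

text \<open>
  The difference of order \<open>k\<close> and step \<open>\<pi> / \<bar>\<nu>\<^sub>j\<bar>\<close> in direction \<open>j\<close> multiplies the coefficient of
  index \<open>\<nu>\<close> by \<open>2\<^sup>k\<close>. On the other hand it is bounded uniformly in \<open>k\<close>, since it annihilates the terms of
  the local power series whose degree in direction \<open>j\<close> is below \<open>k\<close>. Taking \<open>k\<close>
  proportional to \<open>\<bar>\<nu>\<^sub>j\<bar>\<close> gives exponential decay.
\<close>

lemma fourier_coeff_decay:
  fixes f :: "real ^ 'd \<Rightarrow> real"
  assumes per: "torus_periodic f" and an: "real_analytic f"
  obtains C \<rho> where "1 < \<rho>" "\<And>\<nu> j. norm (fourier_coeff (\<lambda>\<psi>. of_real (f \<psi>)) \<nu>) * \<rho> powr \<bar>of_int (\<nu> $ j)\<bar> \<le> C"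
proof -
  have p: "f (\<psi> + axis i (2 * pi)) = f \<psi>" for \<psi> i
    using per unfolding torus_periodic_def by simp
  have c: "continuous_on UNIV f" by (rule real_analytic_continuous_on[OF an])
  obtain A \<delta> where A: "0 \<le> A" and \<delta>: "0 < \<delta>"
    and bound: "\<forall>q\<in>torus_box. \<forall>c\<in>Basis. \<forall>k s. 0 \<le> s \<longrightarrow> real k * s \<le> \<delta> \<longrightarrow>
       \<bar>\<Sum>m\<le>k. (-1) ^ m * real (k choose m) * f (q + (real m * s) *\<^sub>R c)\<bar> \<le> A"
    by (rule real_analytic_difference_bound[OF an compact_cbox, of 0 "\<chi> i. 2 * pi"]) (rule that)
  note bound = bound[rule_format]
  let ?V = "(2 * pi) ^ CARD('d) :: real"
  let ?I = "\<lambda>\<nu>. integral torus_box (\<lambda>\<psi>. complex_of_real (f \<psi>) * mode (- \<nu>) \<psi>)"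
  have key: "norm (?I \<nu>) * 2 ^ k \<le> A * ?V"
    if "0 \<le> s" "s \<le> 2 * pi" "real k * s \<le> \<delta>" "cis (of_int (\<nu> $ j) * s) = -1 \<or> k = 0" for \<nu> j s k
  proof -
    define w where "w m = (-1) ^ m * real (k choose m)" for m
    have eq: "f (\<psi> + (real m * s) *\<^sub>R axis j 1) = f (\<psi> + axis j (real m * s))" for \<psi> m
      by (rule arg_cong[of _ _ f]) (simp add: vec_eq_iff axis_def)
    have int: "(\<lambda>\<psi>. complex_of_real (f (\<psi> + axis j (real m * s))) * mode (- \<nu>) \<psi>) integrable_on torus_box" for m
      by (intro integrable_continuous continuous_intros continuous_on_compose2[OF c]) auto
    have "integral torus_box (\<lambda>\<psi>. of_real (\<Sum>m\<le>k. w m * f (\<psi> + axis j (real m * s))) * mode (- \<nu>) \<psi>)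
        = integral torus_box (\<lambda>\<psi>. \<Sum>m\<le>k. of_real (w m) * (of_real (f (\<psi> + axis j (real m * s))) * mode (- \<nu>) \<psi>))"
      by (simp add: sum_distrib_right mult.assoc)
    also have "\<dots> = (\<Sum>m\<le>k. integral torus_box (\<lambda>\<psi>. of_real (w m) * (of_real (f (\<psi> + axis j (real m * s))) * mode (- \<nu>) \<psi>)))"
      by (rule integral_sum) (auto intro!: integrable_on_mult_right int)
    also have "\<dots> = (\<Sum>m\<le>k. of_real (w m) * (cis (of_int (\<nu> $ j) * s) ^ m * ?I \<nu>))"
    proof (rule sum.cong[OF refl])
      fix m
      have "integral torus_box (\<lambda>\<psi>. of_real (f (\<psi> + axis j (real m * s))) * mode (- \<nu>) \<psi>) = cis (of_int (\<nu> $ j) * s) ^ m * ?I \<nu>"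
        by (rule integral_mode_shift[where h = "\<lambda>\<psi>. complex_of_real (f \<psi>)"])
          (use that p in \<open>auto intro!: continuous_intros c\<close>)
      then show "integral torus_box (\<lambda>\<psi>. of_real (w m) * (of_real (f (\<psi> + axis j (real m * s))) * mode (- \<nu>) \<psi>))
        = of_real (w m) * (cis (of_int (\<nu> $ j) * s) ^ m * ?I \<nu>)" by simp
    qed
    also have "\<dots> = (\<Sum>m\<le>k. of_nat (k choose m)) * ?I \<nu>"
      unfolding sum_distrib_right using that(4)
      by (intro sum.cong) (auto simp: w_def power_mult_distrib[symmetric] mult_ac)
    also have "(\<Sum>m\<le>k. of_nat (k choose m)) = (2 ^ k :: complex)"
      unfolding of_nat_sum[symmetric] choose_row_sum by simp
    finally have "2 ^ k * ?I \<nu> = integral torus_box (\<lambda>\<psi>. of_real (\<Sum>m\<le>k. w m * f (\<psi> + axis j (real m * s))) * mode (- \<nu>) \<psi>)" ..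
    moreover have "norm (integral torus_box (\<lambda>\<psi>. of_real (\<Sum>m\<le>k. w m * f (\<psi> + axis j (real m * s))) * mode (- \<nu>) \<psi>)) \<le> A * measure lborel (torus_box :: (real ^ 'd) set)"
    proof (rule has_integral_bound[OF A integrable_integral])
      show "(\<lambda>\<psi>. of_real (\<Sum>m\<le>k. w m * f (\<psi> + axis j (real m * s))) * mode (- \<nu>) \<psi>) integrable_on torus_box"
        by (intro integrable_continuous continuous_intros continuous_on_compose2[OF c]) auto
      fix \<psi> :: "real ^ 'd" assume "\<psi> \<in> torus_box"
      from bound[OF this _ that(1,3), of "axis j 1"]
      show "norm (of_real (\<Sum>m\<le>k. w m * f (\<psi> + axis j (real m * s))) * mode (- \<nu>) \<psi>) \<le> A"
        unfolding eq w_def norm_mult norm_of_real norm_mode by simp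
    qed
    ultimately have "norm (2 ^ k * ?I \<nu>) \<le> A * ?V" by (simp add: content_torus_box)
    then show ?thesis by (simp add: norm_mult norm_power mult.commute)
  qed
  define \<rho> where "\<rho> = 2 powr (\<delta> / pi)"
  have \<rho>: "1 < \<rho>" using \<delta> by (simp add: \<rho>_def gr_one_powr)
  have main: "norm (fourier_coeff (\<lambda>\<psi>. of_real (f \<psi>)) \<nu>) * \<rho> powr \<bar>of_int (\<nu> $ j)\<bar> \<le> 2 * A" for \<nu> j
  proof (cases "\<nu> $ j = 0")
    case True
    have "norm (?I \<nu>) * 2 ^ 0 \<le> A * ?V" by (rule key[of 0]) (use \<delta> in auto)
    then have "norm (fourier_coeff (\<lambda>\<psi>. of_real (f \<psi>)) \<nu>) \<le> A"
      by (simp add: norm_fourier_coeff divide_le_eq)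
    then show ?thesis using True A \<rho> by simp
  next
    case False
    define n where "n = \<bar>of_int (\<nu> $ j) :: real\<bar>"
    have "1 \<le> \<bar>\<nu> $ j\<bar>" using False by simp
    then have n: "1 \<le> n" unfolding n_def by (metis of_int_1_le_iff of_int_abs)
    define s where "s = pi / n"
    define k where "k = nat \<lfloor>\<delta> * n / pi\<rfloor>"
    have kr: "real k \<le> \<delta> * n / pi" "\<delta> * n / pi < real k + 1"
      unfolding k_def using \<delta> n by auto
    have s: "0 \<le> s" "s \<le> 2 * pi" using n by (auto simp: s_def field_simps intro: order.trans[of _ "pi * 1"])
    have ks: "real k * s \<le> \<delta>" using kr(1) n by (simp add: s_def field_simps)
    have "of_int (\<nu> $ j) * s = pi \<or> of_int (\<nu> $ j) * s = - pi"
      using False by (auto simp: s_def n_def abs_if)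
    then have "cis (of_int (\<nu> $ j) * s) = -1" by (auto simp: complex_eq_iff)
    then have 1: "norm (?I \<nu>) * 2 ^ k \<le> A * ?V" by (intro key[OF s ks]) auto
    have "\<rho> powr n = 2 powr (\<delta> * n / pi)" by (simp add: \<rho>_def powr_powr)
    also have "\<dots> \<le> 2 powr (real k + 1)" using kr(2) by (intro powr_mono) auto
    also have "\<dots> = 2 * 2 ^ k" by (simp add: powr_add powr_realpow)
    finally have 2: "\<rho> powr n \<le> 2 * 2 ^ k" .
    have "norm (?I \<nu>) * \<rho> powr n \<le> norm (?I \<nu>) * (2 * 2 ^ k)" by (intro mult_left_mono 2) simp
    also have "\<dots> \<le> 2 * A * ?V" using 1 by simp
    finally show ?thesis
      unfolding n_def[symmetric] by (simp add: norm_fourier_coeff divide_le_eq)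
  qed
  show ?thesis by (rule that[OF \<rho> main])
qed

lemma summable_geometric_lattice:
  fixes q :: real
  assumes q: "0 \<le> q" "q < 1"
  shows "(\<lambda>\<nu> :: int ^ 'd. \<Prod>i\<in>UNIV. q ^ nat \<bar>\<nu> $ i\<bar>) summable_on UNIV"
proof -
  have sum1: "(\<lambda>n. q ^ n) summable_on UNIV"
    by (rule summable_nonneg_imp_summable_on[OF summable_geometric]) (use q in simp_all)
  have "(\<lambda>n. q ^ nat \<bar>n\<bar>) summable_on range int"
    by (rule summable_on_reindex[THEN iffD2]) (use sum1 in \<open>simp_all add: o_def\<close>)
  moreover have "(\<lambda>n. q ^ nat \<bar>n\<bar>) summable_on range (\<lambda>n. - int n)"
    by (rule summable_on_reindex[THEN iffD2]) (use sum1 in \<open>simp_all add: o_def inj_on_def\<close>)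
  ultimately have "(\<lambda>n. q ^ nat \<bar>n\<bar>) summable_on (range int \<union> range (\<lambda>n. - int n))"
    by (rule summable_on_union)
  moreover have "x \<in> range int \<union> range (\<lambda>n. - int n)" for x
    by (cases x rule: int_cases2) auto
  then have "range int \<union> range (\<lambda>n. - int n) = UNIV" by blast
  ultimately have sum: "(\<lambda>\<alpha>. \<Prod>i\<in>UNIV. q ^ nat \<bar>\<alpha> i\<bar>) summable_on ((UNIV :: 'd set) \<rightarrow>\<^sub>E (UNIV :: int set))"
    using q by (intro summable_on_prod_PiE) simp_all
  have bij: "bij_betw vec_nth (UNIV :: (int ^ 'd) set) (UNIV \<rightarrow>\<^sub>E UNIV)"
    by (rule bij_betwI[where g = vec_lambda]) auto
  show ?thesis
    using sum unfolding summable_on_reindex_bij_betw[OF bij, symmetric] .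
qed

lemma fourier_coeff_summable:
  fixes f :: "real ^ 'd \<Rightarrow> real"
  assumes "torus_periodic f" "real_analytic f"
  obtains \<rho> where "1 < \<rho>"
    "(\<lambda>\<nu>. norm (fourier_coeff (\<lambda>\<psi>. of_real (f \<psi>)) \<nu>) * \<rho> ^ (\<Sum>i\<in>UNIV. nat \<bar>\<nu> $ i\<bar>)) summable_on UNIV"
proof -
  let ?c = "fourier_coeff (\<lambda>\<psi>. of_real (f \<psi>))"
  obtain C \<rho> where \<rho>: "1 < \<rho>" and C: "\<And>\<nu> j. norm (?c \<nu>) * \<rho> powr \<bar>of_int (\<nu> $ j)\<bar> \<le> C"
    by (rule fourier_coeff_decay[OF assms]) (rule that)
  define r where "r = \<rho> powr (1 / (2 * real CARD('d)))"
  have r: "1 < r" using \<rho> by (simp add: r_def gr_one_powr)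
  have "0 \<le> norm (?c 0) * \<rho> powr \<bar>of_int (0 $ undefined)\<bar>" by simp
  from order.trans[OF this C] have C0: "0 \<le> C" .
  have le: "norm (?c \<nu>) * r ^ (\<Sum>i\<in>UNIV. nat \<bar>\<nu> $ i\<bar>) \<le> C * (\<Prod>i\<in>UNIV. (1 / r) ^ nat \<bar>\<nu> $ i\<bar>)" for \<nu>
  proof -
    have "Max (range (\<lambda>i. \<bar>\<nu> $ i\<bar>)) \<in> range (\<lambda>i. \<bar>\<nu> $ i\<bar>)" by (rule Max_in) auto
    then obtain j where "Max (range (\<lambda>i. \<bar>\<nu> $ i\<bar>)) = \<bar>\<nu> $ j\<bar>"
      by (elim imageE) (rule that)
    then have j: "\<bar>\<nu> $ i\<bar> \<le> \<bar>\<nu> $ j\<bar>" for i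
      using Max_ge[of "range (\<lambda>i. \<bar>\<nu> $ i\<bar>)" "\<bar>\<nu> $ i\<bar>"] by simp
    let ?n = "\<Sum>i\<in>UNIV. nat \<bar>\<nu> $ i\<bar>"
    have "?n \<le> CARD('d) * nat \<bar>\<nu> $ j\<bar>"
      using sum_bounded_above[of UNIV "\<lambda>i. nat \<bar>\<nu> $ i\<bar>" "nat \<bar>\<nu> $ j\<bar>"] j by (simp add: nat_mono)
    then have "real ?n \<le> real (CARD('d) * nat \<bar>\<nu> $ j\<bar>)" by (simp only: of_nat_le_iff)
    then have n: "real ?n \<le> real CARD('d) * \<bar>of_int (\<nu> $ j)\<bar>" by simp
    have "r powr real ?n = r ^ ?n" using r by (intro powr_realpow) simp
    then have "r ^ ?n * r ^ ?n = r powr (2 * real ?n)"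
      by (simp only: mult_2 powr_add)
    also have "\<dots> = \<rho> powr (real ?n / real CARD('d))"
      by (simp add: r_def powr_powr)
    also have "\<dots> \<le> \<rho> powr \<bar>of_int (\<nu> $ j)\<bar>"
      using \<rho> n by (intro powr_mono) (simp_all add: pos_divide_le_eq mult.commute[of "\<bar>of_int (\<nu> $ j)\<bar>"])
    finally have "norm (?c \<nu>) * (r ^ ?n * r ^ ?n) \<le> C"
      by (intro order.trans[OF mult_left_mono C[of \<nu> j]] norm_ge_zero)
    then have A: "norm (?c \<nu>) * r ^ ?n \<le> C * (1 / r ^ ?n)" using r by (simp add: field_simps)
    have P: "(\<Prod>i\<in>UNIV. (1 / r) ^ nat \<bar>\<nu> $ i\<bar>) = 1 / r ^ ?n"
      by (simp add: power_sum power_one_over prod_dividef)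
    show ?thesis unfolding P by (rule A)
  qed
  have "(\<lambda>\<nu>. C * (\<Prod>i\<in>UNIV. (1 / r) ^ nat \<bar>\<nu> $ i\<bar>)) summable_on (UNIV :: (int ^ 'd) set)"
    by (intro summable_on_cmult_right summable_geometric_lattice) (use r in auto)
  then have "(\<lambda>\<nu>. norm (?c \<nu>) * r ^ (\<Sum>i\<in>UNIV. nat \<bar>\<nu> $ i\<bar>)) summable_on UNIV"
    by (rule summable_on_comparison_test[OF _ le]) (use r in auto)
  then show ?thesis by (rule that[OF r])
qed

section \<open>Fourier expansion\<close>

definition torus_point :: "real ^ 'd \<Rightarrow> complex ^ 'd" where
  "torus_point \<psi> = (\<chi> i. cis (\<psi> $ i))"

lemma periodic_eqI:
  fixes h :: "real ^ 'd \<Rightarrow> 'b"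
  assumes "\<And>\<psi> i. h (\<psi> + axis i (2 * pi)) = h \<psi>" and "torus_point \<psi> = torus_point \<phi>"
  shows "h \<psi> = h \<phi>"
proof -
  have "\<exists>n::int. \<psi> $ i = \<phi> $ i + 2 * pi * of_int n" for i
  proof -
    have "cis (\<psi> $ i) = cis (\<phi> $ i)"
      using assms(2) by (simp add: torus_point_def vec_eq_iff)
    then show ?thesis using sin_cos_eq_iff[of "\<psi> $ i" "\<phi> $ i"] by (simp add: complex_eq_iff)
  qed
  then obtain k :: "'d \<Rightarrow> int" where "\<And>i. \<psi> $ i = \<phi> $ i + 2 * pi * of_int (k i)" by metis
  then have "\<psi> = \<phi> + (\<chi> i. 2 * pi * of_int (k i))" by (simp add: vec_eq_iff)
  then show ?thesis using periodic_lattice[of h \<phi> k, OF assms(1)] by simp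
qed

lemma compact_torus: "compact {w :: complex ^ 'd. \<forall>i. norm (w $ i) = 1}"
proof (rule compact_eq_bounded_closed[THEN iffD2], intro conjI)
  have "norm w \<le> real CARD('d)" if "\<forall>i. norm (w $ i) = 1" for w :: "complex ^ 'd"
    using L2_set_le_sum[of UNIV "\<lambda>i. norm (w $ i)"] that by (simp add: norm_vec_def)
  then show "bounded {w :: complex ^ 'd. \<forall>i. norm (w $ i) = 1}" unfolding bounded_iff by blast
  have "closed (\<Inter>i. {w :: complex ^ 'd. norm (w $ i) = 1})"
    by (intro closed_INT ballI closed_Collect_eq continuous_intros)
  then show "closed {w :: complex ^ 'd. \<forall>i. norm (w $ i) = 1}"
    by (simp add: Collect_all_eq)
qed

lemma torus_factor:
  fixes h :: "real ^ 'd \<Rightarrow> real"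
  assumes c: "continuous_on UNIV h" and p: "\<And>\<psi> i. h (\<psi> + axis i (2 * pi)) = h \<psi>"
  obtains F where "continuous_on {w :: complex ^ 'd. \<forall>i. norm (w $ i) = 1} F" "\<And>\<psi>. F (torus_point \<psi>) = h \<psi>"
proof -
  define F where "F w = h (\<chi> i. Arg (w $ i))" for w :: "complex ^ 'd"
  let ?K = "{w :: complex ^ 'd. \<forall>i. norm (w $ i) = 1}"
  have cis_Arg1: "cis (Arg z) = z" if "norm z = 1" for z
    using cis_Arg[of z] that by (cases "z = 0") (auto simp: sgn_eq)
  have F_eq: "F w = h \<theta>" if "torus_point \<theta> = w" for w \<theta>
    unfolding F_def
  proof (rule periodic_eqI[OF p])
    have "norm (w $ i) = 1" for i using that[symmetric] by (simp add: torus_point_def)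
    then show "torus_point (\<chi> i. Arg (w $ i)) = torus_point \<theta>"
      unfolding that by (simp add: torus_point_def vec_eq_iff cis_Arg1)
  qed
  show ?thesis
  proof (rule that[of F])
    show "F (torus_point \<psi>) = h \<psi>" for \<psi> by (rule F_eq) simp
    show "continuous_on ?K F"
      unfolding continuous_on_eq_continuous_within
    proof
      fix w0 assume w0: "w0 \<in> ?K"
      define \<theta> where "\<theta> w = (\<chi> i. Arg (w0 $ i) + Arg (w $ i / w0 $ i))" for w
      have nz: "w0 $ i \<noteq> 0" for i
      proof
        assume "w0 $ i = 0"
        moreover have "norm (w0 $ i) = 1" using w0 by simp
        ultimately show False by simp
      qed
      have "torus_point (\<theta> w) = w" if "w \<in> ?K" for w
      proof -
        have "cis (Arg (w0 $ i) + Arg (w $ i / w0 $ i)) = w $ i" for i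
        proof -
          have "cis (Arg (w0 $ i)) = w0 $ i" "cis (Arg (w $ i / w0 $ i)) = w $ i / w0 $ i"
            using w0 that by (simp_all add: cis_Arg1 norm_divide)
          then show ?thesis using nz[of i] unfolding cis_mult[symmetric] by simp
        qed
        then show ?thesis by (simp add: torus_point_def \<theta>_def vec_eq_iff)
      qed
      then have F: "F w = h (\<theta> w)" if "w \<in> ?K" for w using F_eq that by blast
      have "(\<theta> \<longlongrightarrow> \<theta> w0) (at w0)"
        unfolding \<theta>_def
      proof (intro tendsto_vec_lambda tendsto_add tendsto_const)
        fix i
        have "isCont Arg (w0 $ i / w0 $ i)"
          by (rule continuous_at_Arg) (simp add: nz)
        moreover have "((\<lambda>w. w $ i / w0 $ i) \<longlongrightarrow> w0 $ i / w0 $ i) (at w0)"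
          by (rule tendsto_divide[OF tendsto_vec_nth[OF tendsto_ident_at] tendsto_const nz])
        ultimately show "((\<lambda>w. Arg (w $ i / w0 $ i)) \<longlongrightarrow> Arg (w0 $ i / w0 $ i)) (at w0)"
          by (rule isCont_tendsto_compose)
      qed
      then have "isCont \<theta> w0" by (simp add: isCont_def)
      moreover have "isCont h (\<theta> w0)" using c by (simp add: continuous_on_eq_continuous_at)
      ultimately have "isCont (\<lambda>w. h (\<theta> w)) w0" by (rule isCont_o2)
      then have "continuous (at w0 within ?K) (\<lambda>w. h (\<theta> w))" by (rule continuous_at_imp_continuous_at_within)
      then show "continuous (at w0 within ?K) F"
        by (rule continuous_transform_within[OF _ zero_less_one w0]) (rule F[symmetric])
    qed
  qed
qed

text \<open>
  Continuous functions all of whose Fourier coefficients vanish are stable under multiplication by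
  \<open>mode \<mu>\<close>, hence by every polynomial in the \<open>cos \<psi>\<^sub>j\<close> and \<open>sin \<psi>\<^sub>j\<close>; these are uniformly dense
  by the Stone--Weierstrass theorem on the torus \<open>{w. \<forall>j. \<bar>w\<^sub>j\<bar> = 1}\<close>.
\<close>

definition fourier_null :: "(real ^ 'd \<Rightarrow> complex) \<Rightarrow> bool" where
  "fourier_null u \<longleftrightarrow> continuous_on UNIV u \<and> (\<forall>\<nu>. integral torus_box (\<lambda>\<psi>. u \<psi> * mode \<nu> \<psi>) = 0)"

lemma fourier_null_integrable:
  "fourier_null u \<Longrightarrow> (\<lambda>\<psi>. u \<psi> * mode \<nu> \<psi>) integrable_on cbox a b"
  unfolding fourier_null_def
  by (intro integrable_continuous continuous_intros) (auto elim: continuous_on_subset)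

lemma fourier_null_cmult: "fourier_null u \<Longrightarrow> fourier_null (\<lambda>\<psi>. c * u \<psi>)"
  unfolding fourier_null_def by (auto intro!: continuous_intros simp: mult.assoc)

lemma fourier_null_add:
  assumes "fourier_null u" "fourier_null v"
  shows "fourier_null (\<lambda>\<psi>. u \<psi> + v \<psi>)"
  using assms integral_add[OF fourier_null_integrable[OF assms(1)] fourier_null_integrable[OF assms(2)]]
  unfolding fourier_null_def by (auto intro!: continuous_intros simp: distrib_right)

lemma fourier_null_sum:
  "(\<And>i. i \<in> I \<Longrightarrow> fourier_null (u i)) \<Longrightarrow> fourier_null (\<lambda>\<psi>. \<Sum>i\<in>I. u i \<psi>)"
  by (induction I rule: infinite_finite_induct)
    (auto intro!: fourier_null_add simp: fourier_null_def[of "\<lambda>_. 0"])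

lemma fourier_null_mode: "fourier_null u \<Longrightarrow> fourier_null (\<lambda>\<psi>. u \<psi> * mode \<mu> \<psi>)"
  unfolding fourier_null_def by (auto intro!: continuous_intros simp: mult.assoc mode_add[symmetric])

lemma mode_axis_index: "mode (axis i 1) \<psi> = cis (\<psi> $ i)"
proof -
  have "(\<Sum>k\<in>UNIV. of_int (axis i 1 $ k) * \<psi> $ k) = (\<Sum>k\<in>UNIV. if k = i then \<psi> $ k else 0)"
    by (rule sum.cong) (auto simp: axis_def)
  then show ?thesis by (simp add: mode_def)
qed

lemma fourier_null_polynomial:
  fixes u :: "real ^ 'd \<Rightarrow> complex" and P :: "complex ^ 'd \<Rightarrow> real"
  assumes "real_polynomial_function P" "fourier_null u"
  shows "fourier_null (\<lambda>\<psi>. u \<psi> * of_real (P (torus_point \<psi>)))"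
  using assms
proof (induction P arbitrary: u rule: real_polynomial_function.induct)
  case (linear L)
  interpret bounded_linear L by fact
  have w: "w = (\<Sum>i\<in>UNIV. Re (w $ i) *\<^sub>R axis i 1 + Im (w $ i) *\<^sub>R axis i \<i>)" for w :: "complex ^ 'd"
    by (simp add: vec_eq_iff axis_def if_distrib sum.distrib complex_eq_iff cong: if_cong)
  have "L (torus_point \<psi>) = (\<Sum>i\<in>UNIV. cos (\<psi> $ i) * L (axis i 1) + sin (\<psi> $ i) * L (axis i \<i>))" for \<psi>
    by (subst w) (simp add: sum add scaleR torus_point_def)
  moreover have "u \<psi> * of_real (cos (\<psi> $ i) * L (axis i 1) + sin (\<psi> $ i) * L (axis i \<i>)) =
      (of_real (L (axis i 1)) / 2) * (u \<psi> * mode (axis i 1) \<psi>)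
      + (of_real (L (axis i 1)) / 2) * (u \<psi> * mode (- axis i 1) \<psi>)
      + ((- (\<i> * of_real (L (axis i \<i>)) / 2)) * (u \<psi> * mode (axis i 1) \<psi>)
      + (\<i> * of_real (L (axis i \<i>)) / 2) * (u \<psi> * mode (- axis i 1) \<psi>))" for \<psi> i
  proof -
    have "of_real (cos (\<psi> $ i)) = (mode (axis i 1) \<psi> + mode (- axis i 1) \<psi>) / 2"
      "of_real (sin (\<psi> $ i)) = \<i> * (mode (- axis i 1) \<psi> - mode (axis i 1) \<psi>) / 2"
      by (simp_all add: mode_uminus mode_axis_index complex_eq_iff)
    then show ?thesis
      unfolding of_real_add of_real_mult by (simp only:) (simp add: field_simps)
  qed
  ultimately have "u \<psi> * of_real (L (torus_point \<psi>)) = (\<Sum>i\<in>UNIV.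
      (of_real (L (axis i 1)) / 2) * (u \<psi> * mode (axis i 1) \<psi>)
      + (of_real (L (axis i 1)) / 2) * (u \<psi> * mode (- axis i 1) \<psi>)
      + ((- (\<i> * of_real (L (axis i \<i>)) / 2)) * (u \<psi> * mode (axis i 1) \<psi>)
      + (\<i> * of_real (L (axis i \<i>)) / 2) * (u \<psi> * mode (- axis i 1) \<psi>)))" for \<psi>
    by (simp only: of_real_sum sum_distrib_left)
  then show ?case
    using linear.prems by (simp only:) (intro fourier_null_sum fourier_null_add fourier_null_cmult fourier_null_mode)
next
  case (const c)
  then show ?case using fourier_null_cmult[of u "of_real c"] by (simp add: mult.commute)
next
  case (add P Q)
  then show ?case using fourier_null_add[OF add.IH(1) add.IH(2)] by (simp add: distrib_left)
next
  case (mult P Q)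
  show ?case using mult.IH(2)[OF mult.IH(1)[OF mult.prems]] by (simp add: mult.assoc)
qed

lemma periodic_torus_box:
  fixes h :: "real ^ 'd \<Rightarrow> 'b"
  assumes "\<And>\<psi> i. h (\<psi> + axis i (2 * pi)) = h \<psi>"
  obtains \<phi> where "\<phi> \<in> torus_box" "h \<phi> = h \<psi>"
proof -
  define \<phi> where "\<phi> = \<psi> + (\<chi> i. 2 * pi * of_int (- \<lfloor>\<psi> $ i / (2 * pi)\<rfloor>))"
  have "\<phi> \<in> torus_box"
  proof -
    have "0 \<le> \<phi> $ i \<and> \<phi> $ i \<le> 2 * pi" for i
    proof -
      define t where "t = \<psi> $ i / (2 * pi)"
      have "\<phi> $ i = 2 * pi * frac t"
        by (simp add: \<phi>_def t_def frac_def right_diff_distrib)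
      moreover have "0 \<le> 2 * pi * frac t"
        by (intro mult_nonneg_nonneg frac_ge_0) (simp_all add: pi_ge_zero)
      moreover have "2 * pi * frac t \<le> 2 * pi * 1"
        by (intro mult_left_mono less_imp_le[OF frac_lt_1]) simp
      ultimately show ?thesis by simp
    qed
    then show ?thesis by (simp add: mem_box_cart)
  qed
  moreover have "h \<phi> = h \<psi>" unfolding \<phi>_def by (rule periodic_lattice[OF assms])
  ultimately show ?thesis by (rule that)
qed

lemma fourier_null_imp_zero_real:
  fixes h :: "real ^ 'd \<Rightarrow> real"
  assumes c: "continuous_on UNIV h" and p: "\<And>\<psi> i. h (\<psi> + axis i (2 * pi)) = h \<psi>"
    and orth: "\<And>P. real_polynomial_function P \<Longrightarrow> integral torus_box (\<lambda>\<psi>. h \<psi> * P (torus_point \<psi>)) = 0"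
  shows "h \<psi> = 0"
proof -
  obtain F where F: "continuous_on {w :: complex ^ 'd. \<forall>i. norm (w $ i) = 1} F" "\<And>\<psi>. F (torus_point \<psi>) = h \<psi>"
    using torus_factor[OF c p] by blast
  have bounded: "bounded (h ` torus_box)"
    by (intro compact_imp_bounded compact_continuous_image continuous_on_subset[OF c]) auto
  then obtain M where M: "\<And>x. x \<in> torus_box \<Longrightarrow> \<bar>h x\<bar> \<le> M" by (auto simp: bounded_iff)
  have "(0 :: real ^ 'd) \<in> torus_box" by (simp add: mem_box_cart pi_ge_zero)
  from M[OF this] have M0: "0 \<le> M" by linarith
  have cp: "continuous_on UNIV (\<lambda>\<psi>. P (torus_point \<psi>))" if "real_polynomial_function P" for P :: "complex ^ 'd \<Rightarrow> real"
  proof -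
    have "continuous_on UNIV (torus_point :: real ^ 'd \<Rightarrow> _)"
      unfolding torus_point_def cis_conv_exp by (intro continuous_intros)
    moreover have "continuous_on UNIV P"
      using that by (simp add: real_polynomial_function_eq continuous_on_polymonial_function)
    ultimately show ?thesis using continuous_on_compose2[of UNIV P UNIV torus_point] by simp
  qed
  have sq_int: "(\<lambda>\<psi>. h \<psi> * h \<psi>) integrable_on torus_box"
    by (intro integrable_continuous continuous_intros continuous_on_subset[OF c]) auto
  have le: "integral torus_box (\<lambda>\<psi>. h \<psi> * h \<psi>) \<le> M * e * (2 * pi) ^ CARD('d)" if e: "e > 0" for e
  proof -
    obtain P where P: "real_polynomial_function P" "\<And>w. w \<in> {w :: complex ^ 'd. \<forall>i. norm (w $ i) = 1} \<Longrightarrow> \<bar>F w - P w\<bar> < e"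
      using Stone_Weierstrass_real_polynomial_function[OF compact_torus F(1) e] by blast
    have hP: "\<bar>h \<psi> - P (torus_point \<psi>)\<bar> < e" for \<psi>
      using P(2)[of "torus_point \<psi>"] F(2) by (simp add: torus_point_def)
    have int: "(\<lambda>\<psi>. h \<psi> * P (torus_point \<psi>)) integrable_on torus_box"
      "(\<lambda>\<psi>. h \<psi> * (h \<psi> - P (torus_point \<psi>))) integrable_on torus_box"
      by (intro integrable_continuous continuous_intros continuous_on_subset[OF c] continuous_on_subset[OF cp[OF P(1)]]; simp)+
    have "integral torus_box (\<lambda>\<psi>. h \<psi> * h \<psi>) = integral torus_box (\<lambda>\<psi>. h \<psi> * (h \<psi> - P (torus_point \<psi>)))"
      using integral_diff[OF sq_int int(1)] orth[OF P(1)] by (simp add: right_diff_distrib)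
    also have "\<dots> \<le> norm \<dots>" by simp
    also have "\<dots> \<le> (M * e) * measure lborel (torus_box :: (real ^ 'd) set)"
    proof (rule has_integral_bound[OF _ integrable_integral[OF int(2)]])
      show "0 \<le> M * e" using M0 e by simp
      show "norm (h \<psi> * (h \<psi> - P (torus_point \<psi>))) \<le> M * e" if "\<psi> \<in> torus_box" for \<psi>
        using mult_mono[OF M[OF that] less_imp_le[OF hP[of \<psi>]]] M0 by (simp add: abs_mult)
    qed
    finally show ?thesis by (simp add: content_torus_box)
  qed
  have "integral torus_box (\<lambda>\<psi>. h \<psi> * h \<psi>) \<le> 0"
  proof (rule field_le_epsilon)
    fix e :: real assume "e > 0"
    define d where "d = e / ((M + 1) * (2 * pi) ^ CARD('d))"
    have d: "d > 0" using \<open>e > 0\<close> M0 by (simp add: d_def)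
    have "M * d * (2 * pi) ^ CARD('d) \<le> (M + 1) * d * (2 * pi) ^ CARD('d)"
      using d by (intro mult_right_mono) auto
    also have "\<dots> = e" using M0 by (simp add: d_def)
    finally show "integral torus_box (\<lambda>\<psi>. h \<psi> * h \<psi>) \<le> 0 + e" using le[OF d] by linarith
  qed
  moreover have "0 \<le> integral torus_box (\<lambda>\<psi>. h \<psi> * h \<psi>)"
    by (rule integral_nonneg[OF sq_int]) simp
  ultimately have 0: "((\<lambda>\<psi>. h \<psi> * h \<psi>) has_integral 0) torus_box"
    using integrable_integral[OF sq_int] by simp
  have zero: "h x = 0" if "x \<in> torus_box" for x
  proof -
    have "h x * h x = 0"
    proof (rule has_integral_0_cbox_imp_0[OF _ _ 0])
      show "continuous_on torus_box (\<lambda>\<psi>. h \<psi> * h \<psi>)"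
        by (intro continuous_intros continuous_on_subset[OF c]) auto
      show "box 0 (\<chi> i. 2 * pi) \<noteq> ({} :: (real ^ 'd) set)"
        by (simp add: box_ne_empty Basis_vec_def inner_axis)
    qed (use that in auto)
    then show ?thesis by simp
  qed
  obtain \<phi> where "\<phi> \<in> torus_box" "h \<phi> = h \<psi>" by (rule periodic_torus_box[OF p])
  with zero[of \<phi>] show ?thesis by simp
qed

lemma fourier_null_imp_zero:
  fixes u :: "real ^ 'd \<Rightarrow> complex"
  assumes u: "fourier_null u" and p: "\<And>\<psi> i. u (\<psi> + axis i (2 * pi)) = u \<psi>"
  shows "u \<psi> = 0"
proof -
  have c: "continuous_on UNIV u" using u by (simp add: fourier_null_def)
  have int: "((\<lambda>\<psi>. u \<psi> * of_real (P (torus_point \<psi>))) has_integral 0) torus_box"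
    if P: "real_polynomial_function P" for P
  proof -
    have n: "fourier_null (\<lambda>\<psi>. u \<psi> * of_real (P (torus_point \<psi>)))"
      by (rule fourier_null_polynomial[OF P u])
    show ?thesis
      using fourier_null_integrable[OF n, of 0 0 "\<chi> i. 2 * pi"] n
      by (auto simp: fourier_null_def has_integral_integral dest!: spec[of _ 0])
  qed
  have "Re (u \<psi>) = 0"
  proof (rule fourier_null_imp_zero_real[where h = "\<lambda>\<psi>. Re (u \<psi>)"])
    show "continuous_on UNIV (\<lambda>\<psi>. Re (u \<psi>))" by (intro continuous_intros c)
    show "integral torus_box (\<lambda>\<psi>. Re (u \<psi>) * P (torus_point \<psi>)) = 0" if "real_polynomial_function P" for P
      using has_integral_linear[OF int[OF that] bounded_linear_Re] by (simp add: o_def integral_unique)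
  qed (simp add: p)
  moreover have "Im (u \<psi>) = 0"
  proof (rule fourier_null_imp_zero_real[where h = "\<lambda>\<psi>. Im (u \<psi>)"])
    show "continuous_on UNIV (\<lambda>\<psi>. Im (u \<psi>))" by (intro continuous_intros c)
    show "integral torus_box (\<lambda>\<psi>. Im (u \<psi>) * P (torus_point \<psi>)) = 0" if "real_polynomial_function P" for P
      using has_integral_linear[OF int[OF that] bounded_linear_Im] by (simp add: o_def integral_unique)
  qed (simp add: p)
  ultimately show ?thesis by (simp add: complex_eq_iff)
qed

lemma fourier_series_integral:
  fixes c :: "int ^ 'd \<Rightarrow> complex"
  assumes c: "(\<lambda>\<nu>. norm (c \<nu>)) summable_on UNIV"
  shows "continuous_on UNIV (\<lambda>\<psi>. \<Sum>\<^sub>\<infinity>\<nu>. c \<nu> * mode \<nu> \<psi>)"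
    and "integral torus_box (\<lambda>\<psi>. (\<Sum>\<^sub>\<infinity>\<nu>. c \<nu> * mode \<nu> \<psi>) * mode (- \<mu>) \<psi>) = of_real ((2 * pi) ^ CARD('d)) * c \<mu>"
proof -
  have ul: "uniform_limit UNIV (\<lambda>X \<psi>. \<Sum>\<nu>\<in>X. c \<nu> * mode \<nu> \<psi>) (\<lambda>\<psi>. \<Sum>\<^sub>\<infinity>\<nu>. c \<nu> * mode \<nu> \<psi>) (finite_subsets_at_top UNIV)"
    by (rule Weierstrass_m_test_general[OF _ c]) (simp add: norm_mult)
  show cont: "continuous_on UNIV (\<lambda>\<psi>. \<Sum>\<^sub>\<infinity>\<nu>. c \<nu> * mode \<nu> \<psi>)"
    by (rule uniform_limit_theorem[OF _ ul]) (auto intro!: always_eventually continuous_intros)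
  have ul2: "uniform_limit torus_box (\<lambda>X \<psi>. \<Sum>\<nu>\<in>X. c \<nu> * mode (\<nu> - \<mu>) \<psi>) (\<lambda>\<psi>. (\<Sum>\<^sub>\<infinity>\<nu>. c \<nu> * mode (\<nu> - \<mu>) \<psi>)) (finite_subsets_at_top UNIV)"
    by (rule Weierstrass_m_test_general[OF _ c]) (simp add: norm_mult)
  obtain I J where I: "\<And>X. ((\<lambda>\<psi>. \<Sum>\<nu>\<in>X. c \<nu> * mode (\<nu> - \<mu>) \<psi>) has_integral I X) torus_box"
    and J: "((\<lambda>\<psi>. (\<Sum>\<^sub>\<infinity>\<nu>. c \<nu> * mode (\<nu> - \<mu>) \<psi>)) has_integral J) torus_box" "(I \<longlongrightarrow> J) (finite_subsets_at_top UNIV)"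
    by (rule uniform_limit_integral_cbox[OF ul2]) (auto intro!: continuous_intros)
  let ?V = "of_real ((2 * pi) ^ CARD('d)) :: complex"
  have IX: "I X = ?V * c \<mu>" if "finite X" "\<mu> \<in> X" for X
  proof -
    have int: "(\<lambda>\<psi>. mode \<nu> \<psi>) integrable_on torus_box" for \<nu> :: "int ^ 'd"
      by (intro integrable_continuous continuous_intros)
    have "I X = integral torus_box (\<lambda>\<psi>. \<Sum>\<nu>\<in>X. c \<nu> * mode (\<nu> - \<mu>) \<psi>)"
      using I by (rule integral_unique[symmetric])
    also have "\<dots> = (\<Sum>\<nu>\<in>X. c \<nu> * integral torus_box (mode (\<nu> - \<mu>)))"
      by (subst integral_sum) (auto intro!: that integrable_on_mult_right int)
    also have "\<dots> = (\<Sum>\<nu>\<in>X. if \<nu> = \<mu> then ?V * c \<mu> else 0)"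
      by (rule sum.cong) (auto simp: integral_mode)
    also have "\<dots> = ?V * c \<mu>" using that by (simp add: sum.delta')
    finally show ?thesis .
  qed
  have "\<forall>\<^sub>F X in finite_subsets_at_top UNIV. I X = ?V * c \<mu>"
    unfolding eventually_finite_subsets_at_top by (rule exI[of _ "{\<mu>}"]) (use IX in auto)
  then have "(I \<longlongrightarrow> ?V * c \<mu>) (finite_subsets_at_top UNIV)" by (rule tendsto_eventually)
  with J(2) have "J = ?V * c \<mu>" by (intro tendsto_unique[of "finite_subsets_at_top UNIV"]) auto
  moreover have "(\<Sum>\<^sub>\<infinity>\<nu>. c \<nu> * mode \<nu> \<psi>) * mode (- \<mu>) \<psi> = (\<Sum>\<^sub>\<infinity>\<nu>. c \<nu> * mode (\<nu> - \<mu>) \<psi>)" for \<psi>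
    unfolding infsum_cmult_left'[symmetric] by (simp add: mult.assoc mode_add[symmetric])
  ultimately show "integral torus_box (\<lambda>\<psi>. (\<Sum>\<^sub>\<infinity>\<nu>. c \<nu> * mode \<nu> \<psi>) * mode (- \<mu>) \<psi>) = ?V * c \<mu>"
    using J(1) by (simp add: integral_unique)
qed

lemma fourier_expansion:
  fixes f :: "real ^ 'd \<Rightarrow> real"
  assumes per: "torus_periodic f" and an: "real_analytic f"
  obtains \<rho> c where "1 < \<rho>"
    "(\<lambda>\<nu>. norm (c \<nu>) * \<rho> ^ (\<Sum>i\<in>UNIV. nat \<bar>\<nu> $ i\<bar>)) summable_on UNIV"
    "\<forall>\<psi>. of_real (f \<psi>) = (\<Sum>\<^sub>\<infinity>\<nu>. c \<nu> * mode \<nu> \<psi>)"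
    "\<forall>\<nu>. c (- \<nu>) = cnj (c \<nu>)" "c 0 = of_real (torus_average f)"
proof -
  let ?f = "\<lambda>\<psi>. complex_of_real (f \<psi>)"
  let ?c = "fourier_coeff ?f"
  let ?V = "of_real ((2 * pi) ^ CARD('d)) :: complex"
  obtain \<rho> where \<rho>: "1 < \<rho>" and s: "(\<lambda>\<nu>. norm (?c \<nu>) * \<rho> ^ (\<Sum>i\<in>UNIV. nat \<bar>\<nu> $ i\<bar>)) summable_on UNIV"
    by (rule fourier_coeff_summable[OF assms]) (rule that)
  have p: "f (\<psi> + axis i (2 * pi)) = f \<psi>" for \<psi> i
    using per unfolding torus_periodic_def by simp
  have c: "continuous_on UNIV f" by (rule real_analytic_continuous_on[OF an])
  have V: "?V \<noteq> 0" by simp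
  have s1: "(\<lambda>\<nu>. norm (?c \<nu>)) summable_on UNIV"
  proof (rule summable_on_comparison_test[OF s])
    show "norm (?c \<nu>) \<le> norm (?c \<nu>) * \<rho> ^ (\<Sum>i\<in>UNIV. nat \<bar>\<nu> $ i\<bar>)" for \<nu>
      using mult_left_mono[OF one_le_power[of \<rho> "\<Sum>i\<in>UNIV. nat \<bar>\<nu> $ i\<bar>"], of "norm (?c \<nu>)"] \<rho> by simp
  qed auto
  define S where "S \<psi> = (\<Sum>\<^sub>\<infinity>\<nu>. ?c \<nu> * mode \<nu> \<psi>)" for \<psi>
  note S = fourier_series_integral[OF s1, folded S_def]
  have fint: "integral torus_box (\<lambda>\<psi>. ?f \<psi> * mode (- \<mu>) \<psi>) = ?V * ?c \<mu>" for \<mu>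
    unfolding fourier_coeff_def times_divide_eq_right
    by (rule nonzero_mult_div_cancel_left[OF V, symmetric])
  have null: "fourier_null (\<lambda>\<psi>. ?f \<psi> - S \<psi>)"
    unfolding fourier_null_def
  proof (intro conjI allI)
    show "continuous_on UNIV (\<lambda>\<psi>. ?f \<psi> - S \<psi>)" by (intro continuous_intros c S(1))
    fix \<nu> :: "int ^ 'd"
    have "integral torus_box (\<lambda>\<psi>. ?f \<psi> * mode (- (- \<nu>)) \<psi> - S \<psi> * mode (- (- \<nu>)) \<psi>)
        = integral torus_box (\<lambda>\<psi>. ?f \<psi> * mode (- (- \<nu>)) \<psi>) - integral torus_box (\<lambda>\<psi>. S \<psi> * mode (- (- \<nu>)) \<psi>)"
    proof (rule integral_diff)
      show "(\<lambda>\<psi>. ?f \<psi> * mode (- (- \<nu>)) \<psi>) integrable_on torus_box"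
        by (intro integrable_continuous continuous_intros continuous_on_subset[OF c]) simp
      show "(\<lambda>\<psi>. S \<psi> * mode (- (- \<nu>)) \<psi>) integrable_on torus_box"
        by (intro integrable_continuous continuous_intros continuous_on_subset[OF S(1)]) simp
    qed
    also have "\<dots> = 0" unfolding fint S(2) by simp
    finally show "integral torus_box (\<lambda>\<psi>. (?f \<psi> - S \<psi>) * mode \<nu> \<psi>) = 0"
      by (simp add: left_diff_distrib)
  qed
  have zero: "?f \<psi> - S \<psi> = 0" for \<psi>
    by (rule fourier_null_imp_zero[OF null]) (simp add: p S_def mode_periodic)
  show ?thesis
  proof (rule that[OF \<rho> s])
    show "\<forall>\<psi>. ?f \<psi> = (\<Sum>\<^sub>\<infinity>\<nu>. ?c \<nu> * mode \<nu> \<psi>)"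
      using zero unfolding S_def right_minus_eq by blast
    show "\<forall>\<nu>. ?c (- \<nu>) = cnj (?c \<nu>)"
    proof
      fix \<nu>
      have int: "(\<lambda>\<psi>. ?f \<psi> * mode (- \<nu>) \<psi>) integrable_on torus_box"
        by (intro integrable_continuous continuous_intros continuous_on_subset[OF c]) auto
      have "integral torus_box (\<lambda>\<psi>. cnj (?f \<psi> * mode (- \<nu>) \<psi>)) = cnj (integral torus_box (\<lambda>\<psi>. ?f \<psi> * mode (- \<nu>) \<psi>))"
        using integral_linear[OF int bounded_linear_cnj] by (simp add: o_def)
      moreover have "(\<lambda>\<psi>. cnj (?f \<psi> * mode (- \<nu>) \<psi>)) = (\<lambda>\<psi>. ?f \<psi> * mode (- (- \<nu>)) \<psi>)"
        unfolding mode_uminus[of "- \<nu>"] by simp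
      ultimately show "?c (- \<nu>) = cnj (?c \<nu>)"
        unfolding fourier_coeff_def complex_cnj_divide complex_cnj_complex_of_real by (simp only:)
    qed
    have "f integrable_on torus_box"
      by (intro integrable_continuous continuous_on_subset[OF c]) auto
    from integral_linear[OF this bounded_linear_of_real]
    have "integral torus_box (\<lambda>\<psi>. ?f \<psi>) = of_real (integral torus_box f)" by (simp add: o_def)
    then show "?c 0 = of_real (torus_average f)"
      by (simp add: fourier_coeff_def torus_average_def)
  qed
qed

section \<open>Quasi-periodic functions as elements of the algebra\<close>

text \<open>
  A trigonometric series with exponentially decaying coefficients is written as a power series with
  summable coefficients in the \<open>2 d\<close> bounded quantities \<open>e\<^sup>\<plusminus>\<^sup>i\<^sup>\<psi>\<^sup>j / \<rho>\<close>; the multi-index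
  \<open>(m, n)\<close> stands for the frequency \<open>m - n\<close>. This turns the weighted norm into the plain norm
  of \<open>l1\<close>.
\<close>

type_synonym 'd index = "(nat ^ 'd) \<times> (nat ^ 'd)"

definition freq :: "'d::finite index \<Rightarrow> int ^ 'd" where
  "freq p = (\<chi> i. int (fst p $ i) - int (snd p $ i))"

definition deg :: "'d::finite index \<Rightarrow> nat" where
  "deg p = (\<Sum>i\<in>UNIV. fst p $ i + snd p $ i)"

lemma freq_simps [simp]: "freq 0 = 0" "freq (p + q) = freq p + freq q" "freq (prod.swap p) = - freq p"
  by (simp_all add: freq_def vec_eq_iff)

lemma deg_simps [simp]: "deg 0 = 0" "deg (p + q) = deg p + deg q" "deg (prod.swap p) = deg p"
  by (simp_all add: deg_def sum.distrib add_ac)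

lemma swap_add: "prod.swap (p + q) = prod.swap p + prod.swap (q :: 'd::finite index)"
  by (simp add: prod_eq_iff)

definition rotation :: "real ^ 'd \<Rightarrow> 'd::finite index \<Rightarrow> real" where
  "rotation \<omega> p = (\<Sum>i\<in>UNIV. of_int (freq p $ i) * \<omega> $ i)"

lemma rotation_swap: "rotation \<omega> (prod.swap p) = - rotation \<omega> p"
  by (simp add: rotation_def sum_negf)

lemma mode_rotation: "mode (freq p) (t *\<^sub>R \<omega>) = cis (t * rotation \<omega> p)"
  by (simp add: mode_def rotation_def sum_distrib_left mult_ac)

lemma abs_freq_le_deg: "(\<Sum>i\<in>UNIV. \<bar>of_int (freq p $ i) :: real\<bar>) \<le> real (deg p)"
  unfolding deg_def of_nat_sum by (rule sum_mono) (simp add: freq_def)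

lemma abs_rotation_le: "\<bar>rotation \<omega> p\<bar> \<le> norm \<omega> * real (deg p)"
proof -
  have "\<bar>rotation \<omega> p\<bar> \<le> (\<Sum>i\<in>UNIV. \<bar>of_int (freq p $ i)\<bar> * norm \<omega>)"
    unfolding rotation_def
    by (rule order.trans[OF sum_abs], rule sum_mono)
      (use component_le_norm_cart[of \<omega>] in \<open>auto simp: abs_mult intro!: mult_left_mono\<close>)
  also have "\<dots> = norm \<omega> * (\<Sum>i\<in>UNIV. \<bar>of_int (freq p $ i)\<bar>)" by (simp add: sum_distrib_left mult.commute)
  also have "\<dots> \<le> norm \<omega> * real (deg p)" by (intro mult_left_mono abs_freq_le_deg) simp
  finally show ?thesis .
qed

definition tchar :: "real \<Rightarrow> real ^ 'd \<Rightarrow> 'd::finite index \<Rightarrow> complex" where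
  "tchar \<rho> \<psi> p = of_real ((1 / \<rho>) ^ deg p) * mode (freq p) \<psi>"

lemma tchar_add: "tchar \<rho> \<psi> (p + q) = tchar \<rho> \<psi> p * tchar \<rho> \<psi> q"
  by (simp add: tchar_def power_add mode_add)

lemma tchar_zero: "tchar \<rho> \<psi> 0 = 1"
  by (simp add: tchar_def)

lemma tchar_swap: "tchar \<rho> \<psi> (prod.swap p) = cnj (tchar \<rho> \<psi> p)"
  by (simp add: tchar_def mode_uminus)

lemma norm_tchar: "1 < \<rho> \<Longrightarrow> norm (tchar \<rho> \<psi> p) = (1 / \<rho>) ^ deg p"
  by (simp add: tchar_def norm_mult norm_power norm_divide)

lemma norm_tchar_le: "1 < \<rho> \<Longrightarrow> norm (tchar \<rho> \<psi> p) \<le> 1"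
  by (simp add: norm_tchar power_le_one)

lemma bdd_fun_tchar: "1 < \<rho> \<Longrightarrow> bdd_fun (tchar \<rho> \<psi>)"
  unfolding bdd_fun_def using norm_tchar_le by blast

lemma bdd_fun_rotation_tchar:
  assumes \<rho>: "1 < \<rho>"
  shows "\<exists>C. \<forall>p. \<bar>rotation \<omega> p\<bar> ^ 3 * (1 / \<rho>) ^ deg p \<le> C"
proof -
  define r where "r = root 3 (1 / \<rho>)"
  have r: "0 < r" "r < 1" "r ^ 3 = 1 / \<rho>" using \<rho> by (simp_all add: r_def)
  have "(\<lambda>n. real n * r ^ n) \<longlonglongrightarrow> 0" using powser_times_n_limit_0[of r] r by simp
  then have "Bseq (\<lambda>n. real n * r ^ n)" by (intro convergent_imp_Bseq convergentI)
  then obtain K where K: "\<And>n. norm (real n * r ^ n) \<le> K" by (auto simp: Bseq_def)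
  have "\<bar>rotation \<omega> p\<bar> ^ 3 * (1 / \<rho>) ^ deg p \<le> (norm \<omega> * K) ^ 3" for p
  proof -
    have "(1 / \<rho>) ^ deg p = (r ^ deg p) ^ 3" unfolding r(3)[symmetric] by (simp add: power_mult[symmetric] mult.commute)
    then have "\<bar>rotation \<omega> p\<bar> ^ 3 * (1 / \<rho>) ^ deg p = (\<bar>rotation \<omega> p\<bar> * r ^ deg p) ^ 3"
      by (simp only: power_mult_distrib)
    also have "\<dots> \<le> (norm \<omega> * (real (deg p) * r ^ deg p)) ^ 3"
      using mult_right_mono[OF abs_rotation_le, of "r ^ deg p" \<omega> p] r
      by (intro power_mono) (auto simp: mult.assoc)
    also have "\<dots> \<le> (norm \<omega> * K) ^ 3"
      using K[of "deg p"] r by (intro power_mono mult_left_mono) auto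
    finally show ?thesis .
  qed
  then show ?thesis by blast
qed

lemma norm_cis_taylor: "norm (cis (a + b) - cis a - \<i> * of_real b * cis a) \<le> b\<^sup>2"
proof -
  have "norm (exp (\<i> * of_real b) - (\<Sum>k\<le>1. (\<i> * of_real b) ^ k / fact k)) \<le> exp \<bar>Re (\<i> * of_real b)\<bar> * (norm (\<i> * of_real b) ^ Suc 1) / fact 1"
    by (rule Taylor_exp)
  then have "norm (cis b - 1 - \<i> * of_real b) \<le> b\<^sup>2"
    by (simp add: cis_conv_exp norm_mult power2_eq_square diff_diff_eq)
  moreover have "cis (a + b) - cis a - \<i> * of_real b * cis a = cis a * (cis b - 1 - \<i> * of_real b)"
    by (simp add: cis_mult[symmetric] algebra_simps)
  ultimately show ?thesis by (simp add: norm_mult)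
qed

text \<open>The second order Taylor estimate of \<open>cis\<close> is uniform in the index, so no interchange of
  limits is needed.\<close>

lemma pairing_has_derivative:
  fixes s :: "'a \<Rightarrow> real" and x :: "'a l1"
  assumes w: "bdd_fun w" and w1: "bdd_fun (\<lambda>p. of_real (s p) * w p)"
    and C: "\<And>p. (s p)\<^sup>2 * norm (w p) \<le> C"
  shows "((\<lambda>t. pairing x (\<lambda>p. w p * cis (t * s p))) has_vector_derivative
      pairing x (\<lambda>p. \<i> * of_real (s p) * w p * cis (t * s p))) (at t)"
proof -
  have b: "bdd_fun (\<lambda>p. w p * cis (t * s p))" "bdd_fun (\<lambda>p. \<i> * of_real (s p) * w p * cis (t * s p))" for t
    using w w1 unfolding bdd_fun_def by (simp_all add: norm_mult)
  define D where "D = pairing x (\<lambda>p. \<i> * of_real (s p) * w p * cis (t * s p))"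
  have C0: "0 \<le> C" using order.trans[OF mult_nonneg_nonneg[OF zero_le_power2 norm_ge_zero] C] .
  have est: "norm (pairing x (\<lambda>p. w p * cis ((t + h) * s p)) - pairing x (\<lambda>p. w p * cis (t * s p)) - of_real h * D) \<le> C * norm x * h\<^sup>2" for h
  proof -
    have eq: "(\<lambda>p. w p * cis ((t + h) * s p)) = (\<lambda>p. (w p * cis (t * s p) + of_real h * (\<i> * of_real (s p) * w p * cis (t * s p)))
      + w p * (cis (t * s p + h * s p) - cis (t * s p) - \<i> * of_real (h * s p) * cis (t * s p)))"
      by (rule ext) (simp add: algebra_simps)
    have n: "norm (w p * (cis (t * s p + h * s p) - cis (t * s p) - \<i> * of_real (h * s p) * cis (t * s p))) \<le> C * h\<^sup>2" for p
    proof -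
      have "norm (w p * (cis (t * s p + h * s p) - cis (t * s p) - \<i> * of_real (h * s p) * cis (t * s p))) \<le> norm (w p) * (h * s p)\<^sup>2"
        unfolding norm_mult by (intro mult_left_mono) (use norm_cis_taylor[of "t * s p" "h * s p"] in auto)
      also have "\<dots> = ((s p)\<^sup>2 * norm (w p)) * h\<^sup>2" by (simp add: power_mult_distrib)
      also have "\<dots> \<le> C * h\<^sup>2" by (intro mult_right_mono C) simp
      finally show ?thesis .
    qed
    have b3: "bdd_fun (\<lambda>p. w p * (cis (t * s p + h * s p) - cis (t * s p) - \<i> * of_real (h * s p) * cis (t * s p)))"
      unfolding bdd_fun_def using n by blast
    have b2: "bdd_fun (\<lambda>p. of_real h * (\<i> * of_real (s p) * w p * cis (t * s p)))"
      using b(2)[of t] unfolding bdd_fun_def norm_mult[of "of_real h"] by (meson abs_ge_zero mult_left_mono norm_ge_zero)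
    have b4: "bdd_fun (\<lambda>p. w p * cis (t * s p) + of_real h * (\<i> * of_real (s p) * w p * cis (t * s p)))"
      using b(1)[of t] b2 unfolding bdd_fun_def by (meson add_mono norm_triangle_le)
    have "pairing x (\<lambda>p. w p * cis ((t + h) * s p)) = pairing x (\<lambda>p. w p * cis (t * s p)) + of_real h * D
      + pairing x (\<lambda>p. w p * (cis (t * s p + h * s p) - cis (t * s p) - \<i> * of_real (h * s p) * cis (t * s p)))"
      unfolding eq pairing_add_fun[OF b4 b3] pairing_add_fun[OF b(1) b2] pairing_cmult_fun D_def ..
    then show ?thesis using norm_pairing_le[OF n, of x] by (simp add: mult_ac)
  qed
  have "((\<lambda>t. pairing x (\<lambda>p. w p * cis (t * s p))) has_derivative (\<lambda>h. h *\<^sub>R D)) (at t)"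
    unfolding has_derivative_at
  proof (intro conjI bounded_linear_scaleR_left)
    show "(\<lambda>h. norm (pairing x (\<lambda>p. w p * cis ((t + h) * s p)) - pairing x (\<lambda>p. w p * cis (t * s p)) - h *\<^sub>R D) / norm h) \<midarrow>0\<rightarrow> 0"
    proof (rule Lim_null_comparison)
      show "\<forall>\<^sub>F h in at 0. norm (norm (pairing x (\<lambda>p. w p * cis ((t + h) * s p)) - pairing x (\<lambda>p. w p * cis (t * s p)) - h *\<^sub>R D) / norm h)
          \<le> C * norm x * \<bar>h\<bar>"
      proof (rule always_eventually, rule allI)
        fix h :: real
        show "norm (norm (pairing x (\<lambda>p. w p * cis ((t + h) * s p)) - pairing x (\<lambda>p. w p * cis (t * s p)) - h *\<^sub>R D) / norm h) \<le> C * norm x * \<bar>h\<bar>"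
        proof (cases "h = 0")
          case False
          then show ?thesis
            using est[of h] by (simp add: scaleR_conv_of_real pos_divide_le_eq power2_eq_square)
        qed (use C0 in simp)
      qed
      have "(\<lambda>h. C * norm x * \<bar>h\<bar>) \<midarrow>0\<rightarrow> C * norm x * \<bar>0\<bar>" by (intro tendsto_intros)
      then show "(\<lambda>h. C * norm x * \<bar>h\<bar>) \<midarrow>0\<rightarrow> 0" by simp
    qed
  qed
  then show ?thesis unfolding has_vector_derivative_def D_def .
qed

lemma pairing_tchar_real_analytic:
  fixes x :: "'d::finite index l1"
  assumes \<rho>: "1 < \<rho>"
  shows "real_analytic (\<lambda>\<psi>. Re (pairing x (tchar \<rho> \<psi>)))"
proof -
  define c where "c p = coef x p * of_real ((1 / \<rho>) ^ deg p)" for p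
  define k :: "'d index \<Rightarrow> real ^ 'd" where "k p = (\<chi> i. of_int (freq p $ i))" for p
  have k: "(\<Sum>b\<in>Basis. \<bar>k p \<bullet> b\<bar>) = (\<Sum>i\<in>UNIV. \<bar>of_int (freq p $ i)\<bar>)" for p
  proof -
    have "(\<Sum>b\<in>Basis. \<bar>k p \<bullet> b\<bar>) = (\<Sum>b\<in>range (\<lambda>i. axis i (1::real)). \<bar>k p \<bullet> b\<bar>)"
      by (rule sum.cong) (auto simp: Basis_vec_def)
    also have "\<dots> = (\<Sum>i\<in>UNIV. \<bar>k p \<bullet> axis i 1\<bar>)"
      by (subst sum.reindex) (auto simp: inj_on_def axis_eq_axis)
    finally show ?thesis by (simp add: inner_axis k_def)
  qed
  have "real_analytic (\<lambda>\<psi>. Re (\<Sum>\<^sub>\<infinity>p. c p * cis (k p \<bullet> \<psi>)))"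
  proof (rule real_analytic_fourier)
    show "0 < ln \<rho>" using \<rho> by simp
    show "(\<lambda>p. norm (c p) * exp (ln \<rho> * (\<Sum>b\<in>Basis. \<bar>k p \<bullet> b\<bar>))) summable_on UNIV"
    proof (rule summable_on_comparison_test[OF abs_summable_coef[of x]])
      fix p
      have "exp (ln \<rho> * (\<Sum>b\<in>Basis. \<bar>k p \<bullet> b\<bar>)) \<le> exp (ln \<rho> * real (deg p))"
        unfolding k using abs_freq_le_deg[of p] \<rho> by simp
      also have "\<dots> = \<rho> ^ deg p" using \<rho> by (simp add: exp_of_nat2_mult)
      finally have "norm (c p) * exp (ln \<rho> * (\<Sum>b\<in>Basis. \<bar>k p \<bullet> b\<bar>)) \<le> norm (c p) * \<rho> ^ deg p"
        by (rule mult_left_mono) simp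
      also have "\<dots> = norm (coef x p)"
        using \<rho> by (simp add: c_def norm_mult norm_power norm_divide power_one_over)
      finally show "norm (c p) * exp (ln \<rho> * (\<Sum>b\<in>Basis. \<bar>k p \<bullet> b\<bar>)) \<le> norm (coef x p)" .
    qed simp
  qed
  moreover have "mode (freq p) \<psi> = cis (k p \<bullet> \<psi>)" for p \<psi>
    by (simp add: mode_def k_def inner_vec_def)
  ultimately show ?thesis by (simp add: pairing_def tchar_def c_def mult.assoc)
qed

definition split_freq :: "int ^ 'd \<Rightarrow> 'd::finite index" where
  "split_freq \<nu> = ((\<chi> i. nat (\<nu> $ i)), (\<chi> i. nat (- \<nu> $ i)))"

lemma freq_split [simp]: "freq (split_freq \<nu>) = \<nu>"
  by (simp add: freq_def split_freq_def vec_eq_iff)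

lemma deg_split: "deg (split_freq \<nu>) = (\<Sum>i\<in>UNIV. nat \<bar>\<nu> $ i\<bar>)"
  unfolding deg_def split_freq_def by (rule sum.cong) auto

lemma split_uminus: "split_freq (- \<nu>) = prod.swap (split_freq \<nu>)"
  by (simp add: split_freq_def)

lemma fourier_element:
  fixes c :: "int ^ 'd \<Rightarrow> complex"
  assumes \<rho>: "1 < \<rho>" and c: "(\<lambda>\<nu>. norm (c \<nu>) * \<rho> ^ (\<Sum>i\<in>UNIV. nat \<bar>\<nu> $ i\<bar>)) summable_on UNIV"
    and cnj: "\<And>\<nu>. c (- \<nu>) = cnj (c \<nu>)"
  obtains q :: "'d::finite index l1" where
    "\<forall>\<psi>. pairing q (tchar \<rho> \<psi>) = (\<Sum>\<^sub>\<infinity>\<nu>. c \<nu> * mode \<nu> \<psi>)"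
    "\<forall>p. coef q p \<noteq> 0 \<longrightarrow> c (freq p) \<noteq> 0" "star prod.swap q = q"
proof -
  define d where "d p = (if p \<in> range split_freq then c (freq p) * of_real (\<rho> ^ deg p) else 0)" for p
  have inj: "inj split_freq" by (metis freq_split injI)
  have d_split: "d (split_freq \<nu>) = c \<nu> * of_real (\<rho> ^ (\<Sum>i\<in>UNIV. nat \<bar>\<nu> $ i\<bar>))" for \<nu>
    by (simp add: d_def deg_split)
  have "(\<lambda>p. norm (d p)) summable_on range split_freq"
    unfolding summable_on_reindex[OF inj]
    using c \<rho> by (simp add: o_def d_split norm_mult norm_power)
  moreover have "(\<lambda>p. norm (d p)) summable_on UNIV \<longleftrightarrow> (\<lambda>p. norm (d p)) summable_on range split_freq"
    by (rule summable_on_cong_neutral) (auto simp: d_def)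
  ultimately have "(\<lambda>p. norm (d p)) summable_on UNIV" by simp
  then have coef: "coef (Abs_l1 d) = d" by (simp add: Abs_l1_inverse)
  show ?thesis
  proof (rule that[of "Abs_l1 d"])
    show "\<forall>\<psi>. pairing (Abs_l1 d) (tchar \<rho> \<psi>) = (\<Sum>\<^sub>\<infinity>\<nu>. c \<nu> * mode \<nu> \<psi>)"
    proof
      fix \<psi>
      have "pairing (Abs_l1 d) (tchar \<rho> \<psi>) = (\<Sum>\<^sub>\<infinity>p\<in>range split_freq. d p * tchar \<rho> \<psi> p)"
        unfolding pairing_def coef by (rule infsum_cong_neutral) (auto simp: d_def)
      also have "\<dots> = (\<Sum>\<^sub>\<infinity>\<nu>. d (split_freq \<nu>) * tchar \<rho> \<psi> (split_freq \<nu>))"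
        by (simp add: infsum_reindex[OF inj] o_def)
      also have "\<dots> = (\<Sum>\<^sub>\<infinity>\<nu>. c \<nu> * mode \<nu> \<psi>)"
        using \<rho> by (intro infsum_cong) (simp add: d_split tchar_def deg_split power_one_over)
      finally show "pairing (Abs_l1 d) (tchar \<rho> \<psi>) = (\<Sum>\<^sub>\<infinity>\<nu>. c \<nu> * mode \<nu> \<psi>)" .
    qed
    show "\<forall>p. coef (Abs_l1 d) p \<noteq> 0 \<longrightarrow> c (freq p) \<noteq> 0"
      unfolding coef by (auto simp: d_def split: if_splits)
    have imp: "prod.swap p \<in> range split_freq" if p: "p \<in> range split_freq" for p :: "'d index"
      using p by (rule imageE) (simp add: split_uminus[symmetric])
    have swap_range: "prod.swap p \<in> range split_freq \<longleftrightarrow> p \<in> range split_freq" for p :: "'d index"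
      using imp[of p] imp[of "prod.swap p"] unfolding swap_swap by (rule iffI[rotated])
    have "cnj (d (prod.swap p)) = d p" for p
      by (simp add: d_def swap_range cnj)
    then show "star prod.swap (Abs_l1 d) = Abs_l1 d"
      unfolding coef_inject_iff coef_star[of prod.swap, OF swap_swap] coef by blast
  qed
qed

section \<open>Trajectories and the Lyapunov function\<close>

lemma integral_exp_le:
  fixes L :: real
  assumes "L > 0" "\<tau> \<le> t"
  shows "integral {\<tau>..t} (\<lambda>s. exp (L * (s - \<tau>))) \<le> exp (L * (t - \<tau>)) / L"
proof -
  have "((\<lambda>s. exp (L * (s - \<tau>))) has_integral (exp (L * (t - \<tau>)) / L - exp (L * (\<tau> - \<tau>)) / L)) {\<tau>..t}"
    using assms
    by (intro fundamental_theorem_of_calculus)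
      (auto intro!: derivative_eq_intros simp: has_real_derivative_iff_has_vector_derivative[symmetric])
  then show ?thesis using assms by (simp add: integral_unique)
qed

text \<open>Weighting with \<open>exp (- L (t - \<tau>))\<close> for a large \<open>L\<close> makes the Picard operator a contraction on
  the whole half-line.\<close>

lemma global_lipschitz_ode_exists:
  fixes F :: "real \<Rightarrow> 'a::euclidean_space \<Rightarrow> 'a"
  assumes cont: "continuous_on UNIV (\<lambda>(s, u). F s u)"
    and lip: "\<And>s u u'. norm (F s u - F s u') \<le> K * norm (u - u')"
    and bound: "\<And>s. norm (F s 0) \<le> B"
  shows "\<exists>u. u \<tau> = u0 \<and> (\<forall>t\<ge>\<tau>. (u has_vector_derivative F t (u t)) (at t within {\<tau>..}))"
proof -
  have B: "0 \<le> B" using order.trans[OF norm_ge_zero bound] .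
  obtain w :: 'a where w: "norm w = 1" using vector_choose_size[of 1] by auto
  have K: "0 \<le> K" using order.trans[OF norm_ge_zero lip[of 0 w 0]] w by simp
  define L where "L = 2 * K + 1"
  have L: "L > 0" using K by (simp add: L_def)
  define G where "G z s = F s (exp (L * (s - \<tau>)) *\<^sub>R z s)" for z s
  define \<Phi> where "\<Phi> z t = exp (- (L * (max \<tau> t - \<tau>))) *\<^sub>R (u0 + integral {\<tau>..max \<tau> t} (G z))" for z t
  have G_cont: "continuous_on S (G z)" if "continuous_on UNIV z" for z S
  proof -
    have "continuous_on UNIV (\<lambda>s. (s, exp (L * (s - \<tau>)) *\<^sub>R z s))"
      by (intro continuous_intros that)
    from continuous_on_compose2[OF cont this] have "continuous_on UNIV (G z)"
      unfolding G_def by simp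
    then show ?thesis by (rule continuous_on_subset) simp
  qed
  have int_cont: "continuous_on {\<tau>..} (\<lambda>t. integral {\<tau>..t} (G z))" if z: "continuous_on UNIV z" for z
    unfolding continuous_on_eq_continuous_within
  proof
    fix t assume t: "t \<in> {\<tau>..}"
    have "continuous_on {\<tau>..t + 1} (\<lambda>t. integral {\<tau>..t} (G z))"
      by (intro indefinite_integral_continuous_1 integrable_continuous_interval G_cont z)
    then have "continuous (at t within {\<tau>..t + 1}) (\<lambda>t. integral {\<tau>..t} (G z))"
      using t by (simp add: continuous_on_eq_continuous_within)
    moreover have "at t within {\<tau>..t + 1} = at t within {\<tau>..}"
      by (rule at_within_nhd[of _ "{..<t + 1}"]) auto
    ultimately show "continuous (at t within {\<tau>..}) (\<lambda>t. integral {\<tau>..t} (G z))" by simp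
  qed
  have \<Phi>_cont: "continuous_on UNIV (\<Phi> z)" if z: "continuous_on UNIV z" for z
  proof -
    have "continuous_on UNIV (\<lambda>t. integral {\<tau>..max \<tau> t} (G z))"
      by (rule continuous_on_compose2[OF int_cont[OF z]]) (auto intro!: continuous_intros)
    then show ?thesis unfolding \<Phi>_def by (intro continuous_intros)
  qed
  have weighted: "exp (- (L * (t - \<tau>))) * norm (integral {\<tau>..t} h) \<le> C / L"
    if t: "\<tau> \<le> t" and h: "continuous_on {\<tau>..t} h" "\<And>s. s \<in> {\<tau>..t} \<Longrightarrow> norm (h s) \<le> C * exp (L * (s - \<tau>))"
    for t C and h :: "real \<Rightarrow> 'a"
  proof -
    have C: "0 \<le> C" using order.trans[OF norm_ge_zero h(2)[of \<tau>]] t by simp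
    have "norm (integral {\<tau>..t} h) \<le> integral {\<tau>..t} (\<lambda>s. C * exp (L * (s - \<tau>)))"
      by (rule integral_norm_bound_integral) (auto intro!: integrable_continuous_interval h continuous_intros)
    also have "\<dots> = C * integral {\<tau>..t} (\<lambda>s. exp (L * (s - \<tau>)))" by simp
    also have "\<dots> \<le> C * (exp (L * (t - \<tau>)) / L)"
      by (intro mult_left_mono integral_exp_le L t C)
    finally have "exp (- (L * (t - \<tau>))) * norm (integral {\<tau>..t} h)
        \<le> exp (- (L * (t - \<tau>))) * (C * (exp (L * (t - \<tau>)) / L))"
      by (rule mult_left_mono) simp
    also have "\<dots> = C / L" by (simp add: exp_minus)
    finally show ?thesis .
  qed
  have G_diff: "norm (G z s - G z' s) \<le> K * C * exp (L * (s - \<tau>))" if "norm (z s - z' s) \<le> C" for z z' s C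
  proof -
    have "norm (G z s - G z' s) \<le> K * norm (exp (L * (s - \<tau>)) *\<^sub>R z s - exp (L * (s - \<tau>)) *\<^sub>R z' s)"
      unfolding G_def by (rule lip)
    also have "\<dots> = K * (exp (L * (s - \<tau>)) * norm (z s - z' s))"
      by (simp add: scaleR_diff_right[symmetric])
    also have "\<dots> \<le> K * (exp (L * (s - \<tau>)) * C)"
      by (intro mult_left_mono that K) simp
    finally show ?thesis by (simp add: mult_ac)
  qed
  have G_norm: "norm (G z s) \<le> (B + K * C) * exp (L * (s - \<tau>))" if "norm (z s) \<le> C" "\<tau> \<le> s" for z s C
  proof -
    have "norm (G z s) \<le> norm (F s 0) + norm (G z s - G (\<lambda>_. 0) s)"
      using norm_triangle_sub[of "G z s" "F s 0"] by (simp add: G_def)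
    also have "\<dots> \<le> B * 1 + K * C * exp (L * (s - \<tau>))"
      using bound[of s] G_diff[of z s "\<lambda>_. 0" C] that by simp
    also have "\<dots> \<le> B * exp (L * (s - \<tau>)) + K * C * exp (L * (s - \<tau>))"
      using that L B by (intro add_right_mono mult_left_mono) auto
    finally show ?thesis by (simp add: distrib_right)
  qed
  have \<Phi>_bounded: "bounded (range (\<Phi> z))" if z: "continuous_on UNIV z" "\<And>s. norm (z s) \<le> C" for z C
  proof -
    have "norm (\<Phi> z t) \<le> norm u0 + (B + K * C) / L" for t
    proof -
      let ?t = "max \<tau> t" and ?e = "exp (- (L * (max \<tau> t - \<tau>)))"
      have "norm (\<Phi> z t) \<le> ?e * norm u0 + ?e * norm (integral {\<tau>..?t} (G z))"
        unfolding \<Phi>_def norm_scaleR by (simp add: distrib_left[symmetric] norm_triangle_ineq)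
      also have "?e * norm u0 \<le> 1 * norm u0"
        using L by (intro mult_right_mono) auto
      also have "?e * norm (integral {\<tau>..?t} (G z)) \<le> (B + K * C) / L"
        by (intro weighted G_cont z G_norm) auto
      finally show ?thesis by simp
    qed
    then show ?thesis by (auto simp: bounded_iff)
  qed
  have in_bcontfun: "\<Phi> (apply_bcontfun z) \<in> bcontfun" for z :: "real \<Rightarrow>\<^sub>C 'a"
    using \<Phi>_cont[of "apply_bcontfun z"] \<Phi>_bounded[of "apply_bcontfun z" "norm z"]
    by (auto simp: bcontfun_def norm_bounded continuous_on_apply_bcontfun)
  have "\<exists>!z. Bcontfun (\<Phi> (apply_bcontfun z)) = z"
  proof (rule banach_fix_type)
    show "0 \<le> K / L" "K / L < 1" using K by (simp_all add: L_def)
    show "\<forall>z z'. dist (Bcontfun (\<Phi> (apply_bcontfun z))) (Bcontfun (\<Phi> (apply_bcontfun z'))) \<le> K / L * dist z z'"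
    proof (intro allI dist_bound)
      fix z z' :: "real \<Rightarrow>\<^sub>C 'a" and t
      let ?t = "max \<tau> t" and ?e = "exp (- (L * (max \<tau> t - \<tau>)))"
      have c: "continuous_on UNIV (apply_bcontfun z)" "continuous_on UNIV (apply_bcontfun z')"
        by (simp_all add: continuous_on_apply_bcontfun)
      have "integral {\<tau>..?t} (G z) - integral {\<tau>..?t} (G z') = integral {\<tau>..?t} (\<lambda>s. G z s - G z' s)"
        by (intro integral_diff[symmetric] integrable_continuous_interval G_cont c)
      then have "\<Phi> z t - \<Phi> z' t = ?e *\<^sub>R integral {\<tau>..?t} (\<lambda>s. G z s - G z' s)"
        unfolding \<Phi>_def by (simp add: scaleR_diff_right[symmetric])
      then have "dist (\<Phi> z t) (\<Phi> z' t) = ?e * norm (integral {\<tau>..?t} (\<lambda>s. G z s - G z' s))"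
        by (simp add: dist_norm)
      also have "\<dots> \<le> (K * dist z z') / L"
      proof (intro weighted continuous_intros G_cont c G_diff)
        show "norm (apply_bcontfun z s - apply_bcontfun z' s) \<le> dist z z'" for s
          using dist_bounded[of z s z'] by (simp add: dist_norm)
      qed simp
      finally show "dist (Bcontfun (\<Phi> (apply_bcontfun z)) t) (Bcontfun (\<Phi> (apply_bcontfun z')) t) \<le> K / L * dist z z'"
        by (simp add: Bcontfun_inverse[OF in_bcontfun])
    qed
  qed
  then obtain z where "Bcontfun (\<Phi> (apply_bcontfun z)) = z" by blast
  then have z: "apply_bcontfun z t = \<Phi> (apply_bcontfun z) t" for t
    by (metis Bcontfun_inverse in_bcontfun)
  have zc: "continuous_on UNIV (apply_bcontfun z)" by (simp add: continuous_on_apply_bcontfun)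
  define u where "u t = exp (L * (t - \<tau>)) *\<^sub>R apply_bcontfun z t" for t
  have u: "u t = u0 + integral {\<tau>..t} (G z)" if "\<tau> \<le> t" for t
    unfolding u_def z[of t] \<Phi>_def using that by (simp add: exp_minus max_def)
  have Gu: "G z s = F s (u s)" for s by (simp add: G_def u_def)
  have "(u has_vector_derivative F t (u t)) (at t within {\<tau>..})" if t: "\<tau> \<le> t" for t
  proof -
    have "((\<lambda>t. integral {\<tau>..t} (G z)) has_vector_derivative G z t) (at t within {\<tau>..t + 1})"
      using t by (intro integral_has_vector_derivative G_cont zc) auto
    then have "((\<lambda>t. u0 + integral {\<tau>..t} (G z)) has_vector_derivative F t (u t)) (at t within {\<tau>..t + 1})"
      unfolding Gu[symmetric] by (auto intro!: derivative_eq_intros)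
    moreover have "at t within {\<tau>..t + 1} = at t within {\<tau>..}"
      by (rule at_within_nhd[of _ "{..<t + 1}"]) auto
    ultimately have "((\<lambda>t. u0 + integral {\<tau>..t} (G z)) has_vector_derivative F t (u t)) (at t within {\<tau>..})"
      by simp
    then show ?thesis
      by (rule has_vector_derivative_transform[rotated 2]) (use t u in auto)
  qed
  moreover have "u \<tau> = u0" by (simp add: u)
  ultimately show ?thesis by blast
qed

text \<open>
  The coefficients are chosen such that along the difference \<open>(y, w)\<close> of two trajectories the
  friction term contributes \<open>- 2 w\<^sup>2\<close> and no cross term \<open>y w\<close>; all other terms contain the difference of the
  values of \<open>g\<close>.
\<close>

definition lyapunov :: "real \<Rightarrow> real \<Rightarrow> real \<Rightarrow> real" where
  "lyapunov \<epsilon> y w = y\<^sup>2 / \<epsilon> + 2 * y * w + 2 * \<epsilon> * w\<^sup>2"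

lemma lyapunov_bounds:
  assumes "0 < \<epsilon>"
  shows "y\<^sup>2 \<le> 2 * \<epsilon> * lyapunov \<epsilon> y w" "\<epsilon> * w\<^sup>2 \<le> lyapunov \<epsilon> y w"
    "lyapunov \<epsilon> y w \<le> 2 * y\<^sup>2 / \<epsilon> + 3 * \<epsilon> * w\<^sup>2"
proof -
  have "2 * \<epsilon> * lyapunov \<epsilon> y w = y\<^sup>2 + (y + 2 * \<epsilon> * w)\<^sup>2"
    using assms by (simp add: lyapunov_def field_simps power2_eq_square)
  then show "y\<^sup>2 \<le> 2 * \<epsilon> * lyapunov \<epsilon> y w" by simp
  have "lyapunov \<epsilon> y w = \<epsilon> * w\<^sup>2 + (y + \<epsilon> * w)\<^sup>2 / \<epsilon>"
    using assms by (simp add: lyapunov_def field_simps power2_eq_square)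
  then show "\<epsilon> * w\<^sup>2 \<le> lyapunov \<epsilon> y w" using assms by simp
  have "2 * y\<^sup>2 / \<epsilon> + 3 * \<epsilon> * w\<^sup>2 = lyapunov \<epsilon> y w + (y - \<epsilon> * w)\<^sup>2 / \<epsilon>"
    using assms by (simp add: lyapunov_def field_simps power2_eq_square)
  then show "lyapunov \<epsilon> y w \<le> 2 * y\<^sup>2 / \<epsilon> + 3 * \<epsilon> * w\<^sup>2" using assms by simp
qed

lemma lyapunov_has_derivative:
  assumes y: "(y has_real_derivative y') (at t within I)" and w: "(w has_real_derivative w') (at t within I)"
  shows "((\<lambda>t. lyapunov \<epsilon> (y t) (w t)) has_real_derivative
    2 * y t * y' / \<epsilon> + (2 * y' * w t + 2 * y t * w') + 2 * \<epsilon> * (2 * w t * w')) (at t within I)"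
proof -
  have "((\<lambda>t. y t * y t / \<epsilon> + 2 * y t * w t + 2 * \<epsilon> * (w t * w t)) has_real_derivative
    ((y' * y t + y' * y t) / \<epsilon> + ((0 * y t + y' * 2) * w t + w' * (2 * y t)) + (0 * (w t * w t) + (w' * w t + w' * w t) * (2 * \<epsilon>)))) (at t within I)"
    by (intro DERIV_add DERIV_mult DERIV_cdivide DERIV_const y w)
  then show ?thesis
    unfolding lyapunov_def power2_eq_square by (simp add: algebra_simps)
qed

definition slopes_between :: "real \<Rightarrow> real \<Rightarrow> (real \<Rightarrow> real) \<Rightarrow> real set \<Rightarrow> bool" where
  "slopes_between m L g S \<longleftrightarrow> (\<forall>x\<in>S. \<forall>y\<in>S. m * (x - y)\<^sup>2 \<le> (x - y) * (g x - g y) \<and> \<bar>g x - g y\<bar> \<le> L * \<bar>x - y\<bar>)"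

lemma lyapunov_derivative_le:
  fixes y w G :: real
  assumes \<epsilon>: "0 < \<epsilon>" and L: "4 * \<epsilon>\<^sup>2 * L \<le> 1" and m: "0 < m"
    and G1: "m * y\<^sup>2 \<le> y * G" and G2: "\<bar>G\<bar> \<le> L * \<bar>y\<bar>"
  shows "- 2 * w\<^sup>2 - 2 * y * G - 4 * \<epsilon> * w * G \<le> - min (m * \<epsilon> / 2) (1 / (3 * \<epsilon>)) * lyapunov \<epsilon> y w"
proof -
  have yG: "0 \<le> y * G" using G1 m by (meson order.trans mult_nonneg_nonneg zero_le_power2 less_imp_le)
  have "G\<^sup>2 = \<bar>G\<bar> * \<bar>G\<bar>" by (simp add: power2_eq_square)
  also have "\<dots> \<le> (L * \<bar>y\<bar>) * \<bar>G\<bar>" by (intro mult_right_mono G2) simp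
  also have "\<dots> = L * (y * G)" using yG by (simp add: abs_mult[symmetric])
  finally have "4 * \<epsilon>\<^sup>2 * G\<^sup>2 \<le> 4 * \<epsilon>\<^sup>2 * (L * (y * G))" by (intro mult_left_mono) auto
  also have "\<dots> = (4 * \<epsilon>\<^sup>2 * L) * (y * G)" by simp
  also have "\<dots> \<le> 1 * (y * G)" by (intro mult_right_mono L yG)
  finally have "4 * \<epsilon>\<^sup>2 * G\<^sup>2 \<le> y * G" by simp
  moreover have "0 \<le> (w + 2 * \<epsilon> * G)\<^sup>2" by simp
  then have "- 4 * \<epsilon> * w * G \<le> w\<^sup>2 + 4 * \<epsilon>\<^sup>2 * G\<^sup>2" by (simp add: power2_eq_square algebra_simps)
  ultimately have 1: "- 2 * w\<^sup>2 - 2 * y * G - 4 * \<epsilon> * w * G \<le> - (w\<^sup>2 + m * y\<^sup>2)" using G1 by linarith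
  let ?\<kappa> = "min (m * \<epsilon> / 2) (1 / (3 * \<epsilon>))"
  have k: "0 \<le> ?\<kappa>" using m \<epsilon> by simp
  have "?\<kappa> * lyapunov \<epsilon> y w \<le> ?\<kappa> * (2 * y\<^sup>2 / \<epsilon> + 3 * \<epsilon> * w\<^sup>2)"
    by (intro mult_left_mono lyapunov_bounds \<epsilon> k)
  also have "\<dots> = ?\<kappa> * (2 * y\<^sup>2 / \<epsilon>) + ?\<kappa> * (3 * \<epsilon> * w\<^sup>2)" by (simp add: distrib_left)
  also have "\<dots> \<le> (m * \<epsilon> / 2) * (2 * y\<^sup>2 / \<epsilon>) + (1 / (3 * \<epsilon>)) * (3 * \<epsilon> * w\<^sup>2)"
    using \<epsilon> by (intro add_mono mult_right_mono) auto
  also have "\<dots> = w\<^sup>2 + m * y\<^sup>2" using \<epsilon> by simp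
  finally show ?thesis using 1 by simp
qed

lemma trajectory_onD:
  assumes "trajectory_on \<epsilon> g f \<omega> I x v" "t \<in> I" "\<epsilon> \<noteq> 0"
  shows "(x has_real_derivative v t) (at t within I)"
    "(v has_real_derivative - v t / \<epsilon> - g (x t) + f (t *\<^sub>R \<omega>)) (at t within I)"
proof -
  from assms obtain a where a: "(x has_real_derivative v t) (at t within I)"
    "(v has_real_derivative a) (at t within I)" "\<epsilon> * a + v t + \<epsilon> * g (x t) = \<epsilon> * f (t *\<^sub>R \<omega>)"
    unfolding trajectory_on_def by blast
  have "\<epsilon> * (a - (- v t / \<epsilon> - g (x t) + f (t *\<^sub>R \<omega>))) = 0"
    using a(3) assms(3) by (simp add: algebra_simps)
  then have "a = - v t / \<epsilon> - g (x t) + f (t *\<^sub>R \<omega>)" using assms(3) by simp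
  with a show "(x has_real_derivative v t) (at t within I)"
    "(v has_real_derivative - v t / \<epsilon> - g (x t) + f (t *\<^sub>R \<omega>)) (at t within I)" by auto
qed

lemma lyapunov_decay:
  assumes \<epsilon>: "0 < \<epsilon>" and L: "4 * \<epsilon>\<^sup>2 * L \<le> 1" and m: "0 < m" and g: "slopes_between m L g S"
    and tr: "trajectory_on \<epsilon> g f \<omega> I x v" "trajectory_on \<epsilon> g f \<omega> I x0 v0"
    and I: "{s..t} \<subseteq> I" "s \<le> t" and S: "\<And>r. s \<le> r \<Longrightarrow> r \<le> t \<Longrightarrow> x r \<in> S \<and> x0 r \<in> S"
  shows "lyapunov \<epsilon> (x t - x0 t) (v t - v0 t)
    \<le> exp (- (min (m * \<epsilon> / 2) (1 / (3 * \<epsilon>)) * (t - s))) * lyapunov \<epsilon> (x s - x0 s) (v s - v0 s)"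
proof (cases "s = t")
  case False
  with I have st: "s < t" by simp
  define \<kappa> where "\<kappa> = min (m * \<epsilon> / 2) (1 / (3 * \<epsilon>))"
  define V where "V r = lyapunov \<epsilon> (x r - x0 r) (v r - v0 r)" for r
  define V' where "V' r = - 2 * (v r - v0 r)\<^sup>2 - 2 * (x r - x0 r) * (g (x r) - g (x0 r))
      - 4 * \<epsilon> * (v r - v0 r) * (g (x r) - g (x0 r))" for r
  have dV: "(V has_real_derivative V' r) (at r within {s..t})" if "r \<in> {s..t}" for r
  proof -
    have r: "r \<in> I" using that I by auto
    have d: "(x has_real_derivative v r) (at r within {s..t})"
      "(v has_real_derivative - v r / \<epsilon> - g (x r) + f (r *\<^sub>R \<omega>)) (at r within {s..t})"
      "(x0 has_real_derivative v0 r) (at r within {s..t})"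
      "(v0 has_real_derivative - v0 r / \<epsilon> - g (x0 r) + f (r *\<^sub>R \<omega>)) (at r within {s..t})"
      using \<epsilon> by (rule_tac DERIV_subset[OF _ I(1)], rule_tac trajectory_onD[OF tr(1) r] trajectory_onD[OF tr(2) r], simp)+
    let ?y = "x r - x0 r" and ?w = "v r - v0 r" and ?G = "g (x r) - g (x0 r)"
    have w': "- v r / \<epsilon> - g (x r) + f (r *\<^sub>R \<omega>) - (- v0 r / \<epsilon> - g (x0 r) + f (r *\<^sub>R \<omega>)) = - ?w / \<epsilon> - ?G"
      by (simp add: diff_divide_distrib)
    have "(V has_real_derivative 2 * ?y * ?w / \<epsilon> + (2 * ?w * ?w + 2 * ?y * (- ?w / \<epsilon> - ?G))
        + 2 * \<epsilon> * (2 * ?w * (- ?w / \<epsilon> - ?G))) (at r within {s..t})"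
      unfolding V_def[abs_def] w'[symmetric]
      by (intro lyapunov_has_derivative DERIV_diff d)
    also have "2 * y * w / \<epsilon> + (2 * w * w + 2 * y * (- w / \<epsilon> - G)) + 2 * \<epsilon> * (2 * w * (- w / \<epsilon> - G))
        = - 2 * w\<^sup>2 - 2 * y * G - 4 * \<epsilon> * w * G" for y w G :: real
      using \<epsilon> by (simp add: field_simps power2_eq_square)
    finally show ?thesis unfolding V'_def .
  qed
  have V'_le: "V' r \<le> - \<kappa> * V r" if "r \<in> {s..t}" for r
    unfolding V'_def V_def \<kappa>_def
    by (rule lyapunov_derivative_le[OF \<epsilon> L m]) (use g S[of r] that in \<open>auto simp: slopes_between_def\<close>)
  let ?D = "\<lambda>r. \<kappa> * exp (\<kappa> * r) * V r + exp (\<kappa> * r) * V' r"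
  obtain r where r: "r \<in> {s<..<t}" "exp (\<kappa> * t) * V t - exp (\<kappa> * s) * V s = ?D r * (t - s)"
  proof -
    have "\<exists>r\<in>{s<..<t}. (\<lambda>r. exp (\<kappa> * r) * V r) t - (\<lambda>r. exp (\<kappa> * r) * V r) s = (*) (?D r) (t - s)"
    proof (rule mvt_simple[OF st])
      fix r assume "s \<le> r" "r \<le> t"
      then have "r \<in> {s..t}" by simp
      have "((\<lambda>r. exp (\<kappa> * r)) has_real_derivative exp (\<kappa> * r) * \<kappa>) (at r within {s..t})"
        by (auto intro!: derivative_eq_intros)
      from DERIV_mult[OF this dV[OF \<open>r \<in> {s..t}\<close>]]
      have "((\<lambda>r. exp (\<kappa> * r) * V r) has_real_derivative ?D r) (at r within {s..t})"
        by (simp add: mult_ac)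
      then show "((\<lambda>r. exp (\<kappa> * r) * V r) has_derivative (*) (?D r)) (at r within {s..t})"
        unfolding has_field_derivative_def .
    qed
    then show ?thesis using that by blast
  qed
  have "\<kappa> * exp (\<kappa> * r) * V r + exp (\<kappa> * r) * V' r = exp (\<kappa> * r) * (V' r + \<kappa> * V r)"
    by (simp add: algebra_simps)
  also have "\<dots> \<le> 0" using V'_le[of r] r(1) by (intro mult_nonneg_nonpos) auto
  finally have "?D r * (t - s) \<le> 0"
    using st by (intro mult_nonpos_nonneg) auto
  with r(2) have "exp (\<kappa> * t) * V t \<le> exp (\<kappa> * s) * V s" by simp
  then have "exp (- (\<kappa> * t)) * (exp (\<kappa> * t) * V t) \<le> exp (- (\<kappa> * t)) * (exp (\<kappa> * s) * V s)"
    by (rule mult_left_mono) simp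
  then have "V t \<le> exp (- (\<kappa> * (t - s))) * V s"
    by (simp add: right_diff_distrib exp_diff exp_minus field_simps)
  then show ?thesis by (simp add: V_def \<kappa>_def)
qed simp

lemma trajectory_stays_close:
  assumes \<epsilon>: "0 < \<epsilon>" and L: "4 * \<epsilon>\<^sup>2 * L \<le> 1" and m: "0 < m" and g: "slopes_between m L g (cball c (2 * r))"
    and tr: "trajectory_on \<epsilon> g f \<omega> {\<tau>..} x v" "trajectory_on \<epsilon> g f \<omega> {\<tau>..} x0 v0"
    and x0: "\<And>t. \<tau> \<le> t \<Longrightarrow> x0 t \<in> cball c r"
    and init: "2 * \<epsilon> * lyapunov \<epsilon> (x \<tau> - x0 \<tau>) (v \<tau> - v0 \<tau>) < r\<^sup>2" and r: "0 < r" and t: "\<tau> \<le> t"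
  shows "\<bar>x t - x0 t\<bar> < r"
proof (rule ccontr)
  assume "\<not> \<bar>x t - x0 t\<bar> < r"
  then have far: "r \<le> \<bar>x t - x0 t\<bar>" by simp
  define y where "y s = \<bar>x s - x0 s\<bar>" for s
  have near: "y s < r" if "(y s)\<^sup>2 \<le> 2 * \<epsilon> * lyapunov \<epsilon> (x \<tau> - x0 \<tau>) (v \<tau> - v0 \<tau>)" for s
    using that init r by (intro power2_less_imp_less[of "y s" r]) auto
  have y\<tau>: "y \<tau> < r" by (rule near) (use lyapunov_bounds(1)[OF \<epsilon>] in \<open>auto simp: y_def\<close>)
  have "continuous_on {\<tau>..} x" "continuous_on {\<tau>..} x0"
    using trajectory_onD(1)[OF tr(1)] trajectory_onD(1)[OF tr(2)] \<epsilon>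
    by (auto intro!: DERIV_continuous_on)
  then have yc: "continuous_on {\<tau>..} y" unfolding y_def by (intro continuous_intros)
  define A where "A = {s \<in> {\<tau>..t}. y s = r}"
  have "\<exists>s\<ge>\<tau>. s \<le> u \<and> y s = r" if "\<tau> \<le> u" "r \<le> y u" for u
    by (rule IVT') (use that y\<tau> in \<open>auto intro: continuous_on_subset[OF yc]\<close>)
  note ivt = this
  have "A \<noteq> {}" unfolding A_def using ivt[OF t] far by (auto simp: y_def)
  moreover have "compact A"
  proof -
    have "closed ({\<tau>..t} \<inter> y -` {r})"
      by (intro continuous_closed_preimage continuous_on_subset[OF yc]) auto
    moreover have "A = {\<tau>..t} \<inter> ({\<tau>..t} \<inter> y -` {r})" by (auto simp: A_def)
    ultimately show ?thesis by (metis compact_Icc compact_Int_closed)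
  qed
  ultimately obtain u where u: "u \<in> A" "\<And>s. s \<in> A \<Longrightarrow> u \<le> s"
    using compact_attains_inf[of A] by blast
  have le: "y s \<le> r" if "\<tau> \<le> s" "s \<le> u" for s
  proof (rule ccontr)
    assume "\<not> y s \<le> r"
    with ivt[of s] that obtain s' where s': "\<tau> \<le> s'" "s' \<le> s" "y s' = r" by auto
    then have "s' \<in> A" using that u(1) by (auto simp: A_def)
    from u(2)[OF this] s' that have "s = u" by simp
    with u(1) \<open>\<not> y s \<le> r\<close> show False by (simp add: A_def)
  qed
  have "lyapunov \<epsilon> (x u - x0 u) (v u - v0 u)
    \<le> exp (- (min (m * \<epsilon> / 2) (1 / (3 * \<epsilon>)) * (u - \<tau>))) * lyapunov \<epsilon> (x \<tau> - x0 \<tau>) (v \<tau> - v0 \<tau>)"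
  proof (rule lyapunov_decay[OF \<epsilon> L m g tr])
    show "{\<tau>..u} \<subseteq> {\<tau>..}" "\<tau> \<le> u" using u(1) by (auto simp: A_def)
    fix s assume s: "\<tau> \<le> s" "s \<le> u"
    then show "x s \<in> cball c (2 * r) \<and> x0 s \<in> cball c (2 * r)"
      using le[OF s] x0[OF s(1)] r by (auto simp: y_def dist_real_def)
  qed
  also have "\<dots> \<le> 1 * lyapunov \<epsilon> (x \<tau> - x0 \<tau>) (v \<tau> - v0 \<tau>)"
  proof (rule mult_right_mono)
    show "exp (- (min (m * \<epsilon> / 2) (1 / (3 * \<epsilon>)) * (u - \<tau>))) \<le> 1"
      using m \<epsilon> u(1) by (auto simp: A_def)
    have "0 \<le> \<epsilon> * (v \<tau> - v0 \<tau>)\<^sup>2" using \<epsilon> by simp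
    then show "0 \<le> lyapunov \<epsilon> (x \<tau> - x0 \<tau>) (v \<tau> - v0 \<tau>)"
      using lyapunov_bounds(2)[OF \<epsilon>] by (rule order.trans)
  qed
  finally have "2 * \<epsilon> * lyapunov \<epsilon> (x u - x0 u) (v u - v0 u) \<le> 2 * \<epsilon> * lyapunov \<epsilon> (x \<tau> - x0 \<tau>) (v \<tau> - v0 \<tau>)"
    using \<epsilon> by simp
  then have "y u < r"
    using lyapunov_bounds(1)[OF \<epsilon>, of "x u - x0 u" "v u - v0 u"] by (intro near) (simp add: y_def)
  with u(1) show False by (simp add: A_def)
qed

lemma trajectories_converge:
  assumes \<epsilon>: "0 < \<epsilon>" and L: "4 * \<epsilon>\<^sup>2 * L \<le> 1" and m: "0 < m" and g: "slopes_between m L g (cball c (2 * r))"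
    and tr: "trajectory_on \<epsilon> g f \<omega> {\<tau>..} x v" "trajectory_on \<epsilon> g f \<omega> {\<tau>..} x0 v0"
    and x0: "\<And>t. \<tau> \<le> t \<Longrightarrow> x0 t \<in> cball c r"
    and init: "2 * \<epsilon> * lyapunov \<epsilon> (x \<tau> - x0 \<tau>) (v \<tau> - v0 \<tau>) < r\<^sup>2" and r: "0 < r"
  shows "((\<lambda>t. dist (x t, v t) (x0 t, v0 t)) \<longlongrightarrow> 0) at_top"
proof -
  define \<kappa> where "\<kappa> = min (m * \<epsilon> / 2) (1 / (3 * \<epsilon>))"
  define V where "V t = lyapunov \<epsilon> (x t - x0 t) (v t - v0 t)" for t
  have \<kappa>: "\<kappa> > 0" using m \<epsilon> by (simp add: \<kappa>_def)
  have V: "V t \<le> exp (- (\<kappa> * (t - \<tau>))) * V \<tau>" if t: "\<tau> \<le> t" for t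
    unfolding V_def \<kappa>_def
  proof (rule lyapunov_decay[OF \<epsilon> L m g tr])
    show "{\<tau>..t} \<subseteq> {\<tau>..}" "\<tau> \<le> t" using t by auto
    fix s assume s: "\<tau> \<le> s" "s \<le> t"
    have "\<bar>x s - x0 s\<bar> < r"
      by (rule trajectory_stays_close[OF \<epsilon> L m g tr x0 init r s(1)])
    then show "x s \<in> cball c (2 * r) \<and> x0 s \<in> cball c (2 * r)"
      using x0[OF s(1)] r by (auto simp: dist_real_def)
  qed
  have "((\<lambda>t. exp (- (\<kappa> * (t - \<tau>)))) \<longlongrightarrow> 0) at_top"
  proof (rule filterlim_compose[OF exp_at_bot])
    have "filterlim (\<lambda>t. \<kappa> * (t - \<tau>)) at_top at_top"
      unfolding filterlim_at_top
    proof
      fix Z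
      show "\<forall>\<^sub>F t in at_top. Z \<le> \<kappa> * (t - \<tau>)"
        using eventually_ge_at_top[of "\<tau> + Z / \<kappa>"]
        by eventually_elim (use \<kappa> in \<open>simp add: field_simps\<close>)
    qed
    then show "filterlim (\<lambda>t. - (\<kappa> * (t - \<tau>))) at_bot at_top"
      by (rule filterlim_compose[OF filterlim_uminus_at_bot_at_top])
  qed
  from tendsto_mult_left_zero[OF this, of "(2 * \<epsilon> + 1 / \<epsilon>) * V \<tau>"]
  have lim: "((\<lambda>t. sqrt (exp (- (\<kappa> * (t - \<tau>))) * ((2 * \<epsilon> + 1 / \<epsilon>) * V \<tau>))) \<longlongrightarrow> sqrt 0) at_top"
    by (rule tendsto_real_sqrt)
  have le: "dist (x t, v t) (x0 t, v0 t) \<le> sqrt (exp (- (\<kappa> * (t - \<tau>))) * ((2 * \<epsilon> + 1 / \<epsilon>) * V \<tau>))" if t: "\<tau> \<le> t" for t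
  proof -
    have "(x t - x0 t)\<^sup>2 \<le> 2 * \<epsilon> * V t" "\<epsilon> * (v t - v0 t)\<^sup>2 \<le> V t"
      unfolding V_def by (rule lyapunov_bounds[OF \<epsilon>])+
    moreover from this(2) have "(v t - v0 t)\<^sup>2 \<le> V t / \<epsilon>"
      using \<epsilon> by (simp add: pos_le_divide_eq mult.commute)
    ultimately have "(x t - x0 t)\<^sup>2 + (v t - v0 t)\<^sup>2 \<le> (2 * \<epsilon> + 1 / \<epsilon>) * V t"
      by (simp add: distrib_right)
    also have "\<dots> \<le> (2 * \<epsilon> + 1 / \<epsilon>) * (exp (- (\<kappa> * (t - \<tau>))) * V \<tau>)"
      using \<epsilon> by (intro mult_left_mono V t) auto
    finally have "(x t - x0 t)\<^sup>2 + (v t - v0 t)\<^sup>2 \<le> exp (- (\<kappa> * (t - \<tau>))) * ((2 * \<epsilon> + 1 / \<epsilon>) * V \<tau>)"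
      by (simp add: mult_ac)
    then show ?thesis by (simp add: dist_prod_def dist_real_def)
  qed
  show ?thesis
  proof (rule Lim_null_comparison)
    show "\<forall>\<^sub>F t in at_top. norm (dist (x t, v t) (x0 t, v0 t)) \<le> sqrt (exp (- (\<kappa> * (t - \<tau>))) * ((2 * \<epsilon> + 1 / \<epsilon>) * V \<tau>))"
      using eventually_ge_at_top[of \<tau>] by eventually_elim (use le in simp)
    show "((\<lambda>t. sqrt (exp (- (\<kappa> * (t - \<tau>))) * ((2 * \<epsilon> + 1 / \<epsilon>) * V \<tau>))) \<longlongrightarrow> 0) at_top"
      using lim by simp
  qed
qed

lemma trajectory_on_subset:
  assumes "trajectory_on \<epsilon> g f \<omega> I x v" "J \<subseteq> I"
  shows "trajectory_on \<epsilon> g f \<omega> J x v"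
  unfolding trajectory_on_def
proof
  fix t assume "t \<in> J"
  then have "t \<in> I" using assms(2) by blast
  then obtain a where "(x has_real_derivative v t) (at t within I)" "(v has_real_derivative a) (at t within I)"
    and eq: "\<epsilon> * a + v t + \<epsilon> * g (x t) = \<epsilon> * f (t *\<^sub>R \<omega>)"
    using assms(1) unfolding trajectory_on_def by blast
  then have "(x has_real_derivative v t) (at t within J)" "(v has_real_derivative a) (at t within J)"
    by (simp_all add: DERIV_subset[OF _ assms(2)])
  with eq show "(x has_real_derivative v t) (at t within J) \<and> (\<exists>a. (v has_real_derivative a) (at t within J) \<and>
      \<epsilon> * a + v t + \<epsilon> * g (x t) = \<epsilon> * f (t *\<^sub>R \<omega>))" by blast
qed

lemma trajectory_on_cong:
  assumes "\<And>t. t \<in> I \<Longrightarrow> g (x t) = h (x t)"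
  shows "trajectory_on \<epsilon> g f \<omega> I x v \<longleftrightarrow> trajectory_on \<epsilon> h f \<omega> I x v"
  unfolding trajectory_on_def by (intro ball_cong refl) (simp add: assms)

lemma slopes_between_cong:
  assumes "slopes_between m L g S" "\<And>x. x \<in> S \<Longrightarrow> h x = g x"
  shows "slopes_between m L h S"
  using assms unfolding slopes_between_def by simp

lemma trajectory_exists:
  fixes f :: "real ^ 'd \<Rightarrow> real"
  assumes \<epsilon>: "0 < \<epsilon>" and g: "\<And>x y. \<bar>g x - g y\<bar> \<le> L * \<bar>x - y\<bar>"
    and f: "continuous_on UNIV f" "\<And>\<psi>. \<bar>f \<psi>\<bar> \<le> M"
  obtains x v where "trajectory_on \<epsilon> g f \<omega> {\<tau>..} x v" "x \<tau> = a" "v \<tau> = b"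
proof -
  have L: "0 \<le> L" using g[of 1 0] by simp
  define F where "F s u = (snd u, - snd u / \<epsilon> - g (fst u) + f (s *\<^sub>R \<omega>))" for s and u :: "real \<times> real"
  have gc: "continuous_on UNIV g"
    by (rule lipschitz_on_continuous_on[of L], rule lipschitz_onI) (use g L in \<open>auto simp: dist_real_def\<close>)
  have "\<exists>u. u \<tau> = (a, b) \<and> (\<forall>t\<ge>\<tau>. (u has_vector_derivative F t (u t)) (at t within {\<tau>..}))"
  proof (rule global_lipschitz_ode_exists)
    show "continuous_on UNIV (\<lambda>(s, u). F s u)"
      unfolding F_def case_prod_unfold
      by (intro continuous_intros continuous_on_compose2[OF gc] continuous_on_compose2[OF f(1)]) (use \<epsilon> in auto)
    fix s and u u' :: "real \<times> real"
    have n: "\<bar>fst (u - u')\<bar> \<le> norm (u - u')" "\<bar>snd (u - u')\<bar> \<le> norm (u - u')"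
      using norm_fst_le[of "fst (u - u')" "snd (u - u')"] norm_snd_le[of "snd (u - u')" "fst (u - u')"]
      by (simp_all only: prod.collapse real_norm_def)
    have "F s u - F s u' = (snd (u - u'), - (snd (u - u') / \<epsilon>) - (g (fst u) - g (fst u')))"
      by (simp add: F_def diff_divide_distrib)
    then have "norm (F s u - F s u') \<le> \<bar>snd (u - u')\<bar> + \<bar>- (snd (u - u') / \<epsilon>) - (g (fst u) - g (fst u'))\<bar>"
      using norm_Pair_le[of "snd (u - u')" "- (snd (u - u') / \<epsilon>) - (g (fst u) - g (fst u'))"] by simp
    also have "\<dots> \<le> \<bar>snd (u - u')\<bar> + (\<bar>snd (u - u')\<bar> / \<epsilon> + L * \<bar>fst (u - u')\<bar>)"
      using g[of "fst u" "fst u'"] \<epsilon> abs_triangle_ineq4[of "- (snd (u - u') / \<epsilon>)" "g (fst u) - g (fst u')"] by simp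
    also have "\<dots> \<le> norm (u - u') + (norm (u - u') / \<epsilon> + L * norm (u - u'))"
      using \<epsilon> L by (intro add_mono n divide_right_mono mult_left_mono) auto
    finally show "norm (F s u - F s u') \<le> (1 + 1 / \<epsilon> + L) * norm (u - u')"
      by (simp add: distrib_right)
  next
    fix s
    have "F s 0 = (0, f (s *\<^sub>R \<omega>) - g 0)" by (simp add: F_def)
    then have "norm (F s 0) = \<bar>f (s *\<^sub>R \<omega>) - g 0\<bar>" by (simp add: norm_Pair)
    then show "norm (F s 0) \<le> M + \<bar>g 0\<bar>" using f(2)[of "s *\<^sub>R \<omega>"] by linarith
  qed
  then obtain u where u: "u \<tau> = (a, b)" "\<And>t. \<tau> \<le> t \<Longrightarrow> (u has_vector_derivative F t (u t)) (at t within {\<tau>..})"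
    by blast
  show ?thesis
  proof (rule that[of "\<lambda>t. fst (u t)" "\<lambda>t. snd (u t)"])
    show "trajectory_on \<epsilon> g f \<omega> {\<tau>..} (\<lambda>t. fst (u t)) (\<lambda>t. snd (u t))"
      unfolding trajectory_on_def
    proof (intro ballI conjI exI)
      fix t assume "t \<in> {\<tau>..}"
      then have d: "(u has_vector_derivative F t (u t)) (at t within {\<tau>..})" using u(2) by simp
      show "((\<lambda>t. fst (u t)) has_real_derivative snd (u t)) (at t within {\<tau>..})"
        using bounded_linear.has_vector_derivative[OF bounded_linear_fst d]
        by (simp add: has_real_derivative_iff_has_vector_derivative F_def)
      show "((\<lambda>t. snd (u t)) has_real_derivative - snd (u t) / \<epsilon> - g (fst (u t)) + f (t *\<^sub>R \<omega>)) (at t within {\<tau>..})"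
        using bounded_linear.has_vector_derivative[OF bounded_linear_snd d]
        by (simp add: has_real_derivative_iff_has_vector_derivative F_def)
      show "\<epsilon> * (- snd (u t) / \<epsilon> - g (fst (u t)) + f (t *\<^sub>R \<omega>)) + snd (u t) + \<epsilon> * g (fst (u t)) = \<epsilon> * f (t *\<^sub>R \<omega>)"
        using \<epsilon> by (simp add: algebra_simps)
    qed
  qed (use u(1) in auto)
qed

text \<open>
  Freezing \<open>g\<close> outside of \<open>cball c (2 * r)\<close> makes it globally Lipschitz, so that trajectories exist for
  all times; by the Lyapunov bound they never leave \<open>cball c (2 * r)\<close> and hence solve the original equation.
\<close>

lemma solution_locally_attractive:
  fixes f :: "real ^ 'd \<Rightarrow> real"
  assumes \<epsilon>: "0 < \<epsilon>" "\<epsilon> \<le> 1" and L: "4 * \<epsilon>\<^sup>2 * L \<le> 1" and m: "0 < m"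
    and g: "slopes_between m L g (cball c (2 * r))" and r: "0 < r"
    and f: "continuous_on UNIV f" "\<And>\<psi>. \<bar>f \<psi>\<bar> \<le> M"
    and x0: "solution \<epsilon> g f \<omega> x0" "\<And>t. x0 t \<in> cball c r"
  shows "locally_attractive \<epsilon> g f \<omega> x0"
  unfolding locally_attractive_def
proof (intro allI)
  fix \<tau>
  define h where "h x = g (max (c - 2 * r) (min (c + 2 * r) x))" for x
  have h_eq: "h x = g x" if "x \<in> cball c (2 * r)" for x
  proof -
    have "max (c - 2 * r) (min (c + 2 * r) x) = x" using that by (auto simp: dist_real_def)
    then show ?thesis by (simp add: h_def)
  qed
  have L0: "0 \<le> L"
  proof -
    have "c + r \<in> cball c (2 * r)" "c \<in> cball c (2 * r)" using r by (auto simp: dist_real_def)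
    from g[unfolded slopes_between_def, rule_format, OF this] r have "\<bar>g (c + r) - g c\<bar> \<le> L * r" by simp
    then have "0 \<le> L * r" by linarith
    then show ?thesis using r by (simp add: zero_le_mult_iff)
  qed
  have h_lip: "\<bar>h x - h y\<bar> \<le> L * \<bar>x - y\<bar>" for x y
  proof -
    let ?p = "\<lambda>x. max (c - 2 * r) (min (c + 2 * r) x)"
    have "?p x \<in> cball c (2 * r)" "?p y \<in> cball c (2 * r)" using r by (auto simp: dist_real_def)
    then have "\<bar>h x - h y\<bar> \<le> L * \<bar>?p x - ?p y\<bar>" using g unfolding slopes_between_def h_def by blast
    also have "\<dots> \<le> L * \<bar>x - y\<bar>" by (intro mult_left_mono L0) auto
    finally show ?thesis .
  qed
  have h_slopes: "slopes_between m L h (cball c (2 * r))"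
    by (rule slopes_between_cong[OF g h_eq])
  have t0: "trajectory_on \<epsilon> g f \<omega> {\<tau>..} x0 (deriv x0)"
    using x0(1) unfolding solution_def by (rule trajectory_on_subset) simp
  have x0': "x0 t \<in> cball c (2 * r)" for t using x0(2)[of t] r by (auto simp: dist_real_def)
  have t0h: "trajectory_on \<epsilon> h f \<omega> {\<tau>..} x0 (deriv x0)"
    using t0 by (subst trajectory_on_cong[of _ h x0 g]) (auto intro!: h_eq x0')
  show "\<exists>\<delta>>0. \<forall>a b. dist (a, b) (x0 \<tau>, deriv x0 \<tau>) < \<delta> \<longrightarrow>
        (\<exists>x v. trajectory_on \<epsilon> g f \<omega> {\<tau>..} x v \<and> x \<tau> = a \<and> v \<tau> = b) \<and>
        (\<forall>x v. trajectory_on \<epsilon> g f \<omega> {\<tau>..} x v \<and> x \<tau> = a \<and> v \<tau> = b \<longrightarrow>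
           ((\<lambda>t. dist (x t, v t) (x0 t, deriv x0 t)) \<longlongrightarrow> 0) at_top)"
  proof (rule exI[of _ "r / 4"], intro conjI allI impI)
    show "0 < r / 4" using r by simp
    fix a b assume d: "dist (a, b) (x0 \<tau>, deriv x0 \<tau>) < r / 4"
    have init: "2 * \<epsilon> * lyapunov \<epsilon> (a - x0 \<tau>) (b - deriv x0 \<tau>) < r\<^sup>2"
    proof -
      let ?y = "a - x0 \<tau>" and ?w = "b - deriv x0 \<tau>"
      have "2 * \<epsilon> * lyapunov \<epsilon> ?y ?w \<le> 2 * \<epsilon> * (2 * ?y\<^sup>2 / \<epsilon> + 3 * \<epsilon> * ?w\<^sup>2)"
        by (intro mult_left_mono lyapunov_bounds \<epsilon>) (use \<epsilon> in simp)
      also have "\<dots> = 4 * ?y\<^sup>2 + 6 * (\<epsilon> * \<epsilon>) * ?w\<^sup>2" using \<epsilon> by (simp add: field_simps)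
      also have "\<dots> \<le> 6 * ?y\<^sup>2 + 6 * (1 * 1) * ?w\<^sup>2"
        using \<epsilon> by (intro add_mono mult_right_mono mult_left_mono mult_mono) auto
      also have "\<dots> = 6 * (dist (a, b) (x0 \<tau>, deriv x0 \<tau>))\<^sup>2"
        by (simp add: dist_prod_def dist_real_def)
      also have "\<dots> \<le> 6 * (r / 4)\<^sup>2"
        using d by (intro mult_left_mono power_mono) auto
      also have "\<dots> < r\<^sup>2" using r by (simp add: power2_eq_square field_simps)
      finally show ?thesis .
    qed
    show "\<exists>x v. trajectory_on \<epsilon> g f \<omega> {\<tau>..} x v \<and> x \<tau> = a \<and> v \<tau> = b"
    proof -
      obtain x v where xv: "trajectory_on \<epsilon> h f \<omega> {\<tau>..} x v" "x \<tau> = a" "v \<tau> = b"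
        by (rule trajectory_exists[OF \<epsilon>(1) h_lip f]) (rule that)
      have "\<bar>x t - x0 t\<bar> < r" if "\<tau> \<le> t" for t
        by (rule trajectory_stays_close[OF \<epsilon>(1) L m h_slopes xv(1) t0h x0(2) _ r that]) (use init xv in simp)
      then have "x t \<in> cball c (2 * r)" if "t \<in> {\<tau>..}" for t
        using x0(2)[of t] that by (force simp: dist_real_def)
      then have "trajectory_on \<epsilon> g f \<omega> {\<tau>..} x v"
        using xv(1) by (subst trajectory_on_cong[of _ g x h]) (auto simp: h_eq)
      with xv show ?thesis by blast
    qed
    fix x v assume xv: "trajectory_on \<epsilon> g f \<omega> {\<tau>..} x v \<and> x \<tau> = a \<and> v \<tau> = b"
    show "((\<lambda>t. dist (x t, v t) (x0 t, deriv x0 t)) \<longlongrightarrow> 0) at_top"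
      by (rule trajectories_converge[OF \<epsilon>(1) L m g _ t0 x0(2) _ r]) (use xv init in auto)
  qed
qed

lemma bounded_solutions_eq:
  assumes \<epsilon>: "0 < \<epsilon>" and L: "4 * \<epsilon>\<^sup>2 * L \<le> 1" and m: "0 < m" and g: "slopes_between m L g (cball c r)"
    and x: "solution \<epsilon> g f \<omega> x" "\<And>t. x t \<in> cball c r" "\<And>t. \<bar>deriv x t\<bar> \<le> 1"
    and x0: "solution \<epsilon> g f \<omega> x0" "\<And>t. x0 t \<in> cball c r" "\<And>t. \<bar>deriv x0 t\<bar> \<le> 1"
  shows "x = x0"
proof
  fix t
  define \<kappa> where "\<kappa> = min (m * \<epsilon> / 2) (1 / (3 * \<epsilon>))"
  define V where "V t = lyapunov \<epsilon> (x t - x0 t) (deriv x t - deriv x0 t)" for t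
  define B where "B = 2 * (2 * r)\<^sup>2 / \<epsilon> + 3 * \<epsilon> * 2\<^sup>2"
  have \<kappa>: "\<kappa> > 0" using m \<epsilon> by (simp add: \<kappa>_def)
  have V_le: "V s \<le> B" for s
  proof -
    have "\<bar>x s - x0 s\<bar> \<le> 2 * r" using x(2)[of s] x0(2)[of s] by (auto simp: dist_real_def)
    then have "(x s - x0 s)\<^sup>2 \<le> (2 * r)\<^sup>2" by (rule abs_le_square_iff[THEN iffD1, OF order.trans]) simp
    moreover have "\<bar>deriv x s - deriv x0 s\<bar> \<le> \<bar>2\<bar>" using x(3)[of s] x0(3)[of s] by linarith
    then have "(deriv x s - deriv x0 s)\<^sup>2 \<le> 2\<^sup>2" by (simp only: abs_le_square_iff)
    ultimately have "2 * (x s - x0 s)\<^sup>2 / \<epsilon> + 3 * \<epsilon> * (deriv x s - deriv x0 s)\<^sup>2 \<le> B"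
      unfolding B_def using \<epsilon> by (intro add_mono divide_right_mono mult_left_mono) auto
    then show ?thesis unfolding V_def by (rule order.trans[OF lyapunov_bounds(3)[OF \<epsilon>]])
  qed
  have "V t \<le> exp (- (\<kappa> * real n)) * B" for n
  proof -
    have "V t \<le> exp (- (\<kappa> * (t - (t - real n)))) * V (t - real n)"
      unfolding V_def \<kappa>_def
      by (rule lyapunov_decay[OF \<epsilon> L m g x(1)[unfolded solution_def] x0(1)[unfolded solution_def]])
        (use x x0 in auto)
    also have "\<dots> \<le> exp (- (\<kappa> * (t - (t - real n)))) * B" by (intro mult_left_mono V_le) simp
    finally show ?thesis by simp
  qed
  moreover have "(\<lambda>n. exp (- (\<kappa> * real n)) * B) \<longlonglongrightarrow> 0"
  proof (rule tendsto_mult_left_zero)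
    have "(\<lambda>n. exp (- \<kappa>) ^ n) \<longlonglongrightarrow> 0" by (rule LIMSEQ_realpow_zero) (use \<kappa> in auto)
    then show "(\<lambda>n. exp (- (\<kappa> * real n))) \<longlonglongrightarrow> 0"
      by (simp add: exp_of_nat_mult[symmetric] mult.commute)
  qed
  ultimately have "V t \<le> 0" by (intro LIMSEQ_le_const[where a = "V t"]) auto
  then have "2 * \<epsilon> * V t \<le> 0" using \<epsilon> by (simp add: mult_nonneg_nonpos)
  then have "(x t - x0 t)\<^sup>2 \<le> 0"
    using lyapunov_bounds(1)[OF \<epsilon>, of "x t - x0 t" "deriv x t - deriv x0 t"] unfolding V_def by linarith
  then have "(x t - x0 t)\<^sup>2 = 0" using zero_le_power2[of "x t - x0 t"] by linarith
  then show "x t = x0 t" by simp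
qed

lemma solution_reflect:
  assumes "solution \<epsilon> g f \<omega> x"
  shows "solution (- \<epsilon>) g f (- \<omega>) (\<lambda>t. x (- t))" "deriv (\<lambda>t. x (- t)) = (\<lambda>t. - deriv x (- t))"
proof -
  have x: "(x has_real_derivative deriv x t) (at t)" for t
    using assms unfolding solution_def trajectory_on_def by auto
  have d: "((\<lambda>t. x (- t)) has_real_derivative - deriv x (- t)) (at t)" for t
    using x[of "- t"] by (simp only: DERIV_mirror)
  then show D: "deriv (\<lambda>t. x (- t)) = (\<lambda>t. - deriv x (- t))"
    by (intro ext DERIV_imp_deriv)
  show "solution (- \<epsilon>) g f (- \<omega>) (\<lambda>t. x (- t))"
    unfolding solution_def trajectory_on_def D
  proof (intro ballI conjI)
    fix t :: real
    show "((\<lambda>t. x (- t)) has_real_derivative - deriv x (- t)) (at t)" by (rule d)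
    obtain a where a: "(deriv x has_real_derivative a) (at (- t))"
      "\<epsilon> * a + deriv x (- t) + \<epsilon> * g (x (- t)) = \<epsilon> * f ((- t) *\<^sub>R \<omega>)"
      using assms[unfolded solution_def trajectory_on_def, THEN bspec, of "- t"] by auto
    have "((\<lambda>t. - deriv x (- t)) has_real_derivative a) (at t)"
      using DERIV_minus[OF a(1)[unfolded DERIV_mirror]] by simp
    moreover have "- \<epsilon> * a + - deriv x (- t) + - \<epsilon> * g (x (- t)) = - \<epsilon> * f (t *\<^sub>R (- \<omega>))"
      using a(2) by simp
    ultimately show "\<exists>a. ((\<lambda>t. - deriv x (- t)) has_real_derivative a) (at t) \<and>
        - \<epsilon> * a + - deriv x (- t) + - \<epsilon> * g (x (- t)) = - \<epsilon> * f (t *\<^sub>R (- \<omega>))" by blast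
  qed
qed

lemma bounded_solutions_eq':
  assumes \<epsilon>: "\<epsilon> \<noteq> 0" and L: "4 * \<epsilon>\<^sup>2 * L \<le> 1" and m: "0 < m" and g: "slopes_between m L g (cball c r)"
    and x: "solution \<epsilon> g f \<omega> x" "\<And>t. x t \<in> cball c r" "\<And>t. \<bar>deriv x t\<bar> \<le> 1"
    and x0: "solution \<epsilon> g f \<omega> x0" "\<And>t. x0 t \<in> cball c r" "\<And>t. \<bar>deriv x0 t\<bar> \<le> 1"
  shows "x = x0"
proof (cases "0 < \<epsilon>")
  case True
  then show ?thesis by (rule bounded_solutions_eq[OF _ L m g x x0])
next
  case False
  then have \<epsilon>': "0 < - \<epsilon>" using \<epsilon> by simp
  have "(\<lambda>t. x (- t)) = (\<lambda>t. x0 (- t))"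
    by (rule bounded_solutions_eq[OF \<epsilon>' _ m g solution_reflect(1)[OF x(1)] _ _ solution_reflect(1)[OF x0(1)]])
      (use L x(2,3) x0(2,3) in \<open>auto simp: solution_reflect(2)[OF x(1)] solution_reflect(2)[OF x0(1)]\<close>)
  then have "x (- (- t)) = x0 (- (- t))" for t by (rule fun_cong)
  then show ?thesis by auto
qed

section \<open>The response solution\<close>

lemma real_analytic_powser:
  fixes g :: "real \<Rightarrow> real"
  assumes "real_analytic g"
  obtains R b where "0 < R" "summable (\<lambda>k. \<bar>b k\<bar> * R ^ k)"
    "\<forall>y. \<bar>y\<bar> \<le> R \<longrightarrow> g (c + y) = (\<Sum>k. b k * y ^ k)"
proof -
  obtain R a where R: "0 < R"
    and sum: "(\<lambda>\<alpha>. \<bar>a \<alpha>\<bar> * (\<Prod>b\<in>Basis. R ^ \<alpha> b)) summable_on ((Basis :: real set) \<rightarrow>\<^sub>E (UNIV :: nat set))"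
    and g: "\<forall>y. (\<forall>b\<in>Basis. \<bar>y \<bullet> b\<bar> \<le> R) \<longrightarrow>
       ((\<lambda>\<alpha>. a \<alpha> * (\<Prod>b\<in>Basis. (y \<bullet> b) ^ \<alpha> b)) has_sum g (c + y)) ((Basis :: real set) \<rightarrow>\<^sub>E (UNIV :: nat set))"
    by (rule real_analyticE[OF assms, where p = c]) (rule that)
  define h :: "nat \<Rightarrow> real \<Rightarrow> nat" where "h k = (\<lambda>x\<in>{1}. k)" for k
  have bij: "bij_betw h UNIV (Basis \<rightarrow>\<^sub>E UNIV)"
    by (rule bij_betwI[where g = "\<lambda>\<alpha>. \<alpha> 1"]) (auto simp: h_def PiE_iff extensional_def fun_eq_iff)
  show ?thesis
  proof (rule that[OF R])
    have "(\<lambda>k. \<bar>a (h k)\<bar> * R ^ k) summable_on UNIV"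
      using sum unfolding summable_on_reindex_bij_betw[OF bij, symmetric] by (simp add: h_def)
    then show "summable (\<lambda>k. \<bar>a (h k)\<bar> * R ^ k)" by (rule summable_on_imp_summable)
    show "\<forall>y. \<bar>y\<bar> \<le> R \<longrightarrow> g (c + y) = (\<Sum>k. a (h k) * y ^ k)"
    proof (intro allI impI)
      fix y :: real assume "\<bar>y\<bar> \<le> R"
      then have "((\<lambda>\<alpha>. a \<alpha> * (\<Prod>b\<in>Basis. (y \<bullet> b) ^ \<alpha> b)) has_sum g (c + y)) (Basis \<rightarrow>\<^sub>E (UNIV :: nat set))"
        using g by simp
      then have "((\<lambda>k. a (h k) * y ^ k) has_sum g (c + y)) UNIV"
        unfolding has_sum_reindex_bij_betw[OF bij, symmetric] by (simp add: h_def)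
      then show "g (c + y) = (\<Sum>k. a (h k) * y ^ k)" by (simp add: has_sum_imp_sums sums_unique)
    qed
  qed
qed

lemma real_analytic_expansion:
  fixes g :: "real \<Rightarrow> real"
  assumes "real_analytic g"
  obtains R b K where "0 < R" "summable (\<lambda>k. \<bar>b k\<bar> * R ^ k)" "0 \<le> K"
    "\<forall>y. \<bar>y\<bar> \<le> R \<longrightarrow> g (c + y) = g c + deriv g c * y + nonlin b y"
    "\<forall>r y z. r \<le> R / 2 \<longrightarrow> \<bar>y\<bar> \<le> r \<longrightarrow> \<bar>z\<bar> \<le> r \<longrightarrow> \<bar>nonlin b y - nonlin b z\<bar> \<le> K * r * \<bar>y - z\<bar>"
proof -
  obtain R b where R: "0 < R" and b: "summable (\<lambda>k. \<bar>b k\<bar> * R ^ k)"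
    and g: "\<forall>y. \<bar>y\<bar> \<le> R \<longrightarrow> g (c + y) = (\<Sum>k. b k * y ^ k)"
    by (rule real_analytic_powser[OF assms, where c = c]) (rule that)
  define K where "K = 2 / R\<^sup>2 * (\<Sum>k. \<bar>b k\<bar> * R ^ k)"
  have K: "0 \<le> K" unfolding K_def using R b by (intro mult_nonneg_nonneg suminf_nonneg) auto
  have lip: "\<bar>nonlin b y - nonlin b z\<bar> \<le> K * r * \<bar>y - z\<bar>" if "r \<le> R / 2" "\<bar>y\<bar> \<le> r" "\<bar>z\<bar> \<le> r" for r y z :: real
    using norm_nonlin_diff_le[OF b R that(1), of y z] that unfolding K_def by simp
  have exp: "g (c + y) = b 0 + b 1 * y + nonlin b y" if "\<bar>y\<bar> \<le> R" for y
    using nonlin_powser[OF b, of y] g that by simp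
  have g0: "g c = b 0" using exp[of 0] R by (simp add: nonlin_zero)
  have "(\<lambda>h. (g (c + h) - g c) / h - b 1) \<midarrow>0\<rightarrow> 0"
  proof (rule Lim_null_comparison)
    show "\<forall>\<^sub>F h in at 0. norm ((g (c + h) - g c) / h - b 1) \<le> K * \<bar>h\<bar>"
      unfolding eventually_at
    proof (intro exI conjI ballI impI)
      show "0 < R / 2" using R by simp
      fix h :: real assume "h \<noteq> 0 \<and> dist h 0 < R / 2"
      then have h: "h \<noteq> 0" "\<bar>h\<bar> \<le> R / 2" by auto
      have "(g (c + h) - g c) / h - b 1 = nonlin b h / h"
        using exp[of h] h R by (simp add: g0 field_simps)
      moreover have "\<bar>nonlin b h\<bar> \<le> K * \<bar>h\<bar> * \<bar>h\<bar>"
        using lip[of "\<bar>h\<bar>" h 0] h by (simp add: nonlin_zero)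
      ultimately show "norm ((g (c + h) - g c) / h - b 1) \<le> K * \<bar>h\<bar>"
        using h by (simp add: abs_divide pos_divide_le_eq)
    qed
    have "(\<lambda>h. K * \<bar>h\<bar>) \<midarrow>0\<rightarrow> K * \<bar>0\<bar>" by (intro tendsto_intros)
    then show "(\<lambda>h. K * \<bar>h\<bar>) \<midarrow>0\<rightarrow> 0" by simp
  qed
  then have "(g has_real_derivative b 1) (at c)"
    unfolding DERIV_def by (rule LIM_zero_cancel)
  then have "deriv g c = b 1" by (rule DERIV_imp_deriv)
  with exp g0 have "\<forall>y. \<bar>y\<bar> \<le> R \<longrightarrow> g (c + y) = g c + deriv g c * y + nonlin b y" by simp
  with R b K lip show ?thesis by (intro that[of R b K]) blast+
qed

lemma response_solution:
  fixes g :: "real \<Rightarrow> real" and f :: "real ^ 'd \<Rightarrow> real"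
  assumes g: "real_analytic g" and f: "torus_periodic f" "real_analytic f"
    and c0: "g c0 = torus_average f" and a: "deriv g c0 \<noteq> 0"
    and \<omega>: "rationally_independent \<omega>" and \<delta>: "0 < \<delta>"
  obtains \<epsilon>0 B X where "0 < \<epsilon>0" "\<epsilon>0 \<le> 1" "0 \<le> B"
    "\<forall>\<epsilon>. \<bar>\<epsilon>\<bar> < \<epsilon>0 \<longrightarrow> torus_periodic (\<lambda>\<psi>. X \<psi> \<epsilon>) \<and> real_analytic (\<lambda>\<psi>. X \<psi> \<epsilon>) \<and>
       solution \<epsilon> g f \<omega> (\<lambda>t. c0 + X (t *\<^sub>R \<omega>) \<epsilon>) \<and> (\<forall>\<psi>. \<bar>X \<psi> \<epsilon>\<bar> \<le> \<delta>) \<and>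
       (\<forall>t. \<bar>deriv (\<lambda>t. c0 + X (t *\<^sub>R \<omega>) \<epsilon>) t\<bar> \<le> \<bar>\<epsilon>\<bar> * B)"
    "uniform_limit UNIV (\<lambda>\<epsilon> \<psi>. X \<psi> \<epsilon>) (\<lambda>\<psi>. 0) (at 0)"
proof -
  define a where "a = deriv g c0"
  obtain R b K where R: "0 < R" and b: "summable (\<lambda>k. \<bar>b k\<bar> * R ^ k)"
    and g_eq: "\<forall>y. \<bar>y\<bar> \<le> R \<longrightarrow> g (c0 + y) = g c0 + deriv g c0 * y + nonlin b y"
    by (rule real_analytic_expansion[OF g, where c = c0]) (rule that)
  obtain \<rho> c where \<rho>: "1 < \<rho>" and c: "(\<lambda>\<nu>. norm (c \<nu>) * \<rho> ^ (\<Sum>i\<in>UNIV. nat \<bar>\<nu> $ i\<bar>)) summable_on UNIV"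
    and fc: "\<forall>\<psi>. of_real (f \<psi>) = (\<Sum>\<^sub>\<infinity>\<nu>. c \<nu> * mode \<nu> \<psi>)"
    and cnj: "\<forall>\<nu>. c (- \<nu>) = cnj (c \<nu>)" and c_0: "c 0 = of_real (torus_average f)"
    by (rule fourier_expansion[OF f]) (rule that)
  define c' where "c' = c(0 := 0)"
  have c'_sum: "(\<lambda>\<nu>. norm (c' \<nu>) * \<rho> ^ (\<Sum>i\<in>UNIV. nat \<bar>\<nu> $ i\<bar>)) summable_on UNIV"
    by (rule summable_on_comparison_test[OF c]) (use \<rho> in \<open>auto simp: c'_def\<close>)
  have c'_cnj: "c' (- \<nu>) = cnj (c' \<nu>)" for \<nu> using cnj by (simp add: c'_def)
  obtain q :: "'d index l1" where q: "\<forall>\<psi>. pairing q (tchar \<rho> \<psi>) = (\<Sum>\<^sub>\<infinity>\<nu>. c' \<nu> * mode \<nu> \<psi>)"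
    and q_nz: "\<forall>p. coef q p \<noteq> 0 \<longrightarrow> c' (freq p) \<noteq> 0" and q_star: "star prod.swap q = q"
    by (rule fourier_element[OF \<rho> c'_sum c'_cnj]) (rule that)
  note q = q[rule_format] and q_nz = q_nz[rule_format]
  have qf: "pairing q (tchar \<rho> \<psi>) = of_real (f \<psi> - g c0)" for \<psi>
  proof -
    have "(\<lambda>\<nu>. norm (c' \<nu> * mode \<nu> \<psi>)) summable_on UNIV"
    proof (rule summable_on_comparison_test[OF c'_sum])
      show "norm (c' \<nu> * mode \<nu> \<psi>) \<le> norm (c' \<nu>) * \<rho> ^ (\<Sum>i\<in>UNIV. nat \<bar>\<nu> $ i\<bar>)" for \<nu>
        using mult_left_mono[OF one_le_power[of \<rho> "\<Sum>i\<in>UNIV. nat \<bar>\<nu> $ i\<bar>"], of "norm (c' \<nu>)"] \<rho>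
        by (simp add: norm_mult)
    qed auto
    then have s1: "(\<lambda>\<nu>. c' \<nu> * mode \<nu> \<psi>) summable_on UNIV" by (rule abs_summable_summable)
    have s2: "(\<lambda>\<nu> :: int ^ 'd. if \<nu> = 0 then c 0 else 0) summable_on UNIV"
      by (rule finite_nonzero_values_imp_summable_on) (auto intro: finite_subset[of _ "{0}"])
    have "(\<Sum>\<^sub>\<infinity>\<nu> :: int ^ 'd. if \<nu> = 0 then c 0 else 0) = (\<Sum>\<^sub>\<infinity>\<nu>\<in>{0 :: int ^ 'd}. c 0)"
      by (rule infsum_cong_neutral) auto
    then have "(\<Sum>\<^sub>\<infinity>\<nu>. c' \<nu> * mode \<nu> \<psi> + (if \<nu> = 0 then c 0 else 0)) = (\<Sum>\<^sub>\<infinity>\<nu>. c' \<nu> * mode \<nu> \<psi>) + c 0"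
      using infsum_add[OF s1 s2] by simp
    moreover have "(\<lambda>\<nu>. c' \<nu> * mode \<nu> \<psi> + (if \<nu> = 0 then c 0 else 0)) = (\<lambda>\<nu>. c \<nu> * mode \<nu> \<psi>)"
      by (auto simp: c'_def)
    ultimately show ?thesis using fc q[of \<psi>] by (simp add: c_0 c0)
  qed
  define s where "s = rotation \<omega>"
  have s_nz: "coef q p = 0" if "s p = 0" for p
  proof (rule ccontr)
    assume "coef q p \<noteq> 0"
    then have "freq p \<noteq> 0" using q_nz[of p] by (auto simp: c'_def split: if_splits)
    then have "(\<Sum>i\<in>UNIV. \<omega> $ i * of_int (freq p $ i)) \<noteq> 0"
      using \<omega> unfolding rationally_independent_def by blast
    then show False using that by (simp add: s_def rotation_def mult.commute)
  qed
  have a0: "a \<noteq> 0" using a by (simp add: a_def)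
  have s_swap: "s (prod.swap p) = - s p" for p unfolding s_def by (rule rotation_swap)
  obtain \<epsilon>0 \<Xi> where \<epsilon>0: "0 < \<epsilon>0" "\<epsilon>0 \<le> 1"
    and \<Xi>_all: "\<forall>\<epsilon>. \<bar>\<epsilon>\<bar> < \<epsilon>0 \<longrightarrow> \<Xi> \<epsilon> = multiplier (\<lambda>m. resolvent a \<epsilon> (s m)) (q - nonlin b (\<Xi> \<epsilon>)) \<and>
       norm (\<Xi> \<epsilon>) \<le> \<delta> \<and> norm (\<Xi> \<epsilon>) \<le> R / 2 \<and> norm (nonlin b (\<Xi> \<epsilon>)) \<le> \<delta> \<and> star prod.swap (\<Xi> \<epsilon>) = \<Xi> \<epsilon>"
    and \<Xi>_lim: "(\<Xi> \<longlongrightarrow> 0) (at 0)"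
    by (rule quasi_periodic_fixed_point[where \<sigma> = prod.swap and a = a and b = b and R = R and s = s and q = q and \<delta> = \<delta>, OF a0 b R s_nz swap_swap swap_add s_swap q_star \<delta>]) (assumption, rule that)
  have \<Xi>: "\<Xi> \<epsilon> = multiplier (\<lambda>m. resolvent a \<epsilon> (s m)) (q - nonlin b (\<Xi> \<epsilon>))"
    and \<Xi>_small: "norm (\<Xi> \<epsilon>) \<le> \<delta>" "norm (\<Xi> \<epsilon>) \<le> R / 2" "norm (nonlin b (\<Xi> \<epsilon>)) \<le> \<delta>"
    and \<Xi>_star: "star prod.swap (\<Xi> \<epsilon>) = \<Xi> \<epsilon>" if "\<bar>\<epsilon>\<bar> < \<epsilon>0" for \<epsilon>
    using \<Xi>_all[THEN spec, THEN mp, OF that] by - (elim conjE, assumption)+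
  define X where "X \<psi> \<epsilon> = Re (pairing (\<Xi> \<epsilon>) (tchar \<rho> \<psi>))" for \<psi> \<epsilon>
  define B where "B = norm q + \<delta>"
  have X_norm: "\<bar>X \<psi> \<epsilon>\<bar> \<le> norm (\<Xi> \<epsilon>)" for \<psi> \<epsilon>
    using order.trans[OF abs_Re_le_cmod norm_pairing_le[of "tchar \<rho> \<psi>" 1 "\<Xi> \<epsilon>", OF norm_tchar_le[OF \<rho>]]]
    by (simp add: X_def)
  define w :: "'d index \<Rightarrow> complex" where "w p = of_real ((1 / \<rho>) ^ deg p)" for p
  have w_norm: "norm (w p) = (1 / \<rho>) ^ deg p" for p using \<rho> by (simp add: w_def norm_power norm_divide)
  obtain C where C: "\<And>p. \<bar>s p\<bar> ^ 3 * norm (w p) \<le> C"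
    using bdd_fun_rotation_tchar[OF \<rho>, of \<omega>] by (auto simp: s_def w_norm)
  have sw: "\<bar>s p\<bar> ^ k * norm (w p) \<le> 1 + C" if "k \<le> 3" for k p
  proof -
    have "\<bar>s p\<bar> ^ k \<le> 1 + \<bar>s p\<bar> ^ 3"
    proof (cases "\<bar>s p\<bar> \<le> 1")
      case True
      have "\<bar>s p\<bar> ^ k \<le> 1" by (rule power_le_one) (use True in auto)
      moreover have "0 \<le> \<bar>s p\<bar> ^ 3" by simp
      ultimately show ?thesis by linarith
    next
      case False
      then have "\<bar>s p\<bar> ^ k \<le> \<bar>s p\<bar> ^ 3" by (intro power_increasing that) simp
      then show ?thesis by simp
    qed
    then have "\<bar>s p\<bar> ^ k * norm (w p) \<le> (1 + \<bar>s p\<bar> ^ 3) * norm (w p)" by (rule mult_right_mono) simp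
    also have "\<dots> = norm (w p) + \<bar>s p\<bar> ^ 3 * norm (w p)" by (simp add: distrib_right)
    also have "\<dots> \<le> 1 + C" using C[of p] \<rho> by (intro add_mono) (simp_all add: w_norm power_le_one)
    finally show ?thesis .
  qed
  have char: "tchar \<rho> (t *\<^sub>R \<omega>) p = w p * cis (t * s p)" for t p
    by (simp add: tchar_def w_def s_def mode_rotation)
  have bw: "bdd_fun w" "bdd_fun (\<lambda>p. of_real (s p) * w p)" "bdd_fun (\<lambda>p. \<i> * of_real (s p) * w p)"
    "bdd_fun (\<lambda>p. of_real (s p) * (\<i> * of_real (s p) * w p))"
    using sw[of 0] sw[of 1] sw[of 2] unfolding bdd_fun_def by (auto simp: norm_mult power2_eq_square mult.assoc[symmetric])
  have main: "torus_periodic (\<lambda>\<psi>. X \<psi> \<epsilon>) \<and> real_analytic (\<lambda>\<psi>. X \<psi> \<epsilon>) \<and>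
       solution \<epsilon> g f \<omega> (\<lambda>t. c0 + X (t *\<^sub>R \<omega>) \<epsilon>) \<and> (\<forall>\<psi>. \<bar>X \<psi> \<epsilon>\<bar> \<le> \<delta>) \<and>
       (\<forall>t. \<bar>deriv (\<lambda>t. c0 + X (t *\<^sub>R \<omega>) \<epsilon>) t\<bar> \<le> \<bar>\<epsilon>\<bar> * B)" if \<epsilon>: "\<bar>\<epsilon>\<bar> < \<epsilon>0" for \<epsilon>
  proof -
    define x where "x = \<Xi> \<epsilon>"
    define Q where "Q = q - nonlin b x"
    define \<mu> where "\<mu> p = resolvent a \<epsilon> (s p)" for p
    have \<epsilon>1: "\<bar>\<epsilon>\<bar> \<le> 1" using \<epsilon> \<epsilon>0 by simp
    have xQ: "x = multiplier \<mu> Q" using \<Xi>[OF \<epsilon>] by (simp add: x_def Q_def \<mu>_def[abs_def])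
    have b\<mu>: "bdd_fun \<mu>" unfolding \<mu>_def[abs_def] by (rule bdd_fun_resolvent[OF a0 \<epsilon>1])
    have xR: "norm x \<le> R" using \<Xi>_small(2)[OF \<epsilon>] R unfolding x_def by linarith
    have real: "pairing x (tchar \<rho> \<psi>) = of_real (X \<psi> \<epsilon>)" for \<psi>
    proof -
      have "pairing x (tchar \<rho> \<psi>) = cnj (pairing x (\<lambda>p. cnj (tchar \<rho> \<psi> (prod.swap p))))"
        using pairing_star[of prod.swap x "tchar \<rho> \<psi>", OF swap_swap] unfolding x_def \<Xi>_star[OF \<epsilon>] .
      from arg_cong[OF this, of Im] have "Im (pairing x (tchar \<rho> \<psi>)) = 0"
        by (simp add: tchar_swap)
      then show ?thesis by (simp add: X_def x_def[symmetric] complex_eq_iff)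
    qed
    have nonlin_eq: "pairing (nonlin b x) (tchar \<rho> \<psi>) = of_real (nonlin b (X \<psi> \<epsilon>))" for \<psi>
    proof -
      have "pairing (nonlin b x) (tchar \<rho> \<psi>) = nonlin b (pairing x (tchar \<rho> \<psi>))"
      proof (rule nonlin_bounded_linear[OF b xR])
        show "bounded_linear (\<lambda>x. pairing x (tchar \<rho> \<psi>))"
          by (rule bounded_linear_pairing[OF bdd_fun_tchar[OF \<rho>]])
        show "pairing (x ^ n) (tchar \<rho> \<psi>) = pairing x (tchar \<rho> \<psi>) ^ n" for n
          by (rule pairing_power_character[OF bdd_fun_tchar[OF \<rho>] tchar_add tchar_zero])
      qed
      also have "\<dots> = of_real (nonlin b (X \<psi> \<epsilon>))"
        unfolding real
      proof (rule nonlin_bounded_linear[OF b, symmetric])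
        show "norm (X \<psi> \<epsilon>) \<le> R" using X_norm[of \<psi> \<epsilon>] xR by (simp add: x_def)
      qed (simp_all add: bounded_linear_of_real)
      finally show ?thesis .
    qed
    define ch where "ch t p = w p * cis (t * s p)" for t p
    define y where "y t = pairing x (ch t)" for t
    define y1 where "y1 t = pairing x (\<lambda>p. \<i> * of_real (s p) * w p * cis (t * s p))" for t
    define y2 where "y2 t = pairing x (\<lambda>p. \<i> * of_real (s p) * (\<i> * of_real (s p) * w p) * cis (t * s p))" for t
    have y: "y t = of_real (X (t *\<^sub>R \<omega>) \<epsilon>)" for t
      unfolding y_def real[symmetric] ch_def[abs_def] by (simp add: char[abs_def])
    have d1: "(y has_vector_derivative y1 t) (at t)" for t
      unfolding y_def[abs_def] y1_def ch_def
      by (rule pairing_has_derivative[OF bw(1,2), of "1 + C"]) (use sw[of 2] in simp)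
    have d2: "(y1 has_vector_derivative y2 t) (at t)" for t
      unfolding y1_def[abs_def] y2_def
      by (rule pairing_has_derivative[OF bw(3,4), of "1 + C"])
        (use sw[of 3] in \<open>simp add: norm_mult power2_eq_square power3_eq_cube mult.assoc[symmetric]\<close>)
    have bch: "bdd_fun (ch t)" "bdd_fun (\<lambda>p. \<i> * of_real (s p) * w p * cis (t * s p))"
      "bdd_fun (\<lambda>p. \<i> * of_real (s p) * (\<i> * of_real (s p) * w p) * cis (t * s p))" for t
      using bw unfolding bdd_fun_def by (simp_all add: ch_def norm_mult)
    have ode: "of_real \<epsilon> * y2 t + y1 t + of_real (\<epsilon> * a) * y t = of_real \<epsilon> * of_real (f (t *\<^sub>R \<omega>) - g c0 - nonlin b (X (t *\<^sub>R \<omega>) \<epsilon>))" for t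
    proof -
      have cm: "bdd_fun (\<lambda>p. k * \<phi> p)" if "bdd_fun \<phi>" for k and \<phi> :: "'d index \<Rightarrow> complex"
      proof -
        from that obtain M where "\<And>p. norm (\<phi> p) \<le> M" by (auto simp: bdd_fun_def)
        then have "norm (k * \<phi> p) \<le> norm k * M" for p by (simp add: norm_mult mult_left_mono)
        then show ?thesis unfolding bdd_fun_def by blast
      qed
      have ad: "bdd_fun (\<lambda>p. \<phi> p + \<phi>' p)" if "bdd_fun \<phi>" "bdd_fun \<phi>'" for \<phi> \<phi>' :: "'d index \<Rightarrow> complex"
      proof -
        from that obtain M M' where "\<And>p. norm (\<phi> p) \<le> M" "\<And>p. norm (\<phi>' p) \<le> M'" by (auto simp: bdd_fun_def)
        then have "norm (\<phi> p + \<phi>' p) \<le> M + M'" for p by (meson add_mono norm_triangle_le)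
        then show ?thesis unfolding bdd_fun_def by blast
      qed
      have "of_real \<epsilon> * y2 t + y1 t + of_real (\<epsilon> * a) * y t =
        pairing x (\<lambda>p. of_real \<epsilon> * (\<i> * of_real (s p) * (\<i> * of_real (s p) * w p) * cis (t * s p))
          + \<i> * of_real (s p) * w p * cis (t * s p) + of_real (\<epsilon> * a) * ch t p)"
        unfolding y_def y1_def y2_def
        by (simp add: pairing_add_fun[OF ad[OF cm[OF bch(3)] bch(2)] cm[OF bch(1)]]
          pairing_add_fun[OF cm[OF bch(3)] bch(2)] pairing_cmult_fun)
      also have "(\<lambda>p. of_real \<epsilon> * (\<i> * of_real (s p) * (\<i> * of_real (s p) * w p) * cis (t * s p))
          + \<i> * of_real (s p) * w p * cis (t * s p) + of_real (\<epsilon> * a) * ch t p)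
          = (\<lambda>p. (of_real (\<epsilon> * (a - (s p)\<^sup>2)) + \<i> * of_real (s p)) * ch t p)"
        by (rule ext) (simp add: ch_def algebra_simps power2_eq_square)
      also have "pairing x \<dots> = pairing Q (\<lambda>p. \<mu> p * ((of_real (\<epsilon> * (a - (s p)\<^sup>2)) + \<i> * of_real (s p)) * ch t p))"
        unfolding xQ by (rule pairing_multiplier[OF b\<mu>])
      also have "(\<lambda>p. \<mu> p * ((of_real (\<epsilon> * (a - (s p)\<^sup>2)) + \<i> * of_real (s p)) * ch t p)) = (\<lambda>p. of_real \<epsilon> * ch t p)"
      proof
        fix p
        show "\<mu> p * ((of_real (\<epsilon> * (a - (s p)\<^sup>2)) + \<i> * of_real (s p)) * ch t p) = of_real \<epsilon> * ch t p"
          unfolding \<mu>_def resolvent_solves[OF a0, of \<epsilon> "s p", symmetric] by (simp only: mult_ac)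
      qed
      also have "pairing Q \<dots> = of_real \<epsilon> * pairing Q (ch t)" by (rule pairing_cmult_fun)
      also have "pairing Q (ch t) = of_real (f (t *\<^sub>R \<omega>) - g c0 - nonlin b (X (t *\<^sub>R \<omega>) \<epsilon>))"
      proof -
        have "ch t = tchar \<rho> (t *\<^sub>R \<omega>)" by (rule ext) (simp add: ch_def char)
        moreover have "pairing Q (tchar \<rho> \<psi>) = pairing q (tchar \<rho> \<psi>) - pairing (nonlin b x) (tchar \<rho> \<psi>)" for \<psi>
          unfolding Q_def by (rule linear_diff[OF bounded_linear.linear[OF bounded_linear_pairing[OF bdd_fun_tchar[OF \<rho>]]]])
        ultimately show ?thesis by (simp add: qf nonlin_eq)
      qed
      finally show ?thesis .
    qed
    define z where "z t = c0 + X (t *\<^sub>R \<omega>) \<epsilon>" for t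
    have z_Re: "z t = c0 + Re (y t)" for t by (simp add: z_def y)
    have dz: "(z has_real_derivative Re (y1 t)) (at t)" for t
      unfolding z_Re[abs_def] has_real_derivative_iff_has_vector_derivative
      using bounded_linear.has_vector_derivative[OF bounded_linear_Re d1[of t]]
      by (auto intro!: derivative_eq_intros)
    have dz1: "((\<lambda>t. Re (y1 t)) has_real_derivative Re (y2 t)) (at t)" for t
      unfolding has_real_derivative_iff_has_vector_derivative
      by (rule bounded_linear.has_vector_derivative[OF bounded_linear_Re d2])
    have deriv_z: "deriv z = (\<lambda>t. Re (y1 t))" by (intro ext DERIV_imp_deriv dz)
    have "solution \<epsilon> g f \<omega> z"
      unfolding solution_def trajectory_on_def deriv_z
    proof (intro ballI conjI exI)
      fix t
      show "(z has_real_derivative Re (y1 t)) (at t)" "((\<lambda>t. Re (y1 t)) has_real_derivative Re (y2 t)) (at t)"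
        by (rule dz dz1)+
      have X: "\<bar>X (t *\<^sub>R \<omega>) \<epsilon>\<bar> \<le> R" using X_norm[of "t *\<^sub>R \<omega>" \<epsilon>] xR by (simp add: x_def)
      have "Re (of_real \<epsilon> * y2 t + y1 t + of_real (\<epsilon> * a) * y t)
          = Re (of_real \<epsilon> * of_real (f (t *\<^sub>R \<omega>) - g c0 - nonlin b (X (t *\<^sub>R \<omega>) \<epsilon>)))"
        unfolding ode ..
      then have "\<epsilon> * Re (y2 t) + Re (y1 t) + \<epsilon> * a * X (t *\<^sub>R \<omega>) \<epsilon> = \<epsilon> * (f (t *\<^sub>R \<omega>) - g c0 - nonlin b (X (t *\<^sub>R \<omega>) \<epsilon>))"
        unfolding y by simp
      moreover have "g (z t) = g c0 + a * X (t *\<^sub>R \<omega>) \<epsilon> + nonlin b (X (t *\<^sub>R \<omega>) \<epsilon>)"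
        unfolding z_def a_def using g_eq X by blast
      ultimately show "\<epsilon> * Re (y2 t) + Re (y1 t) + \<epsilon> * g (z t) = \<epsilon> * f (t *\<^sub>R \<omega>)"
        by (simp add: algebra_simps)
    qed
    moreover have "\<bar>deriv z t\<bar> \<le> \<bar>\<epsilon>\<bar> * B" for t
    proof -
      have "y1 t = pairing Q (\<lambda>p. \<mu> p * (\<i> * of_real (s p) * w p * cis (t * s p)))"
        unfolding y1_def xQ by (rule pairing_multiplier[OF b\<mu>])
      moreover have "norm (\<mu> p * (\<i> * of_real (s p) * w p * cis (t * s p))) \<le> \<bar>\<epsilon>\<bar>" for p
      proof -
        have "norm (\<mu> p * (\<i> * of_real (s p) * w p * cis (t * s p))) = norm (of_real (s p) * resolvent a \<epsilon> (s p)) * norm (w p)"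
          by (simp add: \<mu>_def norm_mult)
        also have "\<dots> \<le> \<bar>\<epsilon>\<bar> * 1"
          using \<rho> by (intro mult_mono norm_resolvent_le1) (simp_all add: w_norm power_le_one)
        finally show ?thesis by simp
      qed
      ultimately have "norm (y1 t) \<le> \<bar>\<epsilon>\<bar> * norm Q" by (simp only: norm_pairing_le)
      also have "\<dots> \<le> \<bar>\<epsilon>\<bar> * B"
        unfolding Q_def B_def
        by (intro mult_left_mono order.trans[OF norm_triangle_ineq4] add_left_mono)
          (use \<Xi>_small(3)[OF \<epsilon>] in \<open>simp_all add: x_def\<close>)
      finally show ?thesis unfolding deriv_z using abs_Re_le_cmod[of "y1 t"] by linarith
    qed
    moreover have "torus_periodic (\<lambda>\<psi>. X \<psi> \<epsilon>)"
      unfolding torus_periodic_def X_def tchar_def[abs_def] mode_periodic by simp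
    moreover have "real_analytic (\<lambda>\<psi>. X \<psi> \<epsilon>)"
      unfolding X_def by (rule pairing_tchar_real_analytic[OF \<rho>])
    moreover have "\<bar>X \<psi> \<epsilon>\<bar> \<le> \<delta>" for \<psi>
      using X_norm[of \<psi> \<epsilon>] \<Xi>_small(1)[OF \<epsilon>] by linarith
    ultimately show ?thesis unfolding z_def[abs_def] by blast
  qed
  show ?thesis
  proof (rule that[OF \<epsilon>0])
    show "0 \<le> B" using \<delta> by (simp add: B_def)
    show "\<forall>\<epsilon>. \<bar>\<epsilon>\<bar> < \<epsilon>0 \<longrightarrow> torus_periodic (\<lambda>\<psi>. X \<psi> \<epsilon>) \<and> real_analytic (\<lambda>\<psi>. X \<psi> \<epsilon>) \<and>
       solution \<epsilon> g f \<omega> (\<lambda>t. c0 + X (t *\<^sub>R \<omega>) \<epsilon>) \<and> (\<forall>\<psi>. \<bar>X \<psi> \<epsilon>\<bar> \<le> \<delta>) \<and>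
       (\<forall>t. \<bar>deriv (\<lambda>t. c0 + X (t *\<^sub>R \<omega>) \<epsilon>) t\<bar> \<le> \<bar>\<epsilon>\<bar> * B)"
      by (intro allI impI) (rule main)
    show "uniform_limit UNIV (\<lambda>\<epsilon> \<psi>. X \<psi> \<epsilon>) (\<lambda>\<psi>. 0) (at 0)"
    proof (rule uniform_limitI)
      fix e :: real assume "0 < e"
      then have "\<forall>\<^sub>F \<epsilon> in at 0. norm (\<Xi> \<epsilon>) < e" using tendstoD[OF \<Xi>_lim] by simp
      then show "\<forall>\<^sub>F \<epsilon> in at 0. \<forall>\<psi>\<in>UNIV. dist (X \<psi> \<epsilon>) 0 < e"
      proof eventually_elim
        case (elim \<epsilon>)
        show ?case using le_less_trans[OF X_norm elim] by simp
      qed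
    qed
  qed
qed

lemma quasi_periodic_torus:
  fixes h :: "real ^ 'd \<Rightarrow> real"
  assumes "torus_periodic h" "continuous_on UNIV h"
  shows "quasi_periodic (\<lambda>t. h (t *\<^sub>R \<omega>))"
proof -
  obtain e :: "'d \<Rightarrow> nat" where e: "bij_betw e UNIV {..<CARD('d)}"
    using ex_bij_betw_finite_nat[of "UNIV :: 'd set"] by (auto simp: atLeast0LessThan)
  have inj: "inj e" using e by (simp add: bij_betw_def)
  define F where "F \<phi> = h (\<chi> i. \<phi> (e i))" for \<phi> :: "nat \<Rightarrow> real"
  show ?thesis
    unfolding quasi_periodic_def
  proof (intro exI conjI allI impI)
    show "continuous_on UNIV F"
      unfolding F_def
      by (rule continuous_on_compose2[OF assms(2)]) (auto intro!: continuous_intros continuous_on_product_coordinates)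
    show "F \<phi> = F \<phi>'" if "\<forall>i<CARD('d). \<phi> i = \<phi>' i" for \<phi> \<phi>'
    proof -
      have "e i < CARD('d)" for i using e by (auto simp: bij_betw_def)
      then show ?thesis using that by (simp add: F_def)
    qed
    show "F (\<phi>(i := \<phi> i + 2 * pi)) = F \<phi>" if i: "i < CARD('d)" for \<phi> i
    proof -
      obtain j where j: "i = e j" using e i by (auto simp: bij_betw_def)
      have "(\<chi> k. (\<phi>(i := \<phi> i + 2 * pi)) (e k)) = (\<chi> k. \<phi> (e k)) + axis j (2 * pi)"
        using inj by (simp add: j vec_eq_iff axis_def inj_eq)
      then show ?thesis using assms(1) by (simp add: F_def torus_periodic_def)
    qed
    show "h (t *\<^sub>R \<omega>) = F (\<lambda>n. t * \<omega> $ (inv e n))" for t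
      using inj by (simp add: F_def) (rule arg_cong[of _ _ h], simp add: vec_eq_iff)
  qed
qed

lemma real_analytic_slopes:
  fixes g :: "real \<Rightarrow> real"
  assumes g: "real_analytic g" and a: "0 < deriv g c"
  obtains r where "0 < r" "slopes_between (deriv g c / 2) (3 * deriv g c / 2) g (cball c (2 * r))"
proof -
  obtain R b K where R: "0 < R" and K: "0 \<le> K"
    and exp: "\<forall>y. \<bar>y\<bar> \<le> R \<longrightarrow> g (c + y) = g c + deriv g c * y + nonlin b y"
    and lip: "\<forall>r y z. r \<le> R / 2 \<longrightarrow> \<bar>y\<bar> \<le> r \<longrightarrow> \<bar>z\<bar> \<le> r \<longrightarrow> \<bar>nonlin b y - nonlin b z\<bar> \<le> K * r * \<bar>y - z\<bar>"
    by (rule real_analytic_expansion[OF g, where c = c]) (rule that)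
  define r where "r = min (R / 2) (deriv g c / (2 * (K + 1)))"
  have "0 < r" using R K a by (simp add: r_def)
  moreover have "r \<le> R / 2" unfolding r_def by (rule min.cobounded1)
  ultimately have r: "0 < r" "r \<le> R / 2" .
  have cancel: "k * (d / (2 * k)) = d / 2" if "k \<noteq> 0" for k d :: real using that by simp
  have "(K + 1) * r \<le> (K + 1) * (deriv g c / (2 * (K + 1)))"
    using K by (intro mult_left_mono) (simp_all add: r_def)
  also have "\<dots> = deriv g c / 2" by (rule cancel) (use K in simp)
  finally have Kr: "K * r \<le> deriv g c / 2" using r by (simp add: distrib_right)
  have "slopes_between (deriv g c / 2) (3 * deriv g c / 2) g (cball c (2 * (r / 2)))"
    unfolding slopes_between_def
  proof (intro ballI)
    fix x y assume "x \<in> cball c (2 * (r / 2))" "y \<in> cball c (2 * (r / 2))"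
    then have xy: "\<bar>x - c\<bar> \<le> r" "\<bar>y - c\<bar> \<le> r" by (auto simp: dist_real_def)
    define N where "N = nonlin b (x - c) - nonlin b (y - c)"
    have "\<bar>N\<bar> \<le> K * r * \<bar>(x - c) - (y - c)\<bar>" unfolding N_def using lip r(2) xy by blast
    also have "\<dots> \<le> deriv g c / 2 * \<bar>x - y\<bar>" using mult_right_mono[OF Kr, of "\<bar>x - y\<bar>"] by simp
    finally have N: "\<bar>N\<bar> \<le> deriv g c / 2 * \<bar>x - y\<bar>" .
    have "g x = g c + deriv g c * (x - c) + nonlin b (x - c)" "g y = g c + deriv g c * (y - c) + nonlin b (y - c)"
      using exp[THEN spec, of "x - c"] exp[THEN spec, of "y - c"] xy r R by auto
    then have eq: "g x - g y = deriv g c * (x - y) + N" by (simp add: N_def algebra_simps)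
    have "\<bar>(x - y) * N\<bar> \<le> \<bar>x - y\<bar> * (deriv g c / 2 * \<bar>x - y\<bar>)"
      unfolding abs_mult by (intro mult_left_mono N) simp
    also have "\<dots> = deriv g c / 2 * (x - y)\<^sup>2" by (simp add: power2_eq_square)
    finally have "- (deriv g c / 2 * (x - y)\<^sup>2) \<le> (x - y) * N" by linarith
    moreover have "(x - y) * (g x - g y) = deriv g c * (x - y)\<^sup>2 + (x - y) * N"
      unfolding eq by (simp add: power2_eq_square algebra_simps)
    ultimately have 1: "deriv g c / 2 * (x - y)\<^sup>2 \<le> (x - y) * (g x - g y)" by linarith
    have "\<bar>g x - g y\<bar> \<le> \<bar>deriv g c * (x - y)\<bar> + \<bar>N\<bar>" unfolding eq by (rule abs_triangle_ineq)
    also have "\<dots> \<le> 3 * deriv g c / 2 * \<bar>x - y\<bar>" using N a by (simp add: abs_mult)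
    finally show "deriv g c / 2 * (x - y)\<^sup>2 \<le> (x - y) * (g x - g y) \<and> \<bar>g x - g y\<bar> \<le> 3 * deriv g c / 2 * \<bar>x - y\<bar>"
      using 1 by blast
  qed
  with r show ?thesis by (intro that[of "r / 2"]) auto
qed

theorem theorem1:
  fixes g :: "real \<Rightarrow> real" and f :: "real ^ 'd \<Rightarrow> real"
    and c0 :: real and \<omega> :: "real ^ 'd"
  assumes "real_analytic g"
    and "torus_periodic f" and "real_analytic f"
    and "g c0 = torus_average f" and "deriv g c0 \<noteq> 0"
    and "rationally_independent \<omega>"
  shows "\<exists>\<epsilon>0>0. \<exists>(X :: real ^ 'd \<Rightarrow> real \<Rightarrow> real) (x0 :: real \<Rightarrow> real \<Rightarrow> real).
     (\<forall>\<epsilon> t. x0 \<epsilon> t = c0 + X (t *\<^sub>R \<omega>) \<epsilon>) \<and>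
     (\<forall>\<epsilon>. \<bar>\<epsilon>\<bar> < \<epsilon>0 \<longrightarrow>
        torus_periodic (\<lambda>\<psi>. X \<psi> \<epsilon>) \<and> real_analytic (\<lambda>\<psi>. X \<psi> \<epsilon>) \<and>
        solution \<epsilon> g f \<omega> (x0 \<epsilon>) \<and> quasi_periodic (x0 \<epsilon>)) \<and>
     uniform_limit UNIV (\<lambda>\<epsilon> \<psi>. X \<psi> \<epsilon>) (\<lambda>\<psi>. 0) (at 0) \<and>
     (deriv g c0 > 0 \<longrightarrow>
        (\<forall>\<epsilon>. 0 < \<epsilon> \<and> \<epsilon> < \<epsilon>0 \<longrightarrow> locally_attractive \<epsilon> g f \<omega> (x0 \<epsilon>)) \<and>
        (\<exists>U. open U \<and> (c0, 0) \<in> U \<and>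
           (\<forall>\<epsilon>. 0 < \<bar>\<epsilon>\<bar> \<and> \<bar>\<epsilon>\<bar> < \<epsilon>0 \<longrightarrow>
              unique_quasi_periodic_in U \<epsilon> g f \<omega> (x0 \<epsilon>))))"
proof -
  define a where "a = deriv g c0"
  have "\<exists>r>0. 0 < a \<longrightarrow> slopes_between (a / 2) (3 * a / 2) g (cball c0 (2 * r))"
  proof (cases "0 < a")
    case True
    obtain r where "0 < r" "slopes_between (a / 2) (3 * a / 2) g (cball c0 (2 * r))"
      using real_analytic_slopes[OF assms(1) True[unfolded a_def]] unfolding a_def by metis
    then show ?thesis by blast
  qed (auto intro: exI[of _ 1])
  then obtain r where r: "0 < r"
    and slopes: "0 < a \<Longrightarrow> slopes_between (a / 2) (3 * a / 2) g (cball c0 (2 * r))" by blast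
  obtain \<epsilon>1 B X where \<epsilon>1: "0 < \<epsilon>1" "\<epsilon>1 \<le> 1" and B: "0 \<le> B"
    and X: "\<forall>\<epsilon>. \<bar>\<epsilon>\<bar> < \<epsilon>1 \<longrightarrow> torus_periodic (\<lambda>\<psi>. X \<psi> \<epsilon>) \<and> real_analytic (\<lambda>\<psi>. X \<psi> \<epsilon>) \<and>
       solution \<epsilon> g f \<omega> (\<lambda>t. c0 + X (t *\<^sub>R \<omega>) \<epsilon>) \<and> (\<forall>\<psi>. \<bar>X \<psi> \<epsilon>\<bar> \<le> r) \<and>
       (\<forall>t. \<bar>deriv (\<lambda>t. c0 + X (t *\<^sub>R \<omega>) \<epsilon>) t\<bar> \<le> \<bar>\<epsilon>\<bar> * B)"
    and lim: "uniform_limit UNIV (\<lambda>\<epsilon> \<psi>. X \<psi> \<epsilon>) (\<lambda>\<psi>. 0) (at 0)"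
    by (rule response_solution[OF assms r]) (rule that)
  define \<epsilon>0 where "\<epsilon>0 = min \<epsilon>1 (min (1 / (B + 1)) (1 / (6 * \<bar>a\<bar> + 1)))"
  have \<epsilon>0: "0 < \<epsilon>0" using \<epsilon>1 B by (simp add: \<epsilon>0_def add_nonneg_pos)
  define x0 where "x0 \<epsilon> t = c0 + X (t *\<^sub>R \<omega>) \<epsilon>" for \<epsilon> t
  have f_cont: "continuous_on UNIV f" by (rule real_analytic_continuous_on[OF assms(3)])
  have f_per: "f (\<psi> + axis i (2 * pi)) = f \<psi>" for \<psi> i
    using assms(2) unfolding torus_periodic_def by blast
  have "bounded (f ` torus_box)"
    by (intro compact_imp_bounded compact_continuous_image continuous_on_subset[OF f_cont]) auto
  then obtain M where "\<forall>\<psi>\<in>torus_box. \<bar>f \<psi>\<bar> \<le> M" by (auto simp: bounded_iff)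
  then have f_bound: "\<bar>f \<psi>\<bar> \<le> M" for \<psi>
    using periodic_torus_box[where h = f and \<psi> = \<psi>, OF f_per] by metis
  have small: "\<bar>\<epsilon>\<bar> < \<epsilon>1" "\<bar>\<epsilon>\<bar> \<le> 1" "\<bar>\<epsilon>\<bar> * B < 1" "4 * \<epsilon>\<^sup>2 * (3 * a / 2) \<le> 1" if \<epsilon>: "\<bar>\<epsilon>\<bar> < \<epsilon>0" for \<epsilon>
  proof -
    show e1: "\<bar>\<epsilon>\<bar> < \<epsilon>1" "\<bar>\<epsilon>\<bar> \<le> 1" using \<epsilon> \<epsilon>1 by (simp_all add: \<epsilon>0_def)
    have "\<bar>\<epsilon>\<bar> * B \<le> \<bar>\<epsilon>\<bar> * (B + 1)" by (intro mult_left_mono) auto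
    also have "\<dots> < 1" using \<epsilon> B by (simp add: \<epsilon>0_def pos_less_divide_eq)
    finally show "\<bar>\<epsilon>\<bar> * B < 1" .
    have "4 * \<epsilon>\<^sup>2 * (3 * a / 2) = \<bar>\<epsilon>\<bar> * (\<bar>\<epsilon>\<bar> * (6 * a))"
      by (simp add: power2_eq_square mult.assoc[symmetric])
    also have "\<dots> \<le> \<bar>\<epsilon>\<bar> * (\<bar>\<epsilon>\<bar> * (6 * \<bar>a\<bar>))"
      by (intro mult_left_mono) auto
    finally have "4 * \<epsilon>\<^sup>2 * (3 * a / 2) \<le> \<bar>\<epsilon>\<bar> * (\<bar>\<epsilon>\<bar> * (6 * \<bar>a\<bar>))" .
    also have "\<dots> \<le> 1 * (\<bar>\<epsilon>\<bar> * (6 * \<bar>a\<bar> + 1))" by (intro mult_mono e1 mult_left_mono) auto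
    also have "\<dots> \<le> 1" using \<epsilon> by (simp add: \<epsilon>0_def pos_less_divide_eq less_imp_le)
    finally show "4 * \<epsilon>\<^sup>2 * (3 * a / 2) \<le> 1" .
  qed
  have sol: "solution \<epsilon> g f \<omega> (x0 \<epsilon>)" "x0 \<epsilon> t \<in> cball c0 r" "\<bar>deriv (x0 \<epsilon>) t\<bar> < 1" if \<epsilon>: "\<bar>\<epsilon>\<bar> < \<epsilon>0" for \<epsilon> t
  proof -
    note X' = X[THEN spec, THEN mp, OF small(1)[OF \<epsilon>]]
    show "solution \<epsilon> g f \<omega> (x0 \<epsilon>)" using X' unfolding x0_def[abs_def] by blast
    show "x0 \<epsilon> t \<in> cball c0 r" using X' by (simp add: x0_def dist_real_def)
    have "\<bar>deriv (x0 \<epsilon>) t\<bar> \<le> \<bar>\<epsilon>\<bar> * B" using X' unfolding x0_def[abs_def] by blast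
    then show "\<bar>deriv (x0 \<epsilon>) t\<bar> < 1" using small(3)[OF \<epsilon>] by linarith
  qed
  have qp: "quasi_periodic (x0 \<epsilon>)" if \<epsilon>: "\<bar>\<epsilon>\<bar> < \<epsilon>0" for \<epsilon>
  proof -
    note X' = X[THEN spec, THEN mp, OF small(1)[OF \<epsilon>]]
    have "torus_periodic (\<lambda>\<psi>. c0 + X \<psi> \<epsilon>)" using X' unfolding torus_periodic_def by simp
    moreover have "continuous_on UNIV (\<lambda>\<psi>. c0 + X \<psi> \<epsilon>)"
      using X' by (intro continuous_intros real_analytic_continuous_on) blast
    ultimately show ?thesis unfolding x0_def[abs_def] by (rule quasi_periodic_torus)
  qed
  define U :: "(real \<times> real) set" where "U = ball c0 (2 * r) \<times> ball 0 1"
  have unique: "unique_quasi_periodic_in U \<epsilon> g f \<omega> (x0 \<epsilon>)"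
    if a: "0 < a" and \<epsilon>: "0 < \<bar>\<epsilon>\<bar>" "\<bar>\<epsilon>\<bar> < \<epsilon>0" for \<epsilon>
    unfolding unique_quasi_periodic_in_def
  proof (intro allI iffI)
    fix x assume x: "solution \<epsilon> g f \<omega> x \<and> quasi_periodic x \<and> (\<forall>t. (x t, deriv x t) \<in> U)"
    show "x = x0 \<epsilon>"
    proof (rule bounded_solutions_eq'[OF _ small(4)[OF \<epsilon>(2)] _ slopes[OF a]])
      show "x0 \<epsilon> t \<in> cball c0 (2 * r)" for t using sol(2)[OF \<epsilon>(2), of t] r by (simp add: dist_real_def)
      show "\<bar>deriv (x0 \<epsilon>) t\<bar> \<le> 1" for t using sol(3)[OF \<epsilon>(2), of t] by simp
      show "x t \<in> cball c0 (2 * r)" "\<bar>deriv x t\<bar> \<le> 1" for t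
        using x[THEN conjunct2, THEN conjunct2, THEN spec, of t] by (simp_all add: U_def dist_real_def)
    qed (use x a \<epsilon> sol(1)[OF \<epsilon>(2)] in auto)
  next
    fix x assume x: "x = x0 \<epsilon>"
    have "(x0 \<epsilon> t, deriv (x0 \<epsilon>) t) \<in> U" for t
      using sol(2,3)[OF \<epsilon>(2), of t] r by (simp add: U_def dist_real_def)
    then show "solution \<epsilon> g f \<omega> x \<and> quasi_periodic x \<and> (\<forall>t. (x t, deriv x t) \<in> U)"
      using sol(1)[OF \<epsilon>(2)] qp[OF \<epsilon>(2)] x by blast
  qed
  have attr: "locally_attractive \<epsilon> g f \<omega> (x0 \<epsilon>)" if a: "0 < a" and \<epsilon>: "0 < \<epsilon>" "\<epsilon> < \<epsilon>0" for \<epsilon>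
  proof -
    have \<epsilon>': "\<bar>\<epsilon>\<bar> < \<epsilon>0" using \<epsilon> by simp
    show ?thesis
      by (rule solution_locally_attractive[OF \<epsilon>(1) _ small(4)[OF \<epsilon>'] _ slopes[OF a] r f_cont f_bound sol(1)[OF \<epsilon>'] sol(2)[OF \<epsilon>']])
        (use small(2)[OF \<epsilon>'] a in auto)
  qed
  have U: "open U" "(c0, 0) \<in> U" using r by (auto simp: U_def intro: open_Times)
  show ?thesis
  proof (intro exI[of _ \<epsilon>0] conjI exI[of _ X] exI[of _ x0] allI impI)
    show "0 < \<epsilon>0" by (rule \<epsilon>0)
    show "x0 \<epsilon> t = c0 + X (t *\<^sub>R \<omega>) \<epsilon>" for \<epsilon> t by (simp add: x0_def)
    show "uniform_limit UNIV (\<lambda>\<epsilon> \<psi>. X \<psi> \<epsilon>) (\<lambda>\<psi>. 0) (at 0)" by (rule lim)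
    fix \<epsilon> assume \<epsilon>: "\<bar>\<epsilon>\<bar> < \<epsilon>0"
    show "torus_periodic (\<lambda>\<psi>. X \<psi> \<epsilon>)" "real_analytic (\<lambda>\<psi>. X \<psi> \<epsilon>)"
      using X[THEN spec, THEN mp, OF small(1)[OF \<epsilon>]] by blast+
    show "solution \<epsilon> g f \<omega> (x0 \<epsilon>)" by (rule sol(1)[OF \<epsilon>])
    show "quasi_periodic (x0 \<epsilon>)" by (rule qp[OF \<epsilon>])
  next
    fix \<epsilon> assume "0 < deriv g c0" "0 < \<epsilon> \<and> \<epsilon> < \<epsilon>0"
    then show "locally_attractive \<epsilon> g f \<omega> (x0 \<epsilon>)" by (intro attr) (simp_all add: a_def)
  next
    assume "0 < deriv g c0"
    with U unique show "\<exists>U. open U \<and> (c0, 0) \<in> U \<and>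
       (\<forall>\<epsilon>. 0 < \<bar>\<epsilon>\<bar> \<and> \<bar>\<epsilon>\<bar> < \<epsilon>0 \<longrightarrow> unique_quasi_periodic_in U \<epsilon> g f \<omega> (x0 \<epsilon>))"
      unfolding a_def by blast
  qed
qed

end
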